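(* Let $\lambda>0$ and let $\alpha:\mathbb{R}\to[c,d]\subset(1,2)$ and $b:\mathbb{R}\to(0,\infty)$ be continuously differentiable. Let $(\Gamma_i)_{i\ge1}$ be the sequence of arrival times of a Poisson process with unit rate, let $(V_i)_{i\ge1}$ be a sequence of i.i.d. random variables with distribution $\hat m(dx)=\sum_{j=1}^{\infty}2^{-j-1}\,\mathbf{1}_{[-j,-j+1)\cup[j-1,j)}(x)\,dx$ on $\mathbb{R}$, and let $(\gamma_i)_{i\ge1}$ be a sequence of i.i.d. random variables with $P(\gamma_i=1)=P(\gamma_i=-1)=1/2$. Assume that the three sequences $(\Gamma_i)_{i\ge1}$, $(V_i)_{i\ge1}$, $(\gamma_i)_{i\ge1}$ are independent, and define $$Y(t)=b(t)\,C_{\alpha(t)}^{1/\alpha(t)}\sum_{i=1}^{\infty}\sum_{j=1}^{\infty}\gamma_i\,\Gamma_i^{-1/\alpha(t)}\,2^{(j+1)/\alpha(t)}\,e^{-\lambda(V_i-t)}\,\mathbf{1}_{[t,+\infty)\cap([-j,-j+1)\cup[j-1,j))}(V_i)\qquad(t\in\mathbb{R}).$$ Then $Y$ is $1/\alpha(u)$-localisable at every $u\in\mathbb{R}$, with local form $Y'_u=b(u)L_{\alpha(u)}$.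
   Context: $C_\alpha=\left(\int_0^\infty x^{-\alpha}\sin(x)\,dx\right)^{-1}$. In the double sum, for each $i$ at most one index $j$ gives a non-zero term; the sum over $j$ is performed first. $L_\alpha$ denotes symmetric $\alpha$-stable Lévy motion, $L_\alpha(t)=\int_0^tM(dz)$, $t\in\mathbb{R}$ (with $\int_0^t=-\int_t^0$ for $t<0$), where $M$ is a symmetric $\alpha$-stable random measure on $\mathbb{R}$ with Lebesgue control measure; i.e. for $f\in L^\alpha(\mathbb{R})$, $\int f\,dM$ is symmetric $\alpha$-stable with characteristic function $\theta\mapsto\exp(-|\theta|^\alpha\int|f(x)|^\alpha dx)$, and $f\mapsto\int f\,dM$ is linear. Localisability: a process $Y=\{Y(t):t\in\mathbb{R}\}$ is $h$-localisable at $u$ if there is a non-trivial process $Y'_u=\{Y'_u(t):t\in\mathbb{R}\}$, called the local form of $Y$ at $u$, such that $r^{-h}(Y(u+rt)-Y(u))\to Y'_u(t)$ as $r\to0^+$ in the sense of convergence of finite-dimensional distributions (as processes in $t$). Local forms are identified up to equality of finite-dimensional distributions. *)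

theory Defs
  imports "HOL-Probability.Probability"
begin

text \<open>
  All sequences \<open>(x\<^sub>i)\<close>, \<open>i \<ge> 1\<close>, are indexed from \<open>0\<close>, that is, \<open>x i\<close> stands for \<open>x\<^sub>i\<^sub>+\<^sub>1\<close>.
\<close>

definition arrival_gap :: "(nat \<Rightarrow> 'a \<Rightarrow> real) \<Rightarrow> nat \<Rightarrow> 'a \<Rightarrow> real" where
  "arrival_gap \<Gamma> i \<omega> = (case i of 0 \<Rightarrow> \<Gamma> 0 \<omega> | Suc k \<Rightarrow> \<Gamma> (Suc k) \<omega> - \<Gamma> k \<omega>)"

text \<open>A unit-rate Poisson process is taken to be the renewal process with i.i.d. \<open>Exp(1)\<close>
  interarrival times; its arrival times are the partial sums of these.\<close>

definition unit_poisson_arrivals :: "'a measure \<Rightarrow> (nat \<Rightarrow> 'a \<Rightarrow> real) \<Rightarrow> bool" where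
  "unit_poisson_arrivals M \<Gamma> \<longleftrightarrow>
     prob_space.indep_vars M (\<lambda>_. borel) (arrival_gap \<Gamma>) UNIV \<and>
     (\<forall>i. distributed M lborel (arrival_gap \<Gamma> i) (exponential_density 1))"

definition block :: "nat \<Rightarrow> real set" where
  "block j = {- real j ..< - real j + 1} \<union> {real j - 1 ..< real j}"

definition mhat_density :: "real \<Rightarrow> real" where
  "mhat_density x = (\<Sum>j. 2 powr (- real (Suc j) - 1) * indicator (block (Suc j)) x)"

definition iid_mhat :: "'a measure \<Rightarrow> (nat \<Rightarrow> 'a \<Rightarrow> real) \<Rightarrow> bool" where
  "iid_mhat M V \<longleftrightarrow>
     prob_space.indep_vars M (\<lambda>_. borel) V UNIV \<and>
     (\<forall>i. distributed M lborel (V i) mhat_density)"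

definition iid_signs :: "'a measure \<Rightarrow> (nat \<Rightarrow> 'a \<Rightarrow> real) \<Rightarrow> bool" where
  "iid_signs M \<gamma> \<longleftrightarrow>
     prob_space.indep_vars M (\<lambda>_. borel) \<gamma> UNIV \<and>
     (\<forall>i. measure M {\<omega> \<in> space M. \<gamma> i \<omega> = 1} = 1 / 2 \<and>
          measure M {\<omega> \<in> space M. \<gamma> i \<omega> = - 1} = 1 / 2)"

text \<open>Mutual independence of three whole sequences, each viewed as one random element of the
  countable product space.\<close>

definition indep_sequences3 ::
    "'a measure \<Rightarrow> (nat \<Rightarrow> 'a \<Rightarrow> real) \<Rightarrow> (nat \<Rightarrow> 'a \<Rightarrow> real) \<Rightarrow> (nat \<Rightarrow> 'a \<Rightarrow> real) \<Rightarrow> bool" where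
  "indep_sequences3 M X Y Z \<longleftrightarrow>
     prob_space.indep_vars M (\<lambda>_. PiM UNIV (\<lambda>_. borel))
       (\<lambda>k \<omega> i. ([X, Y, Z] ! k) i \<omega>) {..<3::nat}"

text \<open>For \<open>1 < a < 2\<close> the integrand is absolutely integrable, so the Lebesgue integral is adequate.\<close>

definition C_const :: "real \<Rightarrow> real" where
  "C_const a = inverse (LINT x:{0<..}|lborel. x powr (- a) * sin x)"

definition series_process ::
    "real \<Rightarrow> (real \<Rightarrow> real) \<Rightarrow> (real \<Rightarrow> real) \<Rightarrow>
     (nat \<Rightarrow> 'a \<Rightarrow> real) \<Rightarrow> (nat \<Rightarrow> 'a \<Rightarrow> real) \<Rightarrow> (nat \<Rightarrow> 'a \<Rightarrow> real) \<Rightarrow> real \<Rightarrow> 'a \<Rightarrow> real" where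
  "series_process lam \<alpha> b \<Gamma> V \<gamma> t \<omega> =
     b t * C_const (\<alpha> t) powr (1 / \<alpha> t) *
     (\<Sum>i. \<Sum>j. \<gamma> i \<omega> * \<Gamma> i \<omega> powr (- 1 / \<alpha> t) * 2 powr ((real (Suc j) + 1) / \<alpha> t) *
        exp (- lam * (V i \<omega> - t)) * indicator ({t..} \<inter> block (Suc j)) (V i \<omega>))"

definition L_space :: "real \<Rightarrow> (real \<Rightarrow> real) set" where
  "L_space a = {f \<in> borel_measurable lborel. integrable lborel (\<lambda>x. \<bar>f x\<bar> powr a)}"

text \<open>The random measure is given by its integral: \<open>I f\<close> is the random variable written
  \<open>\<integral> f dM\<close>. Linearity holds up to null sets that may depend on the functions and scalars;
  with the marginal characteristic functions it fixes all joint laws.\<close>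

definition sas_random_measure ::
    "'b measure \<Rightarrow> real \<Rightarrow> ((real \<Rightarrow> real) \<Rightarrow> 'b \<Rightarrow> real) \<Rightarrow> bool" where
  "sas_random_measure N a I \<longleftrightarrow>
     prob_space N \<and>
     (\<forall>f \<in> L_space a. I f \<in> borel_measurable N \<and>
        (\<forall>\<theta>. char (distr N borel (I f)) \<theta> =
               of_real (exp (- (\<bar>\<theta>\<bar> powr a) * (LINT x|lborel. \<bar>f x\<bar> powr a))))) \<and>
     (\<forall>f \<in> L_space a. \<forall>g \<in> L_space a. \<forall>p q.
        AE \<omega> in N. I (\<lambda>x. p * f x + q * g x) \<omega> = p * I f \<omega> + q * I g \<omega>)"

definition levy_motion :: "((real \<Rightarrow> real) \<Rightarrow> 'b \<Rightarrow> real) \<Rightarrow> real \<Rightarrow> 'b \<Rightarrow> real" where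
  "levy_motion I t \<omega> = (if 0 \<le> t then I (indicator {0..t}) \<omega> else - I (indicator {t..0}) \<omega>)"

definition process :: "'a measure \<Rightarrow> (real \<Rightarrow> 'a \<Rightarrow> real) \<Rightarrow> bool" where
  "process M X \<longleftrightarrow> prob_space M \<and> (\<forall>t. X t \<in> borel_measurable M)"

definition nontrivial_process :: "'a measure \<Rightarrow> (real \<Rightarrow> 'a \<Rightarrow> real) \<Rightarrow> bool" where
  "nontrivial_process M X \<longleftrightarrow> (\<exists>t. \<not> (AE \<omega> in M. X t \<omega> = 0))"

text \<open>Weak convergence of the joint laws on \<open>\<real>\<^sup>T\<close> for every finite set \<open>T\<close> of times, tested against
  bounded continuous functions.\<close>

definition fdd_converges ::
    "'a measure \<Rightarrow> (real \<Rightarrow> real \<Rightarrow> 'a \<Rightarrow> real) \<Rightarrow> real filter \<Rightarrow>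
     'b measure \<Rightarrow> (real \<Rightarrow> 'b \<Rightarrow> real) \<Rightarrow> bool" where
  "fdd_converges M X F N Z \<longleftrightarrow>
     (\<forall>T f. finite T \<and> continuous_map (product_topology (\<lambda>_. euclideanreal) T) euclideanreal f \<and>
        bounded (f ` (T \<rightarrow>\<^sub>E UNIV)) \<longrightarrow>
        ((\<lambda>r. LINT \<omega>|M. f (restrict (\<lambda>t. X r t \<omega>) T)) \<longlongrightarrow>
           (LINT \<omega>|N. f (restrict (\<lambda>t. Z t \<omega>) T))) F)"

definition localisable_with_form ::
    "'a measure \<Rightarrow> (real \<Rightarrow> 'a \<Rightarrow> real) \<Rightarrow> real \<Rightarrow> real \<Rightarrow>
     'b measure \<Rightarrow> (real \<Rightarrow> 'b \<Rightarrow> real) \<Rightarrow> bool" where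
  "localisable_with_form M Y h u N Z \<longleftrightarrow>
     process M Y \<and> process N Z \<and> nontrivial_process N Z \<and>
     fdd_converges M (\<lambda>r t \<omega>. r powr (- h) * (Y (u + r * t) \<omega> - Y u \<omega>)) (at_right 0) N Z"

end

theory Submission
  imports Defs
begin

text \<open>
  Write \<open>m\<close> for the density of the \<open>V\<^sub>i\<close> and \<open>y\<^sub>i = \<Gamma>\<^sub>i m(V\<^sub>i)\<close>. On the \<open>j\<close>-th block \<open>m\<close> equals
  \<open>2\<^sup>-\<^sup>j\<^sup>-\<^sup>1\<close>, so the weight \<open>2\<close> to the power \<open>(j+1)/a\<close> is just \<open>m(V\<^sub>i)\<close> to the power \<open>-1/a\<close>, and
  \<open>Y(t) = B(t) (\<Sum>\<^sub>i \<gamma>\<^sub>i y\<^sub>i powr (-1/\<alpha>(t)) f\<^sub>t(V\<^sub>i))\<close> with \<open>f\<^sub>t(v) = exp (-\<lambda>(v-t)) 1[v \<ge> t]\<close> and the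
  differentiable amplitude \<open>B(t) = b(t) C\<^sub>\<alpha>\<^sub>(\<^sub>t\<^sub>) powr (1/\<alpha>(t))\<close>. The points \<open>(y\<^sub>i, V\<^sub>i)\<close> form a Poisson process
  on \<open>(0,\<infinity>) \<times> \<real>\<close> with Lebesgue intensity: the density of the marks has cancelled against the weights
  (\<open>campbell\<close>). Everything else is about random sums \<open>\<Sum>\<^sub>i \<gamma>\<^sub>i D(y\<^sub>i, V\<^sub>i)\<close> over these points.

  Two facts about such sums are needed. The first is analytic: the number
  \<open>\<integral>\<integral> min 1 (D\<^sup>2) dy dv\<close>, called the energy of \<open>D\<close>, controls the sum. If it is finite, the sum
  converges almost surely, and the energy bounds the tail of the sum (\<open>mark_sum_AE_summable\<close>,
  \<open>mark_sum_tail\<close>). By Campbell's formula almost surely only finitely many terms exceed \<open>1\<close>, and the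
  truncated terms are bounded martingale differences with summable variances. The second is exact:
  the characteristic function is \<open>exp (- \<integral>\<integral> (1 - cos D) dy dv)\<close> (\<open>mark_sum_char\<close>). It comes from a
  martingale in which the next gap, mark and sign are averaged out one at a time. For
  \<open>D(y,v) = f(v) y powr (-1/a)\<close> the double integral is \<open>\<integral>|f|\<^sup>a / C\<^sub>a\<close>, so, up to normalisation, the sum is
  the integral of \<open>f\<close> against a symmetric \<open>a\<close>-stable random measure. In particular such a measure exists.

  Now let \<open>a = \<alpha>(u)\<close> and \<open>s = u + rt\<close>. In the kernel of \<open>r powr (-1/a) (Y(s) - Y(u))\<close> the part
  \<open>r powr (-1/a) B(u) y powr (-1/a) (1[v \<ge> s] - 1[v \<ge> u])\<close> is the main term. By the scaling of the
  stable integral, the joint law in \<open>t\<close> of its sums is for every \<open>r > 0\<close> equal to that of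
  \<open>b(u) L\<^sub>a(t)\<close>: the joint characteristic functions agree (\<open>main_term_char\<close>,
  \<open>levy_motion_joint_char\<close>) and determine the joint laws (\<open>distr_PiM_eq_of_char_eq\<close>). The remaining
  kernel is Lipschitz at \<open>s = u\<close>, so it is at most \<open>C r powr (1-1/a) (y powr (-P) + y powr (-Q)) F(v)\<close>
  with \<open>1/2 < Q < P < 1\<close> and \<open>F\<close> a decaying exponential (\<open>increment_remainder_bound\<close>). As \<open>a > 1\<close>, its
  energy vanishes with \<open>r\<close>, and the remainder tends to \<open>0\<close> in probability
  (\<open>remainder_tendsto_0\<close>). A perturbation that vanishes in probability does not change the limit of
  expectations of bounded continuous functions (\<open>fdd_convergesI\<close>), which is the claim.
\<close>

section \<open>Integrals of powers against sine and cosine\<close>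

text \<open>
  One bound covers both ends of \<open>(0,\<infinity>)\<close>: it is quadratic at \<open>0\<close> and, coarsely, linear at
  infinity. With it \<open>z powr (-a) min 1 z\<close> dominates all integrands of this section.
\<close>

lemma one_minus_cos_le_min: "0 \<le> z \<Longrightarrow> 1 - cos z \<le> 2 * (z * min 1 z)" for z :: real
proof -
  assume z: "0 \<le> z"
  have c: "1 - cos z = 2 * (sin (z/2))^2"
    using cos_double_sin[of "z/2"] by simp
  have s: "\<bar>sin (z/2)\<bar> \<le> z / 2" using abs_sin_x_le_abs_x[of "z/2"] z by simp
  have "(z/2)^2 \<le> z * z" by (simp add: power2_eq_square)
  moreover have "(sin (z/2))^2 \<le> (z/2)^2" using s abs_le_square_iff[of "sin (z/2)" "z/2"] z by simp
  moreover have "\<bar>sin (z/2)\<bar> * \<bar>sin (z/2)\<bar> \<le> \<bar>sin (z/2)\<bar> * 1" by (intro mult_left_mono) auto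
  then have "(sin (z/2))^2 \<le> \<bar>sin (z/2)\<bar>" by (simp add: power2_eq_square)
  then have "(sin (z/2))^2 \<le> z/2" using s by linarith
  ultimately show ?thesis
    unfolding c using z by (auto simp: min_def)
qed

lemma abs_sin_le_min: "0 \<le> z \<Longrightarrow> \<bar>sin z\<bar> \<le> min 1 z" for z :: real
  using abs_sin_x_le_abs_x[of z] by auto

lemma powr_min_integrable:
  fixes a :: real assumes a: "1 < a" "a < 2"
  shows "set_integrable lborel {0<..} (\<lambda>z::real. z powr (-a) * min 1 z)"
proof -
  have 1: "((\<lambda>z. z powr (1 - a)) has_integral (1 powr (1 - a + 1) / (1 - a + 1))) {0..1::real}"
    by (rule has_integral_powr_from_0) (use a in auto)
  have 2: "((\<lambda>z. z powr (-a)) has_integral -(1 powr (-a + 1)) / (-a + 1)) {1::real..}"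
    by (rule has_integral_powr_to_inf) (use a in auto)
  have i1: "(\<integral>\<^sup>+ z. ennreal (indicator {0..1} z * z powr (1 - a)) \<partial>lborel) < \<infinity>"
    using nn_integral_has_integral_lebesgue[OF _ 1] by simp
  have i2: "(\<integral>\<^sup>+ z. ennreal (indicator {1..} z * z powr (-a)) \<partial>lborel) < \<infinity>"
    using nn_integral_has_integral_lebesgue[OF _ 2] by simp
  have "(\<integral>\<^sup>+ z. ennreal (norm (indicator {0<..} z *\<^sub>R (z powr (-a) * min 1 z))) \<partial>lborel)
     \<le> (\<integral>\<^sup>+ z. ennreal (indicator {0..1} z * z powr (1 - a)) + ennreal (indicator {1..} z * z powr (-a)) \<partial>lborel)"
  proof (rule nn_integral_mono)
    fix z :: real
    have "norm (indicator {0<..} z *\<^sub>R (z powr (-a) * min 1 z)) \<le> indicator {0..1} z * z powr (1 - a) + indicator {1..} z * z powr (-a)"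
      by (auto simp: indicator_def min_def powr_diff powr_minus field_simps)
    then show "ennreal (norm (indicator {0<..} z *\<^sub>R (z powr (-a) * min 1 z)))
      \<le> ennreal (indicator {0..1} z * z powr (1 - a)) + ennreal (indicator {1..} z * z powr (-a))"
      by (subst ennreal_plus[symmetric]) (simp_all only: ennreal_leI, auto)
  qed
  also have "\<dots> < \<infinity>" using i1 i2 by (subst nn_integral_add) auto
  finally show ?thesis
    unfolding set_integrable_def by (subst integrable_iff_bounded) auto
qed

text \<open>
  The reciprocal of the constant \<open>C\<^sub>a\<close>.
\<close>

definition sine_moment :: "real \<Rightarrow> real" where
  "sine_moment a = (LINT x:{0<..}|lborel. x powr (- a) * sin x)"

lemma sine_moment_integrable:
  fixes a :: real assumes a: "1 < a" "a < 2"
  shows "set_integrable lborel {0<..} (\<lambda>x. x powr (- a) * sin x)"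
proof (rule set_integrable_bound[OF powr_min_integrable[OF a]])
  show "AE x in lborel. x \<in> {0<..} \<longrightarrow> norm (x powr (- a) * sin x) \<le> norm (x powr (- a) * min 1 x)"
    by (intro AE_I2 impI) (simp add: abs_mult mult_left_mono abs_sin_le_min del: min.bounded_iff)
qed (simp add: set_borel_measurable_def)

text \<open>
  Integration by parts: the integrands differ by the derivative of \<open>-(1 - cos z) z powr (-a)\<close>, which
  vanishes at \<open>0\<close> because \<open>a < 2\<close> and at infinity because \<open>a > 0\<close>.
\<close>

lemma one_minus_cos_moment:
  fixes a :: real assumes a: "1 < a" "a < 2"
  shows "set_integrable lborel {0<..} (\<lambda>z. a * (1 - cos z) * z powr (- a - 1))" (is ?i)
    and "(LINT z:{0<..}|lborel. a * (1 - cos z) * z powr (- a - 1)) = sine_moment a" (is ?e)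
proof -
  have "set_integrable lborel {0<..} (\<lambda>z::real. (2 * a) * (z powr (-a) * min 1 z))"
    by (rule set_integrable_mult_right) (use powr_min_integrable[OF a] in auto)
  then show i: ?i
  proof (rule set_integrable_bound)
    show "AE x in lborel. x \<in> {0<..} \<longrightarrow> norm (a * (1 - cos x) * x powr (- a - 1)) \<le> norm (2 * a * (x powr - a * min 1 x))"
    proof (intro AE_I2 impI)
      fix x :: real assume "x \<in> {0<..}"
      then have x: "x > 0" by simp
      have "a * (1 - cos x) * x powr (- a - 1) \<le> a * (2 * (x * min 1 x)) * x powr (- a - 1)"
        using one_minus_cos_le_min[of x] x a by (intro mult_right_mono mult_left_mono) auto
      also have "\<dots> = 2 * a * (x powr - a * min 1 x)"
        using x by (simp add: powr_diff)
      finally show "norm (a * (1 - cos x) * x powr (- a - 1)) \<le> norm (2 * a * (x powr - a * min 1 x))"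
        using a x by (simp add: abs_mult)
    qed
  qed (simp add: set_borel_measurable_def)
  \<comment> \<open>?F is the primitive; near \<open>0\<close> it is of order \<open>z powr (2 - a)\<close>.\<close>
  let ?F = "\<lambda>z::real. - (1 - cos z) * z powr (- a)"
  let ?f = "\<lambda>z::real. a * (1 - cos z) * z powr (- a - 1) - z powr (- a) * sin z"
  have fi: "set_integrable lborel {0<..} ?f"
    by (intro set_integral_diff i sine_moment_integrable a)
  have "(LBINT x=0..\<infinity>. ?f x) = 0 - 0"
  proof (rule interval_integral_FTC_integrable)
    show "(?F has_vector_derivative ?f x) (at x)" if "0 < ereal x" for x
      using that unfolding has_real_derivative_iff_has_vector_derivative[symmetric]
      by (auto intro!: derivative_eq_intros simp: zero_ereal_def powr_diff field_simps)
    show "isCont ?f x" if "0 < ereal x" for x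
      using that by (auto intro!: continuous_intros simp: zero_ereal_def)
    show "set_integrable lborel (einterval 0 \<infinity>) ?f"
      using fi by (simp add: einterval_def zero_ereal_def greaterThan_def)
    have b: "norm (?F z) \<le> 2 * z powr (2 - a)" "norm (?F z) \<le> 2 * z powr (- a)" if "z > 0" for z
    proof -
      have "norm (?F z) = (1 - cos z) * z powr (- a)" using that by (simp add: abs_mult)
      moreover have "(1 - cos z) * z powr (-a) \<le> (2 * (z * z)) * z powr (- a)"
        using order_trans[OF one_minus_cos_le_min[of z], of "2 * (z * z)"] that by (intro mult_right_mono) auto
      moreover have "(2 * (z * z)) * z powr (- a) = 2 * z powr (2 - a)"
        using that by (simp add: powr_diff powr_minus field_simps power2_eq_square)
      moreover have "(1 - cos z) * z powr (-a) \<le> 2 * z powr (- a)"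
        using cos_ge_minus_one[of z] by (intro mult_right_mono) auto
      ultimately show "norm (?F z) \<le> 2 * z powr (2 - a)" "norm (?F z) \<le> 2 * z powr (- a)" by simp_all
    qed
    have "((\<lambda>z. 2 * z powr (2 - a)) \<longlongrightarrow> 2 * 0 powr (2 - a)) (at_right (0::real))"
      using a by (intro tendsto_intros) (auto intro: eventually_at_right_less[THEN eventually_mono])
    then have l0: "((\<lambda>z. 2 * z powr (2 - a)) \<longlongrightarrow> 0) (at_right (0::real))" by simp
    have "(?F \<longlongrightarrow> 0) (at_right 0)"
      by (rule Lim_null_comparison[OF _ l0]) (use b in \<open>auto simp: eventually_at_filter\<close>)
    then show "((?F \<circ> real_of_ereal) \<longlongrightarrow> 0) (at_right 0)"
      unfolding zero_ereal_def ereal_tendsto_simps by simp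
    have "((\<lambda>z. 2 * z powr (- a)) \<longlongrightarrow> 2 * 0) (at_top::real filter)"
      using a by (intro tendsto_intros tendsto_neg_powr filterlim_ident) auto
    then have linf: "((\<lambda>z. 2 * z powr (- a)) \<longlongrightarrow> 0) (at_top::real filter)" by simp
    have "(?F \<longlongrightarrow> 0) at_top"
    proof (rule Lim_null_comparison[OF _ linf])
      show "eventually (\<lambda>z. norm (?F z) \<le> 2 * z powr (- a)) at_top"
        using eventually_gt_at_top[of 0] by eventually_elim (rule b(2))
    qed
    then show "((?F \<circ> real_of_ereal) \<longlongrightarrow> 0) (at_left \<infinity>)"
      unfolding ereal_tendsto_simps by simp
  qed simp
  then have "(LINT z:{0<..}|lborel. ?f z) = 0"
    by (simp add: interval_lebesgue_integral_0_infty)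
  then show ?e
    using set_integral_diff(2)[OF i sine_moment_integrable[OF a]] by (simp add: sine_moment_def)
qed

text \<open>
  The substitution \<open>y = z powr (-a)\<close> turns the intensity \<open>dy\<close> into the stable Levy density
  \<open>a z powr (-a-1) dz\<close>. This is where \<open>C\<^sub>a\<close> enters the theorem.
\<close>

lemma one_minus_cos_powr_integral:
  assumes a: "1 < a" "a < 2"
  shows "(\<integral>\<^sup>+ y\<in>{0<..}. ennreal (1 - cos (y powr (- 1 / a))) \<partial>lborel) = ennreal (sine_moment a)"
proof -
  let ?g = "\<lambda>z::real. z powr (- a)" and ?g' = "\<lambda>z::real. - a * z powr (- a - 1)"
  let ?f = "\<lambda>y::real. 1 - cos (y powr (- 1 / a))"
  have img: "?g ` {0<..} = {0<..}"
  proof safe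
    fix y :: real assume "y > 0"
    then show "y \<in> ?g ` {0<..}" using a
      by (intro image_eqI[where x="y powr (- 1 / a)"]) (auto simp: powr_powr)
  qed auto
  have inj: "inj_on ?g {0<..}"
    by (rule inj_onI) (use a in \<open>auto simp: powr_def\<close>)
  note m = one_minus_cos_moment[OF a]
  have eq: "\<bar>?g' z\<bar> * ?f (?g z) = a * (1 - cos z) * z powr (- a - 1)" if "z \<in> {0<..}" for z
    using that a by (simp add: powr_powr abs_mult)
  have ai: "(\<lambda>z. a * (1 - cos z) * z powr (- a - 1)) absolutely_integrable_on {0<..}"
    using m(1) unfolding set_integrable_def by (intro integrable_completion[THEN iffD2]) auto
  have "(\<lambda>z. \<bar>?g' z\<bar> * ?f (?g z)) absolutely_integrable_on {0<..} \<and>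
        integral {0<..} (\<lambda>z. \<bar>?g' z\<bar> * ?f (?g z)) = sine_moment a"
  proof
    show "(\<lambda>z. \<bar>?g' z\<bar> * ?f (?g z)) absolutely_integrable_on {0<..}"
      by (subst set_integrable_cong[OF refl refl, where f'="\<lambda>z. a * (1 - cos z) * z powr (- a - 1)"]) (use ai eq in auto)
    have "integral {0<..} (\<lambda>z. \<bar>?g' z\<bar> * ?f (?g z)) = integral {0<..} (\<lambda>z. a * (1 - cos z) * z powr (- a - 1))"
      using eq by (rule integral_cong)
    then show "integral {0<..} (\<lambda>z. \<bar>?g' z\<bar> * ?f (?g z)) = sine_moment a"
      using m(2) set_borel_integral_eq_integral(2)[OF m(1)] by simp
  qed
  then have "?f absolutely_integrable_on (?g ` {0<..}) \<and> integral (?g ` {0<..}) ?f = sine_moment a"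
    by (subst (asm) has_absolute_integral_change_of_variables_1')
       (auto intro!: derivative_eq_intros inj)
  then have "(?f has_integral sine_moment a) {0<..}"
    unfolding img absolutely_integrable_on_def by (auto dest: integrable_integral)
  then have "(\<integral>\<^sup>+ y. ennreal (indicator {0<..} y * ?f y) \<partial>lborel) = ennreal (sine_moment a)"
    by (intro nn_integral_has_integral_lebesgue) auto
  moreover have "(\<integral>\<^sup>+ y\<in>{0<..}. ennreal (?f y) \<partial>lborel) = (\<integral>\<^sup>+ y. ennreal (indicator {0<..} y * ?f y) \<partial>lborel)"
    by (intro nn_integral_cong) (auto simp: indicator_def)
  ultimately show ?thesis by simp
qed

text \<open>
  The sine integral is not visibly positive, but it equals an integral of \<open>1 - cos\<close>.
\<close>

lemma sine_moment_pos:
  assumes a: "1 < a" "a < 2"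
  shows "sine_moment a > 0"
proof -
  have "sine_moment a \<noteq> 0" "sine_moment a \<ge> 0"
  proof -
    show "sine_moment a \<ge> 0"
      using one_minus_cos_moment(2)[OF a, symmetric] a unfolding set_lebesgue_integral_def
      by (auto intro!: integral_nonneg_AE AE_I2)
    show "sine_moment a \<noteq> 0"
    proof
      assume "sine_moment a = 0"
      then have "(\<integral>\<^sup>+ y\<in>{0<..}. ennreal (1 - cos (y powr (- 1 / a))) \<partial>lborel) = 0"
        using one_minus_cos_powr_integral[OF a] by simp
      then have "AE y in lborel. ennreal (1 - cos (y powr (- 1 / a))) * indicator {0<..} y = 0"
        by (subst (asm) nn_integral_0_iff_AE) auto
      then have "AE y in lborel. y \<notin> {1<..<2::real}"
      proof eventually_elim
        case (elim y)
        show ?case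
        proof
          assume y: "y \<in> {1<..<2}"
          then have "0 < y powr (- 1 / a)" "y powr (- 1 / a) < 1"
            using a powr_less_mono2_neg[of "-1/a" 1 y] by auto
          then have "cos (y powr (- 1 / a)) < cos 0"
            using pi_gt3 by (intro cos_monotone_0_pi) auto
          then show False using elim y by (auto simp: indicator_def ennreal_eq_0_iff)
        qed
      qed
      then have "emeasure lborel {1<..<2::real} = 0"
        by (subst (asm) AE_iff_measurable[of "{1<..<2}"]) auto
      then show False by simp
    qed
  qed
  then show ?thesis by simp
qed

text \<open>
  The substitution \<open>y = |c| powr (1/p) x\<close>; it is the source of the self-similarity of stable integrals.
\<close>

lemma nn_integral_power_scaling:
  fixes h :: "real \<Rightarrow> ennreal"
  assumes [measurable]: "h \<in> borel_measurable borel" and even: "\<And>x. h (- x) = h x" and "h 0 = 0" and p: "p > 0"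
  shows "(\<integral>\<^sup>+ y\<in>{0<..}. h (c * y powr (- p)) \<partial>lborel) = ennreal (\<bar>c\<bar> powr (1 / p)) * (\<integral>\<^sup>+ y\<in>{0<..}. h (y powr (- p)) \<partial>lborel)"
proof (cases "c = 0")
  case False
  define k where "k = \<bar>c\<bar> powr (1 / p)"
  have k: "k > 0" using False by (simp add: k_def)
  have "k powr (- p) = inverse \<bar>c\<bar>"
    using False p by (simp add: k_def powr_powr powr_minus)
  then have e: "\<bar>c\<bar> * (k * y) powr (- p) = y powr (- p)" if "y > 0" for y
    using False k that by (simp add: powr_mult)
  have habs: "h \<bar>x\<bar> = h x" for x using even[of x] by (simp add: abs_if)
  have "(\<integral>\<^sup>+ y\<in>{0<..}. h (c * y powr (- p)) \<partial>lborel)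
      = \<bar>k\<bar> * (\<integral>\<^sup>+ y. h (c * (0 + k * y) powr (- p)) * indicator {0<..} (0 + k * y) \<partial>lborel)"
    by (rule nn_integral_real_affine) (use k in auto)
  also have "(\<integral>\<^sup>+ y. h (c * (0 + k * y) powr (- p)) * indicator {0<..} (0 + k * y) \<partial>lborel)
     = (\<integral>\<^sup>+ y\<in>{0<..}. h (y powr (- p)) \<partial>lborel)"
  proof (rule nn_integral_cong)
    fix y :: real
    show "h (c * (0 + k * y) powr (- p)) * indicator {0<..} (0 + k * y) = h (y powr (- p)) * indicator {0<..} y"
    proof (cases "y > 0")
      case True
      have "h (c * (k * y) powr (- p)) = h (\<bar>c\<bar> * (k * y) powr (- p))"
        using habs[of "c * (k * y) powr (- p)"] by (simp add: abs_mult)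
      then show ?thesis using True k e by simp
    qed (use k in \<open>auto simp: indicator_def zero_less_mult_iff\<close>)
  qed
  finally show ?thesis using k by (simp add: k_def)
qed (use p assms(3) in simp)

lemma one_minus_cos_scaled_integral:
  assumes a: "1 < a" "a < 2"
  shows "(\<integral>\<^sup>+ y\<in>{0<..}. ennreal (1 - cos (c * y powr (- 1 / a))) \<partial>lborel) = ennreal (\<bar>c\<bar> powr a * sine_moment a)"
  using nn_integral_power_scaling[of "\<lambda>x. ennreal (1 - cos x)" "1/a" c] one_minus_cos_powr_integral[OF a] a
    sine_moment_pos[OF a]
  by (simp add: ennreal_mult)

text \<open>
  Here \<open>p > 1/2\<close> gives integrability at infinity; the truncation takes care of \<open>0\<close>.
\<close>

lemma truncated_power_integral:
  assumes p: "1/2 < p" "p < 1"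
  obtains K where "K \<ge> 0" "\<And>c. (\<integral>\<^sup>+ y\<in>{0<..}. ennreal (min 1 ((c * y powr (- p))\<^sup>2)) \<partial>lborel) = ennreal (\<bar>c\<bar> powr (1 / p) * K)"
proof -
  define I where "I = (\<integral>\<^sup>+ y\<in>{0<..}. ennreal (min 1 ((y powr (- p))\<^sup>2)) \<partial>lborel)"
  have s: "1 < 2 * p" "2 * p < 2" using p by auto
  have "I \<le> (\<integral>\<^sup>+ y. ennreal (norm (indicator {0<..} y *\<^sub>R (y powr (- (2 * p)) * min 1 y))) \<partial>lborel)"
    unfolding I_def
  proof (rule nn_integral_mono)
    fix y :: real
    have "min 1 ((y powr (- p))\<^sup>2) \<le> y powr (- (2 * p)) * min 1 y" if y: "y > 0"
    proof (cases "y \<le> 1")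
      case True
      have "1 \<le> y powr (1 - 2 * p)"
        using powr_mono2'[of "1 - 2 * p" y 1] y True s by simp
      also have "\<dots> = y powr (- (2 * p)) * min 1 y" using y True by (simp add: powr_diff powr_minus field_simps)
      finally show ?thesis by simp
    next
      case False
      have "(y powr (- p))\<^sup>2 = y powr (- (2 * p))"
        using y by (simp add: power2_eq_square flip: powr_add)
      then show ?thesis using False by simp
    qed
    then show "ennreal (min 1 ((y powr (- p))\<^sup>2)) * indicator {0<..} y \<le> ennreal (norm (indicator {0<..} y *\<^sub>R (y powr (- (2 * p)) * min 1 y)))"
      by (auto simp: indicator_def intro!: ennreal_leI order_trans[OF _ abs_ge_self])
  qed
  also have "\<dots> < \<infinity>"
    using powr_min_integrable[OF s] unfolding set_integrable_def integrable_iff_bounded by simp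
  finally obtain K where K: "K \<ge> 0" "I = ennreal K" by (cases I) auto
  show ?thesis
  proof (rule that[OF K(1)])
    fix c
    show "(\<integral>\<^sup>+ y\<in>{0<..}. ennreal (min 1 ((c * y powr (- p))\<^sup>2)) \<partial>lborel) = ennreal (\<bar>c\<bar> powr (1 / p) * K)"
      using nn_integral_power_scaling[of "\<lambda>x. ennreal (min 1 (x\<^sup>2))" p c] p K
      by (simp add: I_def ennreal_mult)
  qed
qed

text \<open>
  Mean value theorem in the exponent. The logarithm that it produces is absorbed by widening the range
  of exponents by \<open>\<eta>\<close> on both sides.
\<close>

lemma powr_exponent_difference:
  fixes y :: real
  assumes y: "y > 0" and p: "l \<le> p" "p \<le> h" and q: "l \<le> q" "q \<le> h" and e: "\<eta> > 0"
  shows "\<bar>y powr (- p) - y powr (- q)\<bar> \<le> \<bar>p - q\<bar> / \<eta> * (y powr (- (h + \<eta>)) + y powr (- (l - \<eta>)))"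
proof -
  have ln: "\<bar>ln y\<bar> * y powr (- \<xi>) \<le> (y powr (- (h + \<eta>)) + y powr (- (l - \<eta>))) / \<eta>" if "l \<le> \<xi>" "\<xi> \<le> h" for \<xi>
  proof (cases "y \<ge> 1")
    case True
    have "\<bar>ln y\<bar> * y powr (- \<xi>) \<le> (y powr \<eta> / \<eta>) * y powr (- l)"
      using ln_powr_bound[OF True e] True that e by (intro mult_mono powr_mono) auto
    also have "\<dots> = y powr (- (l - \<eta>)) / \<eta>" using y by (simp add: powr_diff powr_minus field_simps)
    also have "\<dots> \<le> (y powr (- (h + \<eta>)) + y powr (- (l - \<eta>))) / \<eta>"
      using e by (intro divide_right_mono) auto
    finally show ?thesis .
  next
    case False
    have "ln (inverse y) \<le> inverse y powr \<eta> / \<eta>"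
      by (rule ln_powr_bound) (use y False e in \<open>auto simp: one_le_inverse_iff\<close>)
    then have "\<bar>ln y\<bar> \<le> y powr (- \<eta>) / \<eta>"
      using y False by (simp add: ln_inverse powr_minus inverse_powr)
    then have "\<bar>ln y\<bar> * y powr (- \<xi>) \<le> (y powr (- \<eta>) / \<eta>) * y powr (- h)"
      using y False that e by (intro mult_mono powr_mono') auto
    also have "\<dots> = y powr (- (h + \<eta>)) / \<eta>" using y by (simp add: powr_diff powr_minus powr_add field_simps)
    also have "\<dots> \<le> (y powr (- (h + \<eta>)) + y powr (- (l - \<eta>))) / \<eta>"
      using e by (intro divide_right_mono) auto
    finally show ?thesis .
  qed
  have "norm (y powr (- p) - y powr (- q)) \<le> ((y powr (- (h + \<eta>)) + y powr (- (l - \<eta>))) / \<eta>) * norm (p - q)"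
  proof (rule field_differentiable_bound[where S="{l..h}" and f'="\<lambda>x. - ln y * y powr (- x)"])
    show "((\<lambda>a. y powr - a) has_field_derivative - ln y * y powr - z) (at z within {l..h})" if "z \<in> {l..h}" for z
      using DERIV_powr[OF DERIV_const[of y] y DERIV_minus[OF DERIV_ident], of z]
      by (rule_tac has_field_derivative_at_within) (simp add: mult.commute)
    show "norm (- ln y * y powr - z) \<le> (y powr - (h + \<eta>) + y powr - (l - \<eta>)) / \<eta>" if "z \<in> {l..h}" for z
      using ln[of z] that by (simp add: abs_mult)
  qed (use p q in auto)
  then show ?thesis by (simp add: mult_ac)
qed

text \<open>
  Differentiation under the integral sign. The difference quotients at exponents within \<open>\<eta>\<close> of \<open>a\<close>
  are dominated, and \<open>\<eta>\<close> is a third of the distance from \<open>a\<close> to the ends of \<open>(1,2)\<close>, so that widening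
  twice stays inside.
\<close>

lemma sine_moment_differentiable:
  assumes a: "1 < a" "a < 2"
  obtains D where "(sine_moment has_real_derivative D) (at a)"
proof -
  define \<eta> where "\<eta> = min (a - 1) (2 - a) / 3"
  have \<eta>: "\<eta> > 0" "1 < a - \<eta> - \<eta>" "a + \<eta> + \<eta> < 2" using a by (auto simp: \<eta>_def min_def field_simps)
  let ?dom = "\<lambda>z::real. (z powr (- (a + \<eta> + \<eta>)) * min 1 z + z powr (- (a - \<eta> - \<eta>)) * min 1 z) / \<eta>"
  let ?D = "LINT z:{0<..}|lborel. (- ln z * z powr (- a)) * sin z"
  have "(sine_moment has_real_derivative ?D) (at a)"
    unfolding has_field_derivative_iff tendsto_at_iff_sequentially comp_def
  proof (intro allI impI)
    fix X :: "nat \<Rightarrow> real"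
    assume X: "\<forall>i. X i \<in> UNIV - {a}" "X \<longlonglongrightarrow> a"
    have "eventually (\<lambda>i. dist (X i) a < \<eta>) sequentially" using tendstoD[OF X(2) \<eta>(1)] .
    then obtain N where N: "\<And>i. i \<ge> N \<Longrightarrow> \<bar>X i - a\<bar> < \<eta>" by (auto simp: eventually_sequentially dist_real_def)
    define Y where "Y i = X (i + N)" for i
    have Y: "\<And>i. \<bar>Y i - a\<bar> < \<eta>" "\<And>i. Y i \<noteq> a" "Y \<longlonglongrightarrow> a"
      using N X LIMSEQ_ignore_initial_segment[OF X(2), of N] by (auto simp: Y_def[abs_def])
    have "(\<lambda>i. LINT z|lborel. indicator {0<..} z *\<^sub>R ((z powr (- Y i) - z powr (- a)) / (Y i - a) * sin z)) \<longlonglongrightarrow>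
       (LINT z|lborel. indicator {0<..} z *\<^sub>R ((- ln z * z powr (- a)) * sin z))"
    proof (rule integral_dominated_convergence[where w="\<lambda>z. indicator {0<..} z *\<^sub>R ?dom z"])
      show "integrable lborel (\<lambda>z. indicator {0<..} z *\<^sub>R ?dom z)"
        using set_integral_add(1)[OF powr_min_integrable powr_min_integrable, of "a + \<eta> + \<eta>" "a - \<eta> - \<eta>"] \<eta> a
        unfolding set_integrable_def[symmetric] by (intro set_integrable_divide) auto
      show "AE z in lborel. (\<lambda>i. indicator {0<..} z *\<^sub>R ((z powr (- Y i) - z powr (- a)) / (Y i - a) * sin z))
          \<longlonglongrightarrow> indicator {0<..} z *\<^sub>R (- ln z * z powr (- a) * sin z)"
      proof (intro AE_I2)
        fix z :: real
        show "(\<lambda>i. indicator {0<..} z *\<^sub>R ((z powr (- Y i) - z powr (- a)) / (Y i - a) * sin z))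
          \<longlonglongrightarrow> indicator {0<..} z *\<^sub>R (- ln z * z powr (- a) * sin z)"
        proof (cases "z > 0")
          case True
          then have "((\<lambda>v. z powr (- v)) has_real_derivative - ln z * z powr (- a)) (at a)"
            by (auto intro!: derivative_eq_intros)
          then have "(\<lambda>i. (z powr (- Y i) - z powr (- a)) / (Y i - a)) \<longlonglongrightarrow> - ln z * z powr (- a)"
            using Y unfolding has_field_derivative_iff tendsto_at_iff_sequentially comp_def by auto
          then show ?thesis by (intro tendsto_intros)
        qed simp
      qed
      show "AE z in lborel. norm (indicator {0<..} z *\<^sub>R ((z powr (- Y i) - z powr (- a)) / (Y i - a) * sin z)) \<le> indicator {0<..} z *\<^sub>R ?dom z" for i
      proof (intro AE_I2)
        fix z :: real
        show "norm (indicator {0<..} z *\<^sub>R ((z powr (- Y i) - z powr (- a)) / (Y i - a) * sin z)) \<le> indicator {0<..} z *\<^sub>R ?dom z"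
        proof (cases "z > 0")
          case True
          have "\<bar>(z powr (- Y i) - z powr (- a)) / (Y i - a)\<bar> \<le> (z powr (- (a + \<eta> + \<eta>)) + z powr (- (a - \<eta> - \<eta>))) / \<eta>"
            using powr_exponent_difference[OF True, of "a - \<eta>" "Y i" "a + \<eta>" a \<eta>] Y(1)[of i] Y(2)[of i] \<eta>
            by (simp add: abs_divide divide_simps) (simp add: abs_less_iff algebra_simps)
          then have "\<bar>(z powr (- Y i) - z powr (- a)) / (Y i - a)\<bar> * \<bar>sin z\<bar> \<le> (z powr (- (a + \<eta> + \<eta>)) + z powr (- (a - \<eta> - \<eta>))) / \<eta> * min 1 z"
            using True \<eta> abs_sin_le_min[of z] by (intro mult_mono) auto
          moreover have "?dom z = (z powr (- (a + \<eta> + \<eta>)) + z powr (- (a - \<eta> - \<eta>))) / \<eta> * min 1 z"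
            by (simp add: distrib_right)
          ultimately show ?thesis using True by (simp only: indicator_def) (simp add: abs_mult)
        qed simp
      qed
    qed measurable
    also have "(\<lambda>i. LINT z|lborel. indicator {0<..} z *\<^sub>R ((z powr (- Y i) - z powr (- a)) / (Y i - a) * sin z))
        = (\<lambda>i. (sine_moment (Y i) - sine_moment a) / (Y i - a))"
    proof
      fix i
      have "1 < Y i" "Y i < 2" using Y(1)[of i] \<eta> by (auto simp: abs_less_iff)
      note s = sine_moment_integrable[OF this] sine_moment_integrable[OF a]
      have "(LINT z|lborel. indicator {0<..} z *\<^sub>R ((z powr (- Y i) - z powr (- a)) / (Y i - a) * sin z))
         = (LINT z:{0<..}|lborel. (z powr (- Y i) * sin z - z powr (- a) * sin z) / (Y i - a))"
        unfolding set_lebesgue_integral_def by (intro Bochner_Integration.integral_cong) (auto simp: algebra_simps diff_divide_distrib)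
      also have "\<dots> = (sine_moment (Y i) - sine_moment a) / (Y i - a)"
        using set_integral_diff(2)[OF s] by (simp add: sine_moment_def)
      finally show "(LINT z|lborel. indicator {0<..} z *\<^sub>R ((z powr (- Y i) - z powr (- a)) / (Y i - a) * sin z)) = (sine_moment (Y i) - sine_moment a) / (Y i - a)" .
    qed
    finally have "(\<lambda>i. (sine_moment (X (i + N)) - sine_moment a) / (X (i + N) - a)) \<longlonglongrightarrow> ?D"
      unfolding Y_def set_lebesgue_integral_def .
    then show "(\<lambda>i. (sine_moment (X i) - sine_moment a) / (X i - a)) \<longlonglongrightarrow> ?D"
      by (rule LIMSEQ_offset[where k=N])
  qed
  then show ?thesis by (rule that)
qed

section \<open>A renewal identity for thinned exponential gaps\<close>

text \<open>
  In the application, \<open>k x = 1 - \<psi>(x)\<close>, where \<open>\<psi>(x)\<close> is the conditional characteristic function of the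
  term of a random sum that belongs to a point at \<open>x\<close>. If \<open>\<psi>\<close> is nonnegative and each point \<open>x\<close> of a
  unit Poisson process is deleted with probability \<open>\<psi>(x)\<close>, then \<open>survival s\<close> is the probability that
  no point after \<open>s\<close> remains; only the analytic identity is used, so \<open>k\<close> may exceed \<open>1\<close>.
\<close>

locale thinning_rate =
  fixes k :: "real \<Rightarrow> real"
  assumes k_nonneg: "\<And>x. 0 \<le> k x" and k_le: "\<And>x. k x \<le> 2"
    and k_zero: "\<And>x. x \<le> 0 \<Longrightarrow> k x = 0"
    and k_cont: "\<And>x. 0 < x \<Longrightarrow> isCont k x"
    and k_int: "integrable lborel k"
begin

definition cumulative :: "real \<Rightarrow> real" where "cumulative s = (LINT x:{0..s}|lborel. k x)"

text \<open>
  This is \<open>exp\<close> of minus the integral of \<open>k\<close> over \<open>(s,\<infinity>)\<close>; as a difference of integrals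
  over bounded intervals and a constant it is easy to differentiate.
\<close>

definition survival :: "real \<Rightarrow> real" where "survival s = exp (cumulative s - (LINT x|lborel. k x))"

lemma k_measurable [measurable]: "k \<in> borel_measurable borel"
  using k_int by (simp add: borel_measurable_integrable)

lemma k_set_integrable: "A \<in> sets borel \<Longrightarrow> set_integrable lborel A k"
  unfolding set_integrable_def using k_int by (rule integrable_mult_indicator[rotated]) simp

lemma cumulative_mono: "s \<le> t \<Longrightarrow> cumulative s \<le> cumulative t"
  unfolding cumulative_def set_lebesgue_integral_def
proof (rule integral_mono)
  show "s \<le> t \<Longrightarrow> indicator {0..s} x *\<^sub>R k x \<le> indicator {0..t} x *\<^sub>R k x" for x
    using k_nonneg[of x] by (auto simp: indicator_def)
qed (auto intro!: k_set_integrable[unfolded set_integrable_def] simp del: real_scaleR_def)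

lemma cumulative_le: "cumulative s \<le> (LINT x|lborel. k x)"
  unfolding cumulative_def set_lebesgue_integral_def
proof (rule integral_mono)
  show "indicator {0..s} x *\<^sub>R k x \<le> k x" for x
    using k_nonneg[of x] by (auto simp: indicator_def)
qed (auto intro!: k_set_integrable[unfolded set_integrable_def] k_int simp del: real_scaleR_def)

lemma survival_measurable [measurable]: "survival \<in> borel_measurable borel"
proof -
  have [measurable]: "cumulative \<in> borel_measurable borel"
    by (rule borel_measurable_mono) (auto intro!: monoI cumulative_mono)
  show ?thesis unfolding survival_def[abs_def] by measurable
qed

lemma survival_bounds: "0 < survival s" "survival s \<le> 1"
  using cumulative_le[of s] by (auto simp: survival_def)

lemma survival_0: "survival 0 = exp (- (LINT x|lborel. k x))"
proof -
  have "cumulative 0 = 0"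
    using k_zero unfolding cumulative_def set_lebesgue_integral_def
    by (intro integral_eq_zero_AE AE_I2) (auto simp: indicator_def)
  then show ?thesis by (simp add: survival_def)
qed

lemma survival_at_top: "(survival \<longlongrightarrow> 1) at_top"
proof -
  have "((\<lambda>y. LINT x|lborel. indicator {..y} x *\<^sub>R k x) \<longlongrightarrow> (LINT x|lborel. k x)) at_top"
    by (rule tendsto_integral_at_top) (use k_int in auto)
  moreover have "(LINT x|lborel. indicator {..y} x *\<^sub>R k x) = cumulative y" for y
    unfolding cumulative_def set_lebesgue_integral_def
    by (intro Bochner_Integration.integral_cong) (auto simp: indicator_def k_zero)
  ultimately have "(cumulative \<longlongrightarrow> (LINT x|lborel. k x)) at_top" by simp
  then have "((\<lambda>s. exp (cumulative s - (LINT x|lborel. k x))) \<longlongrightarrow> exp ((LINT x|lborel. k x) - (LINT x|lborel. k x))) at_top"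
    by (intro tendsto_intros)
  then show ?thesis by (simp add: survival_def[abs_def])
qed

lemma cumulative_eq_integral: "cumulative s = integral {0..s} k" and k_integrable_on: "k integrable_on {0..s}"
  using set_borel_integral_eq_integral[OF k_set_integrable[of "{0..s}"]] by (auto simp: cumulative_def)

lemma survival_derivative:
  assumes "0 < s" shows "(survival has_real_derivative k s * survival s) (at s)"
proof -
  have "((\<lambda>u. integral {0..u} k) has_vector_derivative k s) (at s within ({0..s+1} - {}))"
    by (rule integral_has_vector_derivative_continuous_at[OF k_integrable_on])
       (use assms in \<open>auto intro: continuous_at_imp_continuous_at_within k_cont\<close>)
  then have "(cumulative has_real_derivative k s) (at s within {0..s+1})"
    by (simp add: has_real_derivative_iff_has_vector_derivative cumulative_eq_integral[abs_def])
  then have [derivative_intros]: "(cumulative has_real_derivative k s) (at s)"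
    using at_within_Icc_at[of 0 s "s+1"] assms by simp
  show ?thesis
    unfolding survival_def[abs_def] by (auto intro!: derivative_eq_intros)
qed

lemma survival_right_limit:
  assumes "0 \<le> s" shows "((\<lambda>x. survival (s + x)) \<longlongrightarrow> survival s) (at_right 0)"
proof -
  have "continuous_on {0..s+1} (\<lambda>u. integral {0..u} k)"
    by (rule indefinite_integral_continuous_1[OF k_integrable_on])
  then have "continuous_on {0..s+1} survival"
    unfolding survival_def[abs_def] cumulative_eq_integral[abs_def] by (intro continuous_intros)
  then have "(survival \<longlongrightarrow> survival s) (at s within {0..s+1})"
    using assms by (auto simp: continuous_on)
  moreover have "filterlim (\<lambda>x. s + x) (at s within {0..s+1}) (at_right 0)"
  proof -
    have "((\<lambda>x. s + x) \<longlongrightarrow> s + 0) (at_right 0)" by (intro tendsto_intros)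
    moreover have "eventually (\<lambda>x. s + x \<in> {0..s+1} \<and> s + x \<noteq> s) (at_right (0::real))"
      unfolding eventually_at_right_field by (intro exI[of _ 1]) (use assms in auto)
    ultimately show ?thesis by (simp add: filterlim_at)
  qed
  ultimately show ?thesis by (rule filterlim_compose)
qed

text \<open>
  The first point after \<open>s\<close> is at \<open>s + x\<close> with \<open>x\<close> exponential. The integrand has the primitive
  \<open>- exp (- x) survival (s + x)\<close>, by the differential equation of \<open>survival\<close>.
\<close>

theorem survival_renewal:
  assumes s: "0 \<le> s"
  shows "(LINT x|density lborel (exponential_density 1). (1 - k (s + x)) * survival (s + x)) = survival s"
proof -
  interpret Ex: prob_space "density lborel (exponential_density 1)" by (rule prob_space_exponential_density) simp
  have b: "\<bar>(1 - k x) * survival x\<bar> \<le> 1" for x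
  proof -
    have "\<bar>1 - k x\<bar> * \<bar>survival x\<bar> \<le> 1 * 1"
      by (intro mult_mono) (use k_nonneg[of x] k_le[of x] survival_bounds[of x] in auto)
    then show ?thesis by (simp add: abs_mult)
  qed
  have "integrable (density lborel (exponential_density 1)) (\<lambda>x. (1 - k (s + x)) * survival (s + x))"
    by (rule Ex.integrable_const_bound[where B=1]) (use b in auto)
  then have i: "integrable lborel (\<lambda>x. exponential_density 1 x * ((1 - k (s + x)) * survival (s + x)))"
    by (subst (asm) integrable_density) (auto simp: exponential_density_nonneg)
  let ?f = "\<lambda>x. exp (- x) * (1 - k (s + x)) * survival (s + x)" and ?F = "\<lambda>x. - exp (- x) * survival (s + x)"
  have eq: "AE x in lborel. exponential_density 1 x * ((1 - k (s + x)) * survival (s + x)) = indicator {0<..} x *\<^sub>R ?f x"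
    using AE_lborel_singleton[of "0::real"]
    by eventually_elim (auto simp: exponential_density_def indicator_def)
  have si: "set_integrable lborel {0<..} ?f"
    unfolding set_integrable_def using eq i by (rule_tac integrable_cong_AE_imp[OF i]) auto
  have "(LBINT x=0..\<infinity>. ?f x) = 0 - (- survival s)"
  proof (rule interval_integral_FTC_integrable)
    fix x :: real assume "0 < ereal x"
    then have x: "0 < x" by (simp add: zero_ereal_def)
    have "(?F has_real_derivative ?f x) (at x)"
      using x s by (auto intro!: derivative_eq_intros DERIV_chain2[OF survival_derivative] simp: algebra_simps)
    then show "(?F has_vector_derivative ?f x) (at x)"
      by (simp add: has_real_derivative_iff_has_vector_derivative)
    have "isCont survival (s + x)" using survival_derivative[of "s + x"] x s DERIV_isCont by fastforce
    moreover have "isCont k (s + x)" using k_cont x s by simp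
    ultimately show "isCont ?f x"
      by (intro continuous_intros isCont_o2[where f="\<lambda>x. s + x"])
  next
    show "set_integrable lborel (einterval 0 \<infinity>) ?f"
      using si by (simp add: einterval_def zero_ereal_def greaterThan_def)
    have "(?F \<longlongrightarrow> - exp (- 0) * survival s) (at_right 0)"
      by (intro tendsto_intros survival_right_limit s)
    then show "((?F \<circ> real_of_ereal) \<longlongrightarrow> - survival s) (at_right 0)"
      unfolding zero_ereal_def ereal_tendsto_simps by simp
    have e0: "((\<lambda>x::real. exp (- x)) \<longlongrightarrow> 0) at_top"
      by (intro filterlim_compose[OF exp_at_bot] filterlim_uminus_at_bot_at_top)
    have "(?F \<longlongrightarrow> 0) at_top"
    proof (rule Lim_null_comparison[OF _ e0])
      show "eventually (\<lambda>x. norm (?F x) \<le> exp (- x)) at_top"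
        using survival_bounds by (intro always_eventually allI) (auto simp: abs_mult less_imp_le)
    qed
    then show "((?F \<circ> real_of_ereal) \<longlongrightarrow> 0) (at_left \<infinity>)"
      unfolding ereal_tendsto_simps .
  qed simp
  then have "(LINT x:{0<..}|lborel. ?f x) = survival s"
    by (simp add: interval_lebesgue_integral_0_infty)
  moreover have "(LINT x|density lborel (exponential_density 1). (1 - k (s + x)) * survival (s + x))
     = (LINT x|lborel. exponential_density 1 x *\<^sub>R ((1 - k (s + x)) * survival (s + x)))"
    by (subst integral_density) (auto simp: exponential_density_nonneg)
  moreover have "\<dots> = (LINT x:{0<..}|lborel. ?f x)"
    unfolding set_lebesgue_integral_def by (rule integral_cong_AE) (use eq in auto)
  ultimately show ?thesis by simp
qed

end

section \<open>Joint laws are determined by joint characteristic functions\<close>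

lemma (in prob_space) integrable_bounded_real:
  fixes f :: "'a \<Rightarrow> real"
  assumes "f \<in> borel_measurable M" "\<And>x. \<bar>f x\<bar> \<le> B"
  shows "integrable M f"
  by (rule integrable_const_bound[where B=B]) (use assms in auto)

lemma (in prob_space) complex_expectation_iexp:
  assumes "X \<in> borel_measurable M"
  shows "(CLINT \<omega>|M. iexp (X \<omega>)) = Complex (expectation (\<lambda>\<omega>. cos (X \<omega>))) (expectation (\<lambda>\<omega>. sin (X \<omega>)))"
proof -
  have i: "integrable M (\<lambda>\<omega>. iexp (X \<omega>))"
    by (rule integrable_const_bound[where B=1]) (use assms in auto)
  show ?thesis
    by (rule complex_eqI) (use i in \<open>simp_all flip: integral_Re integral_Im add: Re_exp Im_exp\<close>)
qed

text \<open>
  Normalising a nonnegative weight gives a probability measure, to which the one-dimensional uniqueness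
  theorem applies.
\<close>

lemma weighted_law:
  fixes w X :: "'a \<Rightarrow> real"
  assumes M: "prob_space M" and [measurable]: "w \<in> borel_measurable M" "X \<in> borel_measurable M"
    and w: "\<And>x. 0 \<le> w x" and iw: "integrable M w" and C: "C = (LINT x|M. w x)" "C \<noteq> 0"
  defines "D \<equiv> distr (density M (\<lambda>x. ennreal (w x / C))) borel X"
  shows "real_distribution D"
    and "\<And>h :: real \<Rightarrow> real. h \<in> borel_measurable borel \<Longrightarrow> (LINT x|M. w x * h (X x)) = C * (LINT x|D. h x)"
proof -
  have Cpos: "C > 0"
    using C integral_nonneg_AE[of w M] w by (auto simp: less_le)
  have "(\<integral>\<^sup>+x. ennreal (w x / C) \<partial>M) = ennreal (LINT x|M. w x / C)"
    by (rule nn_integral_eq_integral) (use iw w Cpos in auto)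
  also have "\<dots> = 1" using Cpos by (simp flip: C(1))
  finally have "prob_space (density M (\<lambda>x. ennreal (w x / C)))"
    by (intro prob_spaceI) (simp add: emeasure_density)
  then have "prob_space D" unfolding D_def by (rule prob_space.prob_space_distr) simp
  then show "real_distribution D"
    by (simp add: real_distribution_def real_distribution_axioms_def D_def)
  fix h :: "real \<Rightarrow> real" assume [measurable]: "h \<in> borel_measurable borel"
  have "(LINT x|D. h x) = (LINT x|M. (w x / C) *\<^sub>R h (X x))"
    unfolding D_def
    by (subst integral_distr, simp, simp, subst integral_density) (use w Cpos in auto)
  then show "(LINT x|M. w x * h (X x)) = C * (LINT x|D. h x)" using Cpos by simp
qed

lemma integral_indicator_eq_of_nonneg_weight:
  fixes w X :: "'a \<Rightarrow> real" and w' X' :: "'b \<Rightarrow> real"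
  assumes M: "prob_space M" and N: "prob_space N"
    and m[measurable]: "w \<in> borel_measurable M" "X \<in> borel_measurable M"
    and m'[measurable]: "w' \<in> borel_measurable N" "X' \<in> borel_measurable N"
    and w: "\<And>x. 0 \<le> w x" "\<And>x. w x \<le> B" and w': "\<And>x. 0 \<le> w' x" "\<And>x. w' x \<le> B"
    and c: "\<And>\<tau>. (LINT x|M. w x * cos (\<tau> * X x)) = (LINT x|N. w' x * cos (\<tau> * X' x))"
    and s: "\<And>\<tau>. (LINT x|M. w x * sin (\<tau> * X x)) = (LINT x|N. w' x * sin (\<tau> * X' x))"
    and A[measurable]: "A \<in> sets borel"
  shows "(LINT x|M. w x * indicator A (X x)) = (LINT x|N. w' x * indicator A (X' x))"
proof -
  define C where "C = (LINT x|M. w x)"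
  have C': "C = (LINT x|N. w' x)" using c[of 0] by (simp add: C_def)
  interpret M: prob_space M by fact
  interpret N: prob_space N by fact
  have iw: "integrable M w" by (rule M.integrable_bounded_real[of _ B]) (use w in auto)
  have iw': "integrable N w'" by (rule N.integrable_bounded_real[of _ B]) (use w' in auto)
  show ?thesis
  proof (cases "C = 0")
    case True
    have "AE x in M. w x = 0"
      using True integral_nonneg_eq_0_iff_AE[OF iw] w by (simp add: C_def)
    then have "AE x in M. w x * indicator A (X x) = 0" by eventually_elim simp
    moreover have "AE x in N. w' x = 0"
      using True integral_nonneg_eq_0_iff_AE[OF iw'] w' by (simp add: C')
    then have "AE x in N. w' x * indicator A (X' x) = 0" by eventually_elim simp
    ultimately show ?thesis by (simp add: integral_eq_zero_AE)
  next
    case False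
    note L = weighted_law[OF M m w(1) iw C_def False]
    note L' = weighted_law[OF N m' w'(1) iw' C' False]
    let ?D = "distr (density M (\<lambda>x. ennreal (w x / C))) borel X"
    let ?D' = "distr (density N (\<lambda>x. ennreal (w' x / C))) borel X'"
    interpret D: real_distribution ?D by (rule L(1))
    interpret D': real_distribution ?D' by (rule L'(1))
    have "char ?D \<tau> = char ?D' \<tau>" for \<tau>
    proof -
      have "C * (LINT x|?D. cos (\<tau> * x)) = C * (LINT x|?D'. cos (\<tau> * x))"
        "C * (LINT x|?D. sin (\<tau> * x)) = C * (LINT x|?D'. sin (\<tau> * x))"
        using c[of \<tau>] s[of \<tau>] L(2)[of "\<lambda>x. cos (\<tau> * x)"] L'(2)[of "\<lambda>x. cos (\<tau> * x)"]
          L(2)[of "\<lambda>x. sin (\<tau> * x)"] L'(2)[of "\<lambda>x. sin (\<tau> * x)"] by simp_all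
      then show ?thesis
        unfolding char_def using False
        by (subst D.complex_expectation_iexp, simp, subst D'.complex_expectation_iexp, simp, simp)
    qed
    then have "?D = ?D'" by (intro Levy_uniqueness[OF L(1) L'(1)] ext)
    then show ?thesis using L(2)[of "indicator A"] L'(2)[of "indicator A"] by simp
  qed
qed

text \<open>
  Adding the constant \<open>1\<close> makes a weight nonnegative that is bounded by \<open>1\<close>; the constant itself is a
  weight whose transforms agree by assumption.
\<close>

lemma integral_indicator_eq_of_weight:
  fixes w X :: "'a \<Rightarrow> real" and w' X' :: "'b \<Rightarrow> real"
  assumes M: "prob_space M" and N: "prob_space N"
    and [measurable]: "w \<in> borel_measurable M" "X \<in> borel_measurable M"
      "w' \<in> borel_measurable N" "X' \<in> borel_measurable N"
    and w: "\<And>x. \<bar>w x\<bar> \<le> 1" and w': "\<And>x. \<bar>w' x\<bar> \<le> 1"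
    and c: "\<And>\<tau>. (LINT x|M. w x * cos (\<tau> * X x)) = (LINT x|N. w' x * cos (\<tau> * X' x))"
    and s: "\<And>\<tau>. (LINT x|M. w x * sin (\<tau> * X x)) = (LINT x|N. w' x * sin (\<tau> * X' x))"
    and c1: "\<And>\<tau>. (LINT x|M. cos (\<tau> * X x)) = (LINT x|N. cos (\<tau> * X' x))"
    and s1: "\<And>\<tau>. (LINT x|M. sin (\<tau> * X x)) = (LINT x|N. sin (\<tau> * X' x))"
    and A[measurable]: "A \<in> sets borel"
  shows "(LINT x|M. w x * indicator A (X x)) = (LINT x|N. w' x * indicator A (X' x))"
proof -
  interpret M: prob_space M by fact
  interpret N: prob_space N by fact
  have b1: "\<bar>w x * h\<bar> \<le> 1" "\<bar>w' y * h\<bar> \<le> 1" if "\<bar>h\<bar> \<le> 1" for x y and h :: real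
    using mult_mono[OF w that] mult_mono[OF w' that] by (auto simp: abs_mult)
  have eq: "(LINT x|M. (w x + 1) * h (X x)) = (LINT x|M. w x * h (X x)) + (LINT x|M. h (X x))"
           "(LINT x|N. (w' x + 1) * h (X' x)) = (LINT x|N. w' x * h (X' x)) + (LINT x|N. h (X' x))"
    if [measurable]: "h \<in> borel_measurable borel" and hb: "\<And>x. \<bar>h x\<bar> \<le> 1" for h :: "real \<Rightarrow> real"
  proof -
    have "integrable M (\<lambda>x. w x * h (X x))" "integrable M (\<lambda>x. h (X x))"
         "integrable N (\<lambda>x. w' x * h (X' x))" "integrable N (\<lambda>x. h (X' x))"
      by (auto intro!: M.integrable_bounded_real[of _ 1] N.integrable_bounded_real[of _ 1] b1 hb)
    then show "(LINT x|M. (w x + 1) * h (X x)) = (LINT x|M. w x * h (X x)) + (LINT x|M. h (X x))"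
           "(LINT x|N. (w' x + 1) * h (X' x)) = (LINT x|N. w' x * h (X' x)) + (LINT x|N. h (X' x))"
      by (simp_all add: distrib_right)
  qed
  have w1: "0 \<le> w x + 1" "w x + 1 \<le> 2" for x using w[of x] by (auto simp: abs_le_iff)
  have w1': "0 \<le> w' x + 1" "w' x + 1 \<le> 2" for x using w'[of x] by (auto simp: abs_le_iff)
  have "(LINT x|M. (w x + 1) * indicator A (X x)) = (LINT x|N. (w' x + 1) * indicator A (X' x))"
    by (rule integral_indicator_eq_of_nonneg_weight[OF M N, where B=2])
       (use w1 w1' eq[of "\<lambda>x. cos (_ * x)"] eq[of "\<lambda>x. sin (_ * x)"] c s c1 s1 in auto)
  moreover have "(LINT x|M. (1::real) * indicator A (X x)) = (LINT x|N. 1 * indicator A (X' x))"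
    by (rule integral_indicator_eq_of_nonneg_weight[OF M N, where w="\<lambda>_. 1" and w'="\<lambda>_. 1" and B=1]) (use c1 s1 in auto)
  ultimately show ?thesis
    using eq[of "indicator A"] by (auto simp: indicator_def)
qed

text \<open>
  Induction on the coordinates, which are moved one at a time from the trigonometric factor into a product of
  indicators of Borel sets. In the step for the coordinate \<open>s\<close>, the weight is the product of the indicators
  obtained so far with the cosine or sine of the remaining linear combination. By the addition theorems,
  the transform of \<open>X\<^sub>s\<close> under this weight is a combination of quantities known from the previous stage. In
  the end only indicators of rectangles are left.
\<close>

theorem distr_PiM_eq_of_char_eq:
  fixes X :: "'t \<Rightarrow> 'a \<Rightarrow> real" and X' :: "'t \<Rightarrow> 'b \<Rightarrow> real"
  assumes M: "prob_space M" and N: "prob_space N" and T: "finite T"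
    and X[measurable]: "\<And>t. t \<in> T \<Longrightarrow> X t \<in> borel_measurable M"
    and X'[measurable]: "\<And>t. t \<in> T \<Longrightarrow> X' t \<in> borel_measurable N"
    and char: "\<And>\<xi>. (CLINT \<omega>|M. iexp (\<Sum>t\<in>T. \<xi> t * X t \<omega>)) = (CLINT \<omega>|N. iexp (\<Sum>t\<in>T. \<xi> t * X' t \<omega>))"
  shows "distr M (PiM T (\<lambda>_. borel)) (\<lambda>\<omega>. \<lambda>t\<in>T. X t \<omega>) = distr N (PiM T (\<lambda>_. borel)) (\<lambda>\<omega>. \<lambda>t\<in>T. X' t \<omega>)"
proof -
  interpret M: prob_space M by fact
  interpret N: prob_space N by fact
  define P where "P S B \<omega> = (\<Prod>t\<in>S. indicator (B t) (X t \<omega>) :: real)" for S B \<omega>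
  define P' where "P' S B \<omega> = (\<Prod>t\<in>S. indicator (B t) (X' t \<omega>) :: real)" for S B \<omega>
  have Pb: "\<bar>P S B \<omega>\<bar> \<le> 1" "\<bar>P' S B \<omega>'\<bar> \<le> 1" for S B \<omega> \<omega>'
    unfolding P_def P'_def by (auto simp: abs_prod intro!: prod_le_1)
  have Pm: "P S B \<in> borel_measurable M" "P' S B \<in> borel_measurable N"
    if "S \<subseteq> T" "\<And>t. t \<in> S \<Longrightarrow> B t \<in> sets borel" for S B
    unfolding P_def P'_def using that
    by (auto intro!: borel_measurable_prod measurable_compose[OF X] measurable_compose[OF X'] borel_measurable_indicator)
  have *: "(LINT \<omega>|M. P S B \<omega> * cos (\<Sum>t\<in>T-S. \<xi> t * X t \<omega>)) = (LINT \<omega>|N. P' S B \<omega> * cos (\<Sum>t\<in>T-S. \<xi> t * X' t \<omega>)) \<and>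
         (LINT \<omega>|M. P S B \<omega> * sin (\<Sum>t\<in>T-S. \<xi> t * X t \<omega>)) = (LINT \<omega>|N. P' S B \<omega> * sin (\<Sum>t\<in>T-S. \<xi> t * X' t \<omega>))"
    if "finite S" "S \<subseteq> T" "\<And>t. t \<in> S \<Longrightarrow> B t \<in> sets borel" for S B \<xi>
    using that
  proof (induction S arbitrary: \<xi> rule: finite_induct)
    case empty
    have "(\<lambda>\<omega>. \<Sum>t\<in>T. \<xi> t * X t \<omega>) \<in> borel_measurable M" "(\<lambda>\<omega>. \<Sum>t\<in>T. \<xi> t * X' t \<omega>) \<in> borel_measurable N"
      by (auto intro!: borel_measurable_sum)
    from char[of \<xi>, unfolded M.complex_expectation_iexp[OF this(1)] N.complex_expectation_iexp[OF this(2)]]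
    show ?case by (simp add: P_def P'_def)
  next
    case (insert s S)
    have sT: "s \<in> T" "S \<subseteq> T" and [measurable]: "B s \<in> sets borel" and BS: "\<And>t. t \<in> S \<Longrightarrow> B t \<in> sets borel"
      using insert.prems by auto
    define th where "th \<omega> = (\<Sum>t\<in>T - insert s S. \<xi> t * X t \<omega>)" for \<omega>
    define th' where "th' \<omega> = (\<Sum>t\<in>T - insert s S. \<xi> t * X' t \<omega>)" for \<omega>
    have [measurable]: "th \<in> borel_measurable M" "th' \<in> borel_measurable N"
      unfolding th_def th'_def by (auto intro!: borel_measurable_sum)
    have [measurable]: "X s \<in> borel_measurable M" "X' s \<in> borel_measurable N" using sT by auto
    have [measurable]: "P S B \<in> borel_measurable M" "P' S B \<in> borel_measurable N"
      using Pm sT BS by auto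
    have split: "T - S = insert s (T - insert s S)" using insert sT by auto
    have sums: "(\<Sum>t\<in>T-S. (\<lambda>t. if t = s then \<tau> else \<sigma> * \<xi> t) t * X t \<omega>) = \<tau> * X s \<omega> + \<sigma> * th \<omega>"
               "(\<Sum>t\<in>T-S. (\<lambda>t. if t = s then \<tau> else \<sigma> * \<xi> t) t * X' t \<omega>') = \<tau> * X' s \<omega>' + \<sigma> * th' \<omega>'"
      for \<tau> \<sigma> \<omega> \<omega>'
      unfolding split th_def th'_def using T
      by (subst sum.insert; auto simp: sum_distrib_left mult.assoc intro!: sum.cong)+
    have IH: "(LINT \<omega>|M. P S B \<omega> * cos (\<tau> * X s \<omega> + \<sigma> * th \<omega>)) = (LINT \<omega>|N. P' S B \<omega> * cos (\<tau> * X' s \<omega> + \<sigma> * th' \<omega>))"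
             "(LINT \<omega>|M. P S B \<omega> * sin (\<tau> * X s \<omega> + \<sigma> * th \<omega>)) = (LINT \<omega>|N. P' S B \<omega> * sin (\<tau> * X' s \<omega> + \<sigma> * th' \<omega>))"
      for \<tau> \<sigma>
      using insert.IH[OF sT(2) BS, of "\<lambda>t. if t = s then \<tau> else \<sigma> * \<xi> t"] unfolding sums by auto
    have one: "(LINT \<omega>|M. cos (\<tau> * X s \<omega>)) = (LINT \<omega>|N. cos (\<tau> * X' s \<omega>))"
              "(LINT \<omega>|M. sin (\<tau> * X s \<omega>)) = (LINT \<omega>|N. sin (\<tau> * X' s \<omega>))" for \<tau>
    proof -
      have e: "(\<Sum>t\<in>T. (if t = s then \<tau> else 0) * Y t) = \<tau> * Y s" for Y :: "'t \<Rightarrow> real"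
        using sT T by (subst sum.remove[of _ s]) auto
      have "(CLINT \<omega>|M. iexp (\<tau> * X s \<omega>)) = (CLINT \<omega>|N. iexp (\<tau> * X' s \<omega>))"
        using char[of "\<lambda>t. if t = s then \<tau> else 0"] unfolding e .
      then show "(LINT \<omega>|M. cos (\<tau> * X s \<omega>)) = (LINT \<omega>|N. cos (\<tau> * X' s \<omega>))"
              "(LINT \<omega>|M. sin (\<tau> * X s \<omega>)) = (LINT \<omega>|N. sin (\<tau> * X' s \<omega>))"
        by (subst (asm) M.complex_expectation_iexp, simp, subst (asm) N.complex_expectation_iexp, simp, simp)+
    qed
    have b2: "\<bar>P S B \<omega> * h\<bar> \<le> 1" "\<bar>P' S B \<omega>' * h\<bar> \<le> 1" if "\<bar>h\<bar> \<le> 1" for h \<omega> \<omega>'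
      using mult_mono[OF Pb(1) that] mult_mono[OF Pb(2) that] by (auto simp: abs_mult)
    have i: "integrable M (\<lambda>\<omega>. P S B \<omega> * cos (\<tau> * X s \<omega> + \<sigma> * th \<omega>))"
        "integrable M (\<lambda>\<omega>. P S B \<omega> * sin (\<tau> * X s \<omega> + \<sigma> * th \<omega>))"
        "integrable N (\<lambda>\<omega>. P' S B \<omega> * cos (\<tau> * X' s \<omega> + \<sigma> * th' \<omega>))"
        "integrable N (\<lambda>\<omega>. P' S B \<omega> * sin (\<tau> * X' s \<omega> + \<sigma> * th' \<omega>))" for \<tau> \<sigma>
      by (auto intro!: M.integrable_bounded_real[of _ 1] N.integrable_bounded_real[of _ 1] b2)
    have tr: "p * cos t * cos y = (p * cos (y + 1 * t) + p * cos (y + (-1) * t)) / 2"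
       "p * cos t * sin y = (p * sin (y + 1 * t) + p * sin (y + (-1) * t)) / 2"
       "p * sin t * cos y = (p * sin (y + 1 * t) - p * sin (y + (-1) * t)) / 2"
       "p * sin t * sin y = (p * cos (y + (-1) * t) - p * cos (y + 1 * t)) / 2" for p t y :: real
      by (simp_all add: cos_add sin_add cos_diff sin_diff algebra_simps)
    have w: "(LINT \<omega>|M. (P S B \<omega> * cos (th \<omega>)) * indicator (B s) (X s \<omega>)) = (LINT \<omega>|N. (P' S B \<omega> * cos (th' \<omega>)) * indicator (B s) (X' s \<omega>))"
      by (rule integral_indicator_eq_of_weight[OF M N])
         (simp_all add: b2 one, simp_all only: tr, simp_all add: i IH[of _ 1, simplified] IH[of _ "-1", simplified] i[of _ 1, simplified] i[of _ "-1", simplified])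
    have w2: "(LINT \<omega>|M. (P S B \<omega> * sin (th \<omega>)) * indicator (B s) (X s \<omega>)) = (LINT \<omega>|N. (P' S B \<omega> * sin (th' \<omega>)) * indicator (B s) (X' s \<omega>))"
      by (rule integral_indicator_eq_of_weight[OF M N])
         (simp_all add: b2 one, simp_all only: tr, simp_all add: i IH[of _ 1, simplified] IH[of _ "-1", simplified] i[of _ 1, simplified] i[of _ "-1", simplified])
    have Pi: "P (insert s S) B \<omega> = P S B \<omega> * indicator (B s) (X s \<omega>)"
             "P' (insert s S) B \<omega>' = P' S B \<omega>' * indicator (B s) (X' s \<omega>')" for \<omega> \<omega>'
      using insert by (simp_all add: P_def P'_def mult.commute)
    show ?case
      using w w2 unfolding Pi th_def th'_def by (simp add: mult_ac)
  qed
  let ?D = "distr M (PiM T (\<lambda>_. borel)) (\<lambda>\<omega>. \<lambda>t\<in>T. X t \<omega>)"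
  let ?E = "distr N (PiM T (\<lambda>_. borel)) (\<lambda>\<omega>. \<lambda>t\<in>T. X' t \<omega>)"
  have mX: "(\<lambda>\<omega>. \<lambda>t\<in>T. X t \<omega>) \<in> measurable M (PiM T (\<lambda>_. borel))"
    by (rule measurable_restrict) simp
  have mX': "(\<lambda>\<omega>. \<lambda>t\<in>T. X' t \<omega>) \<in> measurable N (PiM T (\<lambda>_. borel))"
    by (rule measurable_restrict) simp
  show ?thesis
  proof (rule measure_eqI_PiM_finite[OF T, where A="\<lambda>_. space (PiM T (\<lambda>_. borel))"])
    fix B :: "'t \<Rightarrow> real set" assume B: "\<And>t. t \<in> T \<Longrightarrow> B t \<in> sets borel"
    have BB: "Pi\<^sub>E T B \<in> sets (PiM T (\<lambda>_. borel))" using B T by (intro sets_PiM_I_finite) auto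
    have "measure ?D (Pi\<^sub>E T B) = measure M ((\<lambda>\<omega>. \<lambda>t\<in>T. X t \<omega>) -` Pi\<^sub>E T B \<inter> space M)"
      by (rule measure_distr[OF mX BB])
    also have "\<dots> = (LINT \<omega>|M. indicator ((\<lambda>\<omega>. \<lambda>t\<in>T. X t \<omega>) -` Pi\<^sub>E T B \<inter> space M) \<omega>)"
      using measurable_sets[OF mX BB] by simp
    also have "\<dots> = (LINT \<omega>|M. P T B \<omega>)"
      by (intro Bochner_Integration.integral_cong)
         (use T in \<open>auto simp: P_def indicator_def PiE_iff split: if_splits\<close>)
    also have "\<dots> = (LINT \<omega>|N. P' T B \<omega>)"
      using *[OF T order_refl B] by simp
    also have "\<dots> = (LINT \<omega>|N. indicator ((\<lambda>\<omega>. \<lambda>t\<in>T. X' t \<omega>) -` Pi\<^sub>E T B \<inter> space N) \<omega>)"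
      by (intro Bochner_Integration.integral_cong)
         (use T in \<open>auto simp: P'_def indicator_def PiE_iff split: if_splits\<close>)
    also have "\<dots> = measure N ((\<lambda>\<omega>. \<lambda>t\<in>T. X' t \<omega>) -` Pi\<^sub>E T B \<inter> space N)"
      using measurable_sets[OF mX' BB] by simp
    also have "\<dots> = measure ?E (Pi\<^sub>E T B)"
      by (rule measure_distr[OF mX' BB, symmetric])
    finally show "emeasure ?D (Pi\<^sub>E T B) = emeasure ?E (Pi\<^sub>E T B)"
      using M.prob_space_distr[OF mX] N.prob_space_distr[OF mX']
      by (simp add: prob_space_def finite_measure.emeasure_eq_measure)
  next
    show "emeasure ?D (space (Pi\<^sub>M T (\<lambda>_. borel))) \<noteq> \<infinity>"
      using M.prob_space_distr[OF mX] by (simp add: prob_space_def finite_measure.emeasure_eq_measure)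
    show "range (\<lambda>_. space (PiM T (\<lambda>_. borel :: real measure))) \<subseteq> prod_algebra T (\<lambda>_. borel)"
      using prod_algebraI_finite[OF T, of "\<lambda>_. UNIV" "\<lambda>_. borel :: real measure"] by (auto simp: space_PiM)
  qed simp_all
qed

section \<open>Perturbations that vanish in probability\<close>

text \<open>
  For a fixed pair of arguments of \<open>g\<close> the condition on \<open>x\<close> is open, and the set is a union over such pairs;
  this makes it measurable for arbitrary \<open>g\<close>.
\<close>

lemma oscillation_set_open:
  fixes g :: "(nat \<Rightarrow> real) \<Rightarrow> real"
  shows "open {x. \<exists>y z. (\<forall>i<n. \<bar>y i - x i\<bar> < \<delta> \<and> \<bar>z i - x i\<bar> < \<delta>) \<and> \<epsilon> < \<bar>g y - g z\<bar>}"
proof -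
  have "{x. \<exists>y z. (\<forall>i<n. \<bar>y i - x i\<bar> < \<delta> \<and> \<bar>z i - x i\<bar> < \<delta>) \<and> \<epsilon> < \<bar>g y - g z\<bar>} =
      (\<Union>(y,z)\<in>{(y,z). \<epsilon> < \<bar>g y - g z\<bar>}. \<Inter>i\<in>{..<n}. {x. \<bar>y i - x i\<bar> < \<delta>} \<inter> {x. \<bar>z i - x i\<bar> < \<delta>})"
    by auto
  moreover have "open {x :: nat \<Rightarrow> real. \<bar>y i - x i\<bar> < \<delta>}" for y :: "nat \<Rightarrow> real" and i
    by (intro open_Collect_less continuous_intros continuous_on_product_coordinates)
  ultimately show ?thesis
    by (auto intro!: open_UN open_INT open_Int)
qed

lemma finitely_determined_continuous_oscillation:
  fixes g :: "(nat \<Rightarrow> real) \<Rightarrow> real"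
  assumes cont: "continuous_on UNIV g" and dep: "\<And>x y. (\<And>i. i < n \<Longrightarrow> x i = y i) \<Longrightarrow> g x = g y"
    and "\<epsilon> > 0"
  shows "\<exists>\<delta>>0. \<forall>y z. (\<forall>i<n. \<bar>y i - x i\<bar> < \<delta> \<and> \<bar>z i - x i\<bar> < \<delta>) \<longrightarrow> \<bar>g y - g z\<bar> \<le> \<epsilon>"
proof (rule ccontr)
  assume "\<not> ?thesis"
  then have "\<forall>k. \<exists>y z. (\<forall>i<n. \<bar>y i - x i\<bar> < inverse (real (Suc k)) \<and> \<bar>z i - x i\<bar> < inverse (real (Suc k))) \<and> \<epsilon> < \<bar>g y - g z\<bar>"
    by (auto simp: not_le dest!: spec[of _ "inverse (real (Suc _))"])
  then obtain y z where yz: "\<And>k i. i < n \<Longrightarrow> \<bar>y k i - x i\<bar> < inverse (real (Suc k))"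
     "\<And>k i. i < n \<Longrightarrow> \<bar>z k i - x i\<bar> < inverse (real (Suc k))" "\<And>k. \<epsilon> < \<bar>g (y k) - g (z k)\<bar>"
    by metis
  have lim: "(\<lambda>k. g (w k)) \<longlonglongrightarrow> g x" if w: "\<And>k i. i < n \<Longrightarrow> \<bar>w k i - x i\<bar> < inverse (real (Suc k))" for w
  proof -
    define w' where "w' k = (\<lambda>i. if i < n then w k i else x i)" for k
    have "(\<lambda>k. w' k i) \<longlonglongrightarrow> x i" for i
    proof (cases "i < n")
      case True
      have "(\<lambda>k. w k i - x i) \<longlonglongrightarrow> 0"
        by (rule Lim_null_comparison[OF _ LIMSEQ_inverse_real_of_nat]) (use w[OF True] in \<open>auto intro!: eventuallyI less_imp_le\<close>)
      then show ?thesis using True by (simp add: w'_def LIM_zero_iff)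
    qed (simp add: w'_def)
    then have "limitin (product_topology (\<lambda>_. euclidean) UNIV) w' x sequentially"
      by (simp add: limitin_componentwise)
    then have "limitin euclidean w' x sequentially" by (simp only: euclidean_product_topology)
    then have "w' \<longlonglongrightarrow> x" by simp
    then have "(\<lambda>k. g (w' k)) \<longlonglongrightarrow> g x"
      using cont by (auto intro: continuous_on_tendsto_compose[of UNIV g])
    moreover have "g (w' k) = g (w k)" for k by (rule dep) (simp add: w'_def)
    ultimately show ?thesis by simp
  qed
  have "(\<lambda>k. \<bar>g (y k) - g (z k)\<bar>) \<longlonglongrightarrow> \<bar>g x - g x\<bar>"
    by (intro tendsto_intros lim) (use yz in auto)
  then have "\<epsilon> \<le> \<bar>g x - g x\<bar>"
    by (rule LIMSEQ_le_const) (use yz(3) less_imp_le in blast)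
  then show False using \<open>\<epsilon> > 0\<close> by simp
qed

text \<open>
  Slutsky's lemma for a main part \<open>A r\<close> whose law does not depend on \<open>r\<close>. The sets of points near
  which \<open>g\<close> oscillates on the scale \<open>\<delta>\<close> decrease to the empty set as \<open>\<delta>\<close> tends to \<open>0\<close>, so the fixed law
  gives them small mass for some \<open>\<delta>\<close>. Away from such a set a perturbation below \<open>\<delta>\<close> hardly changes \<open>g\<close>,
  and larger perturbations have small probability.
\<close>

lemma expectation_tendsto_of_small_perturbation:
  fixes g :: "(nat \<Rightarrow> real) \<Rightarrow> real" and A X :: "'r \<Rightarrow> nat \<Rightarrow> 'a \<Rightarrow> real" and Z :: "nat \<Rightarrow> 'b \<Rightarrow> real"
  assumes M: "prob_space M" and N: "prob_space N"
    and cont: "continuous_on UNIV g" and dep: "\<And>x y. (\<And>i. i < n \<Longrightarrow> x i = y i) \<Longrightarrow> g x = g y"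
    and bd: "\<And>x. \<bar>g x\<bar> \<le> B"
    and [measurable]: "\<And>r i. A r i \<in> borel_measurable M" "\<And>r i. X r i \<in> borel_measurable M"
      "\<And>i. Z i \<in> borel_measurable N"
    and law: "eventually (\<lambda>r. distr M (PiM UNIV (\<lambda>_. borel)) (\<lambda>\<omega> i. A r i \<omega>) = distr N (PiM UNIV (\<lambda>_. borel)) (\<lambda>\<omega> i. Z i \<omega>)) F"
    and small: "\<And>i e. i < n \<Longrightarrow> e > 0 \<Longrightarrow>
       ((\<lambda>r. measure M {\<omega>\<in>space M. e \<le> \<bar>X r i \<omega> - A r i \<omega>\<bar>}) \<longlongrightarrow> 0) F"
  shows "((\<lambda>r. LINT \<omega>|M. g (\<lambda>i. X r i \<omega>)) \<longlongrightarrow> (LINT \<omega>|N. g (\<lambda>i. Z i \<omega>))) F"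
proof (rule tendstoI)
  interpret M: prob_space M by fact
  interpret N: prob_space N by fact
  fix e :: real assume "e > 0"
  have g0[measurable]: "g \<in> borel_measurable borel" by (rule borel_measurable_continuous_onI[OF cont])
  have g1[measurable]: "g \<in> borel_measurable (PiM UNIV (\<lambda>_. borel))"
    using g0 measurable_cong_sets[OF sets_PiM_equal_borel refl] by blast
  \<comment> \<open>the set of points near which \<open>g\<close> oscillates on the scale \<open>\<delta>\<close>\<close>
  define G where "G \<delta> = {x. \<exists>y z. (\<forall>i<n. \<bar>y i - x i\<bar> < \<delta> \<and> \<bar>z i - x i\<bar> < \<delta>) \<and> e / 4 < \<bar>g y - g z\<bar>}" for \<delta>
  have Gs[measurable]: "G \<delta> \<in> sets (PiM UNIV (\<lambda>_. borel))" for \<delta>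
    unfolding sets_PiM_equal_borel G_def by (intro borel_open oscillation_set_open)
  define Q where "Q = distr N (PiM UNIV (\<lambda>_. borel)) (\<lambda>\<omega> i. Z i \<omega>)"
  have mZ[measurable]: "(\<lambda>\<omega> i. Z i \<omega>) \<in> measurable N (PiM UNIV (\<lambda>_. borel))"
    and mX[measurable]: "(\<lambda>\<omega> i. X r i \<omega>) \<in> measurable M (PiM UNIV (\<lambda>_. borel))"
    and mA[measurable]: "(\<lambda>\<omega> i. A r i \<omega>) \<in> measurable M (PiM UNIV (\<lambda>_. borel))" for r
    by (auto intro!: measurable_PiM_single' simp: space_PiM)
  interpret Q: prob_space Q unfolding Q_def by (rule N.prob_space_distr[OF mZ])
  have B0: "B \<ge> 0" using bd[of undefined] by linarith
  have "(\<lambda>k. measure Q (G (inverse (real (Suc k))))) \<longlonglongrightarrow> measure Q (\<Inter>k. G (inverse (real (Suc k))))"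
  proof (rule Q.finite_Lim_measure_decseq)
    have "G a \<subseteq> G b" if "a \<le> b" for a b
      unfolding G_def using that by (force intro: less_le_trans)
    then show "decseq (\<lambda>k. G (inverse (real (Suc k))))"
      by (intro decseq_SucI) (simp add: le_imp_inverse_le)
  qed (auto simp: Q_def)
  also have "(\<Inter>k. G (inverse (real (Suc k)))) = {}"
  proof -
    have False if x: "\<And>k. x \<in> G (inverse (real (Suc k)))" for x
    proof -
      obtain \<delta> where \<delta>: "\<delta> > 0" "\<And>y z. (\<forall>i<n. \<bar>y i - x i\<bar> < \<delta> \<and> \<bar>z i - x i\<bar> < \<delta>) \<Longrightarrow> \<bar>g y - g z\<bar> \<le> e / 4"
        using finitely_determined_continuous_oscillation[where \<epsilon>="e/4" and x=x and n=n and g=g, OF cont dep] \<open>e > 0\<close> by auto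
      obtain k where k: "inverse (real (Suc k)) < \<delta>" using reals_Archimedean[OF \<delta>(1)] by auto
      obtain y z where "\<forall>i<n. \<bar>y i - x i\<bar> < inverse (real (Suc k)) \<and> \<bar>z i - x i\<bar> < inverse (real (Suc k))" "e / 4 < \<bar>g y - g z\<bar>"
        using x[of k] unfolding G_def by blast
      then show False using \<delta>(2)[of y z] k by (meson less_trans not_le)
    qed
    then show ?thesis by blast
  qed
  finally have "(\<lambda>k. measure Q (G (inverse (real (Suc k))))) \<longlonglongrightarrow> 0" by simp
  moreover have "e / (4 * (2 * B + 1)) > 0" using B0 \<open>e > 0\<close> by simp
  ultimately have "eventually (\<lambda>k. measure Q (G (inverse (real (Suc k)))) < e / (4 * (2 * B + 1))) sequentially"
    by (rule order_tendstoD(2))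
  then obtain k where k: "measure Q (G (inverse (real (Suc k)))) < e / (4 * (2 * B + 1))"
    by (auto simp: eventually_sequentially)
  define \<delta> where "\<delta> = inverse (real (Suc k))"
  have \<delta>: "\<delta> > 0" "measure Q (G \<delta>) < e / (4 * (2 * B + 1))" using k by (auto simp: \<delta>_def)
  define p where "p r i = measure M {\<omega>\<in>space M. \<delta> \<le> \<bar>X r i \<omega> - A r i \<omega>\<bar>}" for r i
  have "((\<lambda>r. 2 * B * (\<Sum>i<n. p r i)) \<longlongrightarrow> 2 * B * (\<Sum>i<n. 0)) F"
    unfolding p_def by (intro tendsto_intros small) (use \<delta> in auto)
  then have "eventually (\<lambda>r. 2 * B * (\<Sum>i<n. p r i) < e / 4) F"
    by (rule order_tendstoD) (use \<open>e > 0\<close> in simp)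
  with law show "eventually (\<lambda>r. dist (LINT \<omega>|M. g (\<lambda>i. X r i \<omega>)) (LINT \<omega>|N. g (\<lambda>i. Z i \<omega>)) < e) F"
  proof eventually_elim
    case (elim r)
    have Qr: "Q = distr M (PiM UNIV (\<lambda>_. borel)) (\<lambda>\<omega> i. A r i \<omega>)" using elim(1) by (simp add: Q_def)
    have eqA: "(LINT \<omega>|N. g (\<lambda>i. Z i \<omega>)) = (LINT \<omega>|M. g (\<lambda>i. A r i \<omega>))"
    proof -
      have "(LINT \<omega>|N. g (\<lambda>i. Z i \<omega>)) = (LINT x|Q. g x)" unfolding Q_def by (subst integral_distr) auto
      also have "\<dots> = (LINT \<omega>|M. g (\<lambda>i. A r i \<omega>))" unfolding Qr by (subst integral_distr) auto
      finally show ?thesis .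
    qed
    let ?E = "\<lambda>i. {\<omega>\<in>space M. \<delta> \<le> \<bar>X r i \<omega> - A r i \<omega>\<bar>}"
    let ?H = "{\<omega>\<in>space M. (\<lambda>i. A r i \<omega>) \<in> G \<delta>}"
    have Hs[measurable]: "?H \<in> sets M" by measurable
    have Es[measurable]: "?E i \<in> sets M" for i by measurable
    have pw: "\<bar>g (\<lambda>i. X r i \<omega>) - g (\<lambda>i. A r i \<omega>)\<bar> \<le> e / 4 + 2 * B * indicator ?H \<omega> + 2 * B * (\<Sum>i<n. indicator (?E i) \<omega>)"
      if "\<omega> \<in> space M" for \<omega>
    proof -
      have two: "\<bar>g (\<lambda>i. X r i \<omega>) - g (\<lambda>i. A r i \<omega>)\<bar> \<le> 2 * B"
        using bd[of "\<lambda>i. X r i \<omega>"] bd[of "\<lambda>i. A r i \<omega>"] by linarith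
      have s0: "0 \<le> (\<Sum>i<n. indicator (?E i) \<omega> :: real)" by (intro sum_nonneg) auto
      show ?thesis
      proof (cases "\<exists>i<n. \<omega> \<in> ?E i")
        case True
        then obtain i where i: "i < n" "\<omega> \<in> ?E i" by blast
        have "(\<Sum>i<n. indicator (?E i) \<omega> :: real) \<ge> (\<Sum>i\<in>{i}. indicator (?E i) \<omega>)"
          by (rule sum_mono2) (use i in auto)
        then have "1 \<le> (\<Sum>i<n. indicator (?E i) \<omega> :: real)" using i by simp
        then have "2 * B * 1 \<le> 2 * B * (\<Sum>i<n. indicator (?E i) \<omega>)" using B0 by (intro mult_left_mono) auto
        moreover have "0 \<le> 2 * B * indicator ?H \<omega>" using B0 by simp
        ultimately show ?thesis using two \<open>e > 0\<close> by linarith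
      next
        case F: False
        have nn: "0 \<le> 2 * B * (\<Sum>i<n. indicator (?E i) \<omega>)" using s0 B0 by (intro mult_nonneg_nonneg) auto
        show ?thesis
        proof (cases "\<omega> \<in> ?H")
          case True
          then show ?thesis using two nn \<open>e > 0\<close> by simp
        next
          case False
          then have nG: "(\<lambda>i. A r i \<omega>) \<notin> G \<delta>" using that by simp
          have close: "\<forall>i<n. \<bar>X r i \<omega> - A r i \<omega>\<bar> < \<delta> \<and> \<bar>A r i \<omega> - A r i \<omega>\<bar> < \<delta>"
            using F that \<delta> by (auto simp: not_le)
          have "\<bar>g (\<lambda>i. X r i \<omega>) - g (\<lambda>i. A r i \<omega>)\<bar> \<le> e / 4"
            using nG close unfolding G_def mem_Collect_eq by (meson not_le)
          moreover have "0 \<le> 2 * B * indicator ?H \<omega>" using B0 by simp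
          ultimately show ?thesis using nn by linarith
        qed
      qed
    qed
    have iX: "integrable M (\<lambda>\<omega>. g (\<lambda>i. X r i \<omega>))" "integrable M (\<lambda>\<omega>. g (\<lambda>i. A r i \<omega>))"
      by (rule M.integrable_const_bound[where B=B]; use bd in simp)+
    have mH: "measure M ?H = measure Q (G \<delta>)"
      unfolding Qr by (subst measure_distr) (auto intro!: arg_cong[where f="measure M"])
    have "\<bar>(LINT \<omega>|M. g (\<lambda>i. X r i \<omega>)) - (LINT \<omega>|M. g (\<lambda>i. A r i \<omega>))\<bar>
       \<le> (LINT \<omega>|M. \<bar>g (\<lambda>i. X r i \<omega>) - g (\<lambda>i. A r i \<omega>)\<bar>)"
      using iX integral_abs_bound[of M "\<lambda>\<omega>. g (\<lambda>i. X r i \<omega>) - g (\<lambda>i. A r i \<omega>)"] by simp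
    also have "\<dots> \<le> (LINT \<omega>|M. e / 4 + 2 * B * indicator ?H \<omega> + 2 * B * (\<Sum>i<n. indicator (?E i) \<omega>))"
    proof (intro integral_mono)
      show "integrable M (\<lambda>\<omega>. e / 4 + 2 * B * indicator ?H \<omega> + 2 * B * (\<Sum>i<n. indicator (?E i) \<omega>))"
        by (intro Bochner_Integration.integrable_add integrable_mult_right Bochner_Integration.integrable_sum
             integrable_real_indicator M.integrable_const Hs Es)
           (auto simp: M.emeasure_eq_measure)
    qed (use iX pw in auto)
    also have "\<dots> = e / 4 + 2 * B * measure M ?H + 2 * B * (\<Sum>i<n. p r i)"
    proof -
      have iH: "integrable M (indicator ?H :: 'a \<Rightarrow> real)" and iE: "integrable M (indicator (?E i) :: 'a \<Rightarrow> real)" for i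
        by (auto simp: M.emeasure_eq_measure intro!: integrable_real_indicator)
      have "(LINT \<omega>|M. e / 4 + 2 * B * indicator ?H \<omega> + 2 * B * (\<Sum>i<n. indicator (?E i) \<omega>))
          = (LINT \<omega>|M. e / 4 + 2 * B * indicator ?H \<omega>) + (LINT \<omega>|M. 2 * B * (\<Sum>i<n. indicator (?E i) \<omega>))"
        by (intro Bochner_Integration.integral_add Bochner_Integration.integrable_add integrable_mult_right
           Bochner_Integration.integrable_sum iH iE M.integrable_const)
      also have "(LINT \<omega>|M. e / 4 + 2 * B * indicator ?H \<omega>) = e / 4 + 2 * B * measure M ?H"
        by (subst Bochner_Integration.integral_add) (use iH Hs in \<open>auto simp: M.prob_space\<close>)
      also have "(LINT \<omega>|M. 2 * B * (\<Sum>i<n. indicator (?E i) \<omega>)) = 2 * B * (\<Sum>i<n. p r i)"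
        by (subst integral_mult_right_zero, subst Bochner_Integration.integral_sum) (use iE Es in \<open>auto simp: p_def\<close>)
      finally show ?thesis .
    qed
    also have "\<dots> < e"
    proof -
      have "2 * B * measure M ?H \<le> (2 * B + 1) * (e / (4 * (2 * B + 1)))"
        unfolding mH using B0 \<delta> by (intro mult_mono) auto
      also have "\<dots> = e / 4" using B0 by (simp add: field_simps add_nonneg_eq_0_iff)
      finally show ?thesis using elim(2) \<open>e > 0\<close> by linarith
    qed
    finally show ?case unfolding eqA dist_real_def .
  qed
qed

section \<open>Convergence of series of bounded martingale differences\<close>

text \<open>
  The sum of \<open>z\<^sub>m, z\<^sub>m\<^sub>+\<^sub>1, \<dots>\<close>, frozen once its absolute value has reached \<open>\<epsilon>\<close>.
\<close>

primrec stopped_sum :: "real \<Rightarrow> nat \<Rightarrow> (nat \<Rightarrow> real) \<Rightarrow> nat \<Rightarrow> real" where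
  "stopped_sum \<epsilon> m z 0 = 0"
| "stopped_sum \<epsilon> m z (Suc n) =
     stopped_sum \<epsilon> m z n + z (m + n) * (if \<bar>stopped_sum \<epsilon> m z n\<bar> < \<epsilon> then 1 else 0)"

text \<open>
  A stopped sum below \<open>\<epsilon>\<close> has never stopped. Hence large partial sums force a large stopped sum.
\<close>

lemma stopped_sum_eq:
  assumes "\<bar>stopped_sum \<epsilon> m z n\<bar> < \<epsilon>" "k \<le> n"
  shows "stopped_sum \<epsilon> m z k = (\<Sum>i<k. z (m + i)) \<and> \<bar>stopped_sum \<epsilon> m z k\<bar> < \<epsilon>"
  using assms
proof (induction n arbitrary: k)
  case (Suc n)
  have *: "\<bar>stopped_sum \<epsilon> m z n\<bar> < \<epsilon>"
    using Suc.prems(1) by (auto split: if_splits)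
  show ?case
  proof (cases "k \<le> n")
    case True
    then show ?thesis using Suc.IH * by blast
  next
    case False
    then have "k = Suc n" using Suc.prems by simp
    then show ?thesis using Suc.IH[OF *, of n] * Suc.prems by simp
  qed
qed auto

lemma stopped_sum_restrict:
  "m + n \<le> j \<Longrightarrow> stopped_sum \<epsilon> m (restrict z {..<j}) n = stopped_sum \<epsilon> m z n"
  by (induction n) auto

lemma stopped_sum_measurable:
  "m + n \<le> j \<Longrightarrow> (\<lambda>z. stopped_sum \<epsilon> m z n) \<in> borel_measurable (PiM {..<j} (\<lambda>_. borel))"
proof (induction n)
  case (Suc n)
  have [measurable]: "(\<lambda>z. z (m + n)) \<in> borel_measurable (PiM {..<j} (\<lambda>_. borel))"
    using Suc.prems by (intro measurable_component_singleton) auto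
  have [measurable]: "(\<lambda>z. stopped_sum \<epsilon> m z n) \<in> borel_measurable (PiM {..<j} (\<lambda>_. borel))"
    using Suc by simp
  show ?case by simp
qed simp

lemma stopped_sum_bounded:
  assumes "\<And>i. \<bar>z i\<bar> \<le> 1" shows "\<bar>stopped_sum \<epsilon> m z n\<bar> \<le> n"
proof (induction n)
  case (Suc n)
  have "\<bar>z (m + n) * (if \<bar>stopped_sum \<epsilon> m z n\<bar> < \<epsilon> then 1 else 0)\<bar> \<le> 1"
    using assms by auto
  then show ?case using Suc by simp
qed simp

text \<open>
  Conditional expectation zero is expressed through test functions of the past.
\<close>

locale bounded_martingale_differences = prob_space M for M :: "'a measure" +
  fixes Z :: "nat \<Rightarrow> 'a \<Rightarrow> real"
  assumes Z_measurable [measurable]: "\<And>i. Z i \<in> borel_measurable M"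
    and Z_bounded: "\<And>i \<omega>. \<bar>Z i \<omega>\<bar> \<le> 1"
    and Z_orthogonal: "\<And>j H B. H \<in> borel_measurable (PiM {..<j} (\<lambda>_. borel)) \<Longrightarrow>
      (\<And>\<omega>. \<bar>H (restrict (\<lambda>i. Z i \<omega>) {..<j})\<bar> \<le> B) \<Longrightarrow>
      expectation (\<lambda>\<omega>. Z j \<omega> * H (restrict (\<lambda>i. Z i \<omega>) {..<j})) = 0"
begin

lemma stopped_measurable [measurable]:
  "(\<lambda>\<omega>. stopped_sum \<epsilon> m (\<lambda>i. Z i \<omega>) n) \<in> borel_measurable M"
  by (induction n) auto

lemma stopped_abs_le: "\<bar>stopped_sum \<epsilon> m (\<lambda>i. Z i \<omega>) n\<bar> \<le> n"
  by (intro stopped_sum_bounded Z_bounded)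

lemma Z_square_integrable: "integrable M (\<lambda>\<omega>. (Z i \<omega>)\<^sup>2)"
  by (rule integrable_const_bound[where B=1]) (auto simp: abs_square_le_1 Z_bounded)

text \<open>
  The increments of the stopped sum are orthogonal to its past, and stopping only reduces their second
  moments.
\<close>

lemma stopped_second_moment:
  "expectation (\<lambda>\<omega>. (stopped_sum \<epsilon> m (\<lambda>i. Z i \<omega>) n)\<^sup>2) \<le> (\<Sum>i<n. expectation (\<lambda>\<omega>. (Z (m + i) \<omega>)\<^sup>2))"
proof (induction n)
  case (Suc n)
  let ?T = "\<lambda>\<omega>. stopped_sum \<epsilon> m (\<lambda>i. Z i \<omega>) n"
  let ?g = "\<lambda>\<omega>. (if \<bar>?T \<omega>\<bar> < \<epsilon> then 1 else 0 :: real)"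
  \<comment> \<open>the test function that makes the cross term vanish: the stopped sum while it is still running\<close>
  let ?H = "\<lambda>z. stopped_sum \<epsilon> m z n * (if \<bar>stopped_sum \<epsilon> m z n\<bar> < \<epsilon> then 1 else 0 :: real)"
  have Hm: "?H \<in> borel_measurable (PiM {..<m+n} (\<lambda>_. borel))"
    using stopped_sum_measurable[of m n "m+n" \<epsilon>] by measurable
  have "expectation (\<lambda>\<omega>. Z (m+n) \<omega> * ?H (restrict (\<lambda>i. Z i \<omega>) {..<m+n})) = 0"
    by (rule Z_orthogonal[OF Hm, where B=n])
       (use stopped_abs_le[of \<epsilon> m _ n] in \<open>auto simp: stopped_sum_restrict\<close>)
  then have cross: "expectation (\<lambda>\<omega>. Z (m+n) \<omega> * (?T \<omega> * ?g \<omega>)) = 0"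
    by (simp only: stopped_sum_restrict[OF order_refl])
  have i1: "integrable M (\<lambda>\<omega>. (?T \<omega>)\<^sup>2)"
    by (rule integrable_const_bound[where B="(real n)\<^sup>2"])
       (use stopped_abs_le[of \<epsilon> m _ n] in \<open>auto intro!: power2_le_iff_abs_le[THEN iffD2]\<close>)
  have i2: "integrable M (\<lambda>\<omega>. Z (m+n) \<omega> * (?T \<omega> * ?g \<omega>))"
  proof (rule integrable_const_bound[where B="real n"])
    show "AE \<omega> in M. norm (Z (m+n) \<omega> * (?T \<omega> * ?g \<omega>)) \<le> real n"
      using mult_mono[OF Z_bounded[of "m+n"] stopped_abs_le[of \<epsilon> m _ n]]
      by (auto simp: abs_mult)
  qed simp
  have i3: "integrable M (\<lambda>\<omega>. (Z (m+n) \<omega>)\<^sup>2 * ?g \<omega>)"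
    by (rule integrable_const_bound[where B=1]) (auto simp: abs_square_le_1 Z_bounded)
  have "expectation (\<lambda>\<omega>. (stopped_sum \<epsilon> m (\<lambda>i. Z i \<omega>) (Suc n))\<^sup>2)
     = expectation (\<lambda>\<omega>. (?T \<omega>)\<^sup>2 + 2 * (Z (m+n) \<omega> * (?T \<omega> * ?g \<omega>)) + (Z (m+n) \<omega>)\<^sup>2 * ?g \<omega>)"
    by (intro Bochner_Integration.integral_cong) (auto simp: power2_eq_square algebra_simps)
  also have "\<dots> = expectation (\<lambda>\<omega>. (?T \<omega>)\<^sup>2) + expectation (\<lambda>\<omega>. (Z (m+n) \<omega>)\<^sup>2 * ?g \<omega>)"
    using i1 i2 i3 cross by simp
  also have "expectation (\<lambda>\<omega>. (Z (m+n) \<omega>)\<^sup>2 * ?g \<omega>) \<le> expectation (\<lambda>\<omega>. (Z (m+n) \<omega>)\<^sup>2)"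
    by (intro integral_mono i3 Z_square_integrable) auto
  finally show ?case using Suc.IH by simp
qed simp

text \<open>
  Kolmogorov's inequality: Chebyshev's inequality for the stopped sum.
\<close>

lemma maximal_inequality:
  assumes "\<epsilon> > 0"
  shows "prob {\<omega>\<in>space M. \<exists>k\<le>n. \<epsilon> \<le> \<bar>\<Sum>i<k. Z (m + i) \<omega>\<bar>}
           \<le> (\<Sum>i<n. expectation (\<lambda>\<omega>. (Z (m + i) \<omega>)\<^sup>2)) / \<epsilon>\<^sup>2"
proof -
  let ?T = "\<lambda>\<omega>. stopped_sum \<epsilon> m (\<lambda>i. Z i \<omega>) n"
  have i1: "integrable M (\<lambda>\<omega>. (?T \<omega>)\<^sup>2)"
    by (rule integrable_const_bound[where B="(real n)\<^sup>2"])
       (use stopped_abs_le[of \<epsilon> m _ n] in \<open>auto intro!: power2_le_iff_abs_le[THEN iffD2]\<close>)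
  have "prob {\<omega>\<in>space M. \<exists>k\<le>n. \<epsilon> \<le> \<bar>\<Sum>i<k. Z (m + i) \<omega>\<bar>} \<le> prob {\<omega>\<in>space M. (?T \<omega>)\<^sup>2 \<ge> \<epsilon>\<^sup>2}"
  proof (rule finite_measure_mono)
    show "{\<omega> \<in> space M. \<exists>k\<le>n. \<epsilon> \<le> \<bar>\<Sum>i<k. Z (m + i) \<omega>\<bar>} \<subseteq> {\<omega> \<in> space M. \<epsilon>\<^sup>2 \<le> (?T \<omega>)\<^sup>2}"
    proof safe
      fix \<omega> k assume k: "k \<le> n" "\<epsilon> \<le> \<bar>\<Sum>i<k. Z (m + i) \<omega>\<bar>"
      then have "\<epsilon> \<le> \<bar>?T \<omega>\<bar>"
        using stopped_sum_eq[of \<epsilon> m "\<lambda>i. Z i \<omega>" n k] by force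
      then show "\<epsilon>\<^sup>2 \<le> (?T \<omega>)\<^sup>2"
        using assms by (simp add: abs_le_square_iff[symmetric])
    qed
  qed measurable
  also have "\<dots> \<le> expectation (\<lambda>\<omega>. (?T \<omega>)\<^sup>2) / \<epsilon>\<^sup>2"
    by (rule integral_Markov_inequality_measure[where A="{}"]) (use i1 assms in auto)
  also have "\<dots> \<le> (\<Sum>i<n. expectation (\<lambda>\<omega>. (Z (m + i) \<omega>)\<^sup>2)) / \<epsilon>\<^sup>2"
    using stopped_second_moment assms by (intro divide_right_mono) auto
  finally show ?thesis .
qed

lemma maximal_inequality_infinite:
  assumes "\<epsilon> > 0" and sm: "summable (\<lambda>i. expectation (\<lambda>\<omega>. (Z i \<omega>)\<^sup>2))"
  shows "prob {\<omega>\<in>space M. \<exists>k. \<epsilon> \<le> \<bar>\<Sum>i<k. Z (m + i) \<omega>\<bar>}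
           \<le> (\<Sum>i. expectation (\<lambda>\<omega>. (Z (i + m) \<omega>)\<^sup>2)) / \<epsilon>\<^sup>2"
proof -
  define A where "A n = {\<omega>\<in>space M. \<exists>k\<le>n. \<epsilon> \<le> \<bar>\<Sum>i<k. Z (m + i) \<omega>\<bar>}" for n
  have [measurable]: "A n \<in> sets M" for n unfolding A_def by measurable
  have "(\<lambda>n. prob (A n)) \<longlonglongrightarrow> prob (\<Union>n. A n)"
  proof (rule finite_Lim_measure_incseq)
    show "incseq A" unfolding A_def by (rule incseq_SucI) (auto intro: le_SucI)
  qed auto
  moreover have "prob (A n) \<le> (\<Sum>i. expectation (\<lambda>\<omega>. (Z (i + m) \<omega>)\<^sup>2)) / \<epsilon>\<^sup>2" for n
  proof -
    have "prob (A n) \<le> (\<Sum>i<n. expectation (\<lambda>\<omega>. (Z (i + m) \<omega>)\<^sup>2)) / \<epsilon>\<^sup>2"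
      using maximal_inequality[OF assms(1), of n m] by (simp add: A_def add.commute)
    also have "\<dots> \<le> (\<Sum>i. expectation (\<lambda>\<omega>. (Z (i + m) \<omega>)\<^sup>2)) / \<epsilon>\<^sup>2"
      by (intro divide_right_mono sum_le_suminf) (use sm in \<open>auto simp: summable_iff_shift[of "\<lambda>i. expectation (\<lambda>\<omega>. (Z i \<omega>)\<^sup>2)" m]\<close>)
    finally show ?thesis .
  qed
  ultimately have "prob (\<Union>n. A n) \<le> (\<Sum>i. expectation (\<lambda>\<omega>. (Z (i + m) \<omega>)\<^sup>2)) / \<epsilon>\<^sup>2"
    by (intro LIMSEQ_le_const2) auto
  moreover have "(\<Union>n. A n) = {\<omega>\<in>space M. \<exists>k. \<epsilon> \<le> \<bar>\<Sum>i<k. Z (m + i) \<omega>\<bar>}"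
    unfolding A_def by auto
  ultimately show ?thesis by simp
qed

theorem AE_summable:
  assumes sm: "summable (\<lambda>i. expectation (\<lambda>\<omega>. (Z i \<omega>)\<^sup>2))"
  shows "AE \<omega> in M. summable (\<lambda>i. Z i \<omega>)"
proof -
  have *: "AE \<omega> in M. \<exists>m. \<forall>k. \<bar>\<Sum>i<k. Z (m + i) \<omega>\<bar> < \<epsilon>" if "\<epsilon> > 0" for \<epsilon> :: real
  proof -
    define B where "B = {\<omega>\<in>space M. \<forall>m. \<exists>k. \<epsilon> \<le> \<bar>\<Sum>i<k. Z (m + i) \<omega>\<bar>}"
    have [measurable]: "B \<in> sets M" unfolding B_def by measurable
    have "prob B \<le> (\<Sum>i. expectation (\<lambda>\<omega>. (Z (i + m) \<omega>)\<^sup>2)) / \<epsilon>\<^sup>2" for m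
    proof -
      have "prob B \<le> prob {\<omega>\<in>space M. \<exists>k. \<epsilon> \<le> \<bar>\<Sum>i<k. Z (m + i) \<omega>\<bar>}"
        by (rule finite_measure_mono) (auto simp: B_def)
      then show ?thesis using maximal_inequality_infinite[OF that sm, of m] by simp
    qed
    moreover have "(\<lambda>m. (\<Sum>i. expectation (\<lambda>\<omega>. (Z (i + m) \<omega>)\<^sup>2)) / \<epsilon>\<^sup>2) \<longlonglongrightarrow> 0 / \<epsilon>\<^sup>2"
      by (intro tendsto_divide suminf_exist_split2 sm tendsto_const) (use that in auto)
    ultimately have "prob B \<le> 0"
      by (intro LIMSEQ_le_const[where X="\<lambda>m. (\<Sum>i. expectation (\<lambda>\<omega>. (Z (i + m) \<omega>)\<^sup>2)) / \<epsilon>\<^sup>2"]) auto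
    then have "prob B = 0" using measure_le_0_iff by blast
    then have "AE \<omega> in M. \<omega> \<notin> B" by (simp add: prob_eq_0)
    then show ?thesis by (rule AE_mp) (auto simp: B_def not_le)
  qed
  have "AE \<omega> in M. \<forall>n. \<exists>m. \<forall>k. \<bar>\<Sum>i<k. Z (m + i) \<omega>\<bar> < 1 / real (Suc n)"
    unfolding AE_all_countable by (intro allI *) simp
  then show ?thesis
  proof (rule AE_mp, intro AE_I2 impI)
    fix \<omega> assume \<omega>: "\<forall>n. \<exists>m. \<forall>k. \<bar>\<Sum>i<k. Z (m + i) \<omega>\<bar> < 1 / real (Suc n)"
    show "summable (\<lambda>i. Z i \<omega>)"
      unfolding summable_Cauchy
    proof (intro allI impI)
      fix e :: real assume "e > 0"
      then obtain n where n: "1 / real (Suc n) < e / 2"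
        using reals_Archimedean[of "e/2"] by (auto simp: inverse_eq_divide)
      obtain N where N: "\<And>k. \<bar>\<Sum>i<k. Z (N + i) \<omega>\<bar> < 1 / real (Suc n)" using \<omega> by blast
      have N': "\<bar>sum (\<lambda>i. Z i \<omega>) {N..<k}\<bar> < e / 2" if "N \<le> k" for k
      proof -
        have "sum (\<lambda>i. Z i \<omega>) {N..<k} = (\<Sum>i<k-N. Z (N + i) \<omega>)"
          by (rule sum.reindex_bij_witness[where i="\<lambda>i. N + i" and j="\<lambda>i. i - N"]) auto
        then show ?thesis using N[of "k - N"] n by simp
      qed
      show "\<exists>N. \<forall>m\<ge>N. \<forall>n. norm (sum (\<lambda>i. Z i \<omega>) {m..<n}) < e"
      proof (intro exI allI impI)
        fix m k assume m: "N \<le> m"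
        show "norm (sum (\<lambda>i. Z i \<omega>) {m..<k}) < e"
        proof (cases "m \<le> k")
          case True
          have "sum (\<lambda>i. Z i \<omega>) {N..<k} = sum (\<lambda>i. Z i \<omega>) {N..<m} + sum (\<lambda>i. Z i \<omega>) {m..<k}"
            using m True by (simp add: sum.atLeastLessThan_concat)
          moreover have "\<bar>sum (\<lambda>i. Z i \<omega>) {N..<m}\<bar> < e / 2" "\<bar>sum (\<lambda>i. Z i \<omega>) {N..<k}\<bar> < e / 2"
            using N' m True by auto
          ultimately show ?thesis unfolding real_norm_def by linarith
        qed (use \<open>e > 0\<close> in simp)
      qed
    qed
  qed
qed

text \<open>
  The factor \<open>2\<close> leaves room for passing from the limit to a partial sum.
\<close>

lemma suminf_tail_bound:
  assumes "\<epsilon> > 0" and sm: "summable (\<lambda>i. expectation (\<lambda>\<omega>. (Z i \<omega>)\<^sup>2))"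
  shows "prob {\<omega>\<in>space M. 2 * \<epsilon> \<le> \<bar>\<Sum>i. Z i \<omega>\<bar>} \<le> (\<Sum>i. expectation (\<lambda>\<omega>. (Z i \<omega>)\<^sup>2)) / \<epsilon>\<^sup>2"
proof -
  have "prob {\<omega>\<in>space M. 2 * \<epsilon> \<le> \<bar>\<Sum>i. Z i \<omega>\<bar>}
       \<le> prob {\<omega>\<in>space M. \<exists>k. \<epsilon> \<le> \<bar>\<Sum>i<k. Z (0 + i) \<omega>\<bar>}"
  proof (rule finite_measure_mono_AE)
    show "AE \<omega> in M. \<omega> \<in> {\<omega> \<in> space M. 2 * \<epsilon> \<le> \<bar>\<Sum>i. Z i \<omega>\<bar>} \<longrightarrow>
        \<omega> \<in> {\<omega> \<in> space M. \<exists>k. \<epsilon> \<le> \<bar>\<Sum>i<k. Z (0 + i) \<omega>\<bar>}"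
      using AE_summable[OF sm]
    proof (rule AE_mp, intro AE_I2 impI)
      fix \<omega> assume sw: "summable (\<lambda>i. Z i \<omega>)" and \<omega>: "\<omega> \<in> {\<omega> \<in> space M. 2 * \<epsilon> \<le> \<bar>\<Sum>i. Z i \<omega>\<bar>}"
      have "(\<lambda>k. \<bar>\<Sum>i<k. Z i \<omega>\<bar>) \<longlonglongrightarrow> \<bar>\<Sum>i. Z i \<omega>\<bar>"
        by (intro tendsto_rabs summable_LIMSEQ sw)
      moreover have "\<epsilon> < \<bar>\<Sum>i. Z i \<omega>\<bar>" using \<omega> assms by auto
      ultimately have "\<forall>\<^sub>F k in sequentially. \<epsilon> < \<bar>\<Sum>i<k. Z i \<omega>\<bar>"
        by (rule order_tendstoD)
      then obtain k where "\<epsilon> < \<bar>\<Sum>i<k. Z i \<omega>\<bar>" by (auto simp: eventually_sequentially)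
      then show "\<omega> \<in> {\<omega> \<in> space M. \<exists>k. \<epsilon> \<le> \<bar>\<Sum>i<k. Z (0 + i) \<omega>\<bar>}"
        using \<omega> by (auto intro!: exI[of _ k])
    qed
  qed measurable
  also have "\<dots> \<le> (\<Sum>i. expectation (\<lambda>\<omega>. (Z i \<omega>)\<^sup>2)) / \<epsilon>\<^sup>2"
    using maximal_inequality_infinite[OF assms, of 0] by simp
  finally show ?thesis .
qed

end

section \<open>Sequences of gaps, marks and signs\<close>

text \<open>
  Signs and test functions are bounded only almost surely, or only along the process. Clipping makes them
  bounded everywhere without changing the relevant values.
\<close>

definition clip :: "real \<Rightarrow> real \<Rightarrow> real" where "clip B x = max (- B) (min B x)"

lemma clip_measurable [measurable]: "clip B \<in> borel_measurable borel"
  unfolding clip_def by measurable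

lemma clip_abs_le: "0 \<le> B \<Longrightarrow> \<bar>clip B x\<bar> \<le> B"
  by (auto simp: clip_def)

lemma clip_eq: "\<bar>x\<bar> \<le> B \<Longrightarrow> clip B x = x"
  by (auto simp: clip_def)

text \<open>
  The marginal laws follow from the joint law of a triple; they are listed in the form in which the theory
  of distributed random variables uses them.
\<close>

locale marked_poisson = prob_space M for M :: "'a measure" +
  fixes E V \<gamma> :: "nat \<Rightarrow> 'a \<Rightarrow> real" and m :: "real \<Rightarrow> real"
  assumes indep: "indep_vars (\<lambda>_. borel) (\<lambda>i \<omega>. (E i \<omega>, V i \<omega>, \<gamma> i \<omega>)) UNIV"
    and triple_law: "\<And>i. distr M borel (\<lambda>\<omega>. (E i \<omega>, V i \<omega>, \<gamma> i \<omega>)) =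
      density lborel (exponential_density 1) \<Otimes>\<^sub>M (density lborel m \<Otimes>\<^sub>M distr M borel (\<gamma> i))"
    and E_exp: "\<And>i. distributed M lborel (E i) (exponential_density 1)"
    and V_density: "\<And>i. distributed M lborel (V i) m"
    and sign_pos: "\<And>i. prob {\<omega>\<in>space M. \<gamma> i \<omega> = 1} = 1 / 2"
    and sign_neg: "\<And>i. prob {\<omega>\<in>space M. \<gamma> i \<omega> = - 1} = 1 / 2"
    and \<gamma>_measurable [measurable]: "\<And>i. \<gamma> i \<in> borel_measurable M"
    and m_measurable [measurable]: "m \<in> borel_measurable borel"
    and m_pos: "\<And>v. 0 < m v"
begin

abbreviation "Em \<equiv> density lborel (exponential_density 1)"
abbreviation "Dm \<equiv> density lborel m"
abbreviation "past n \<omega> \<equiv> restrict (\<lambda>i. (E i \<omega>, V i \<omega>, \<gamma> i \<omega>)) {..<n}"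
abbreviation "PM n \<equiv> PiM {..<n} (\<lambda>_. borel :: (real \<times> real \<times> real) measure)"

lemma E_measurable [measurable]: "E i \<in> borel_measurable M"
  using E_exp[of i] by (simp add: distributed_def)

lemma V_measurable [measurable]: "V i \<in> borel_measurable M"
  using V_density[of i] by (simp add: distributed_def)

lemma past_measurable [measurable]: "past n \<in> measurable M (PM n)"
  by (rule measurable_restrict) (simp add: borel_prod[symmetric])

lemma prob_space_Em: "prob_space Em" by (rule prob_space_exponential_density) simp

lemma prob_space_Dm: "prob_space Dm"
  using V_density[of 0] by (metis distributed_distr_eq_density distributed_measurable prob_space_distr)

lemma prob_space_sign: "prob_space (distr M borel (\<gamma> i))" by (rule prob_space_distr) simp

lemma AE_sign: "AE \<omega> in M. \<gamma> i \<omega> = 1 \<or> \<gamma> i \<omega> = - 1"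
proof -
  have "prob ({\<omega>\<in>space M. \<gamma> i \<omega> = 1} \<union> {\<omega>\<in>space M. \<gamma> i \<omega> = - 1}) = 1"
    by (subst finite_measure_Union) (auto simp: sign_pos sign_neg)
  then have "AE \<omega> in M. \<omega> \<in> {\<omega>\<in>space M. \<gamma> i \<omega> = 1} \<union> {\<omega>\<in>space M. \<gamma> i \<omega> = - 1}"
    by (intro prob_eq_1[THEN iffD1]) auto
  then show ?thesis by (rule AE_mp) auto
qed

lemma sign_integral:
  fixes h :: "real \<Rightarrow> 'b :: {banach, second_countable_topology}"
  assumes [measurable]: "h \<in> borel_measurable borel"
  shows "(LINT s|distr M borel (\<gamma> i). h s) = (1 / 2) *\<^sub>R (h 1 + h (- 1))"
proof -
  let ?A = "{\<omega>\<in>space M. \<gamma> i \<omega> = 1}" and ?B = "{\<omega>\<in>space M. \<gamma> i \<omega> = - 1}"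
  have "(LINT s|distr M borel (\<gamma> i). h s) = (LINT \<omega>|M. h (\<gamma> i \<omega>))"
    by (subst integral_distr) auto
  also have "\<dots> = (LINT \<omega>|M. indicator ?A \<omega> *\<^sub>R h 1 + indicator ?B \<omega> *\<^sub>R h (- 1))"
    by (rule integral_cong_AE) (use AE_sign[of i] AE_space in \<open>auto elim!: eventually_elim2 simp: indicator_def\<close>)
  also have "\<dots> = (LINT \<omega>|M. indicator ?A \<omega> *\<^sub>R h 1) + (LINT \<omega>|M. indicator ?B \<omega> *\<^sub>R h (- 1))"
    by (intro Bochner_Integration.integral_add integrable_scaleR_left integrable_real_indicator)
       (auto simp: emeasure_eq_measure)
  also have "\<dots> = prob ?A *\<^sub>R h 1 + prob ?B *\<^sub>R h (- 1)"
    by (subst (1 2) integral_scaleR_left) (auto simp: emeasure_eq_measure intro!: integrable_real_indicator)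
  finally show ?thesis by (simp add: sign_pos sign_neg scaleR_add_right)
qed

lemma joint_law:
  "distr M (PM n \<Otimes>\<^sub>M borel) (\<lambda>\<omega>. (past n \<omega>, (E n \<omega>, V n \<omega>, \<gamma> n \<omega>))) =
   distr M (PM n) (past n) \<Otimes>\<^sub>M (Em \<Otimes>\<^sub>M (Dm \<Otimes>\<^sub>M distr M borel (\<gamma> n)))"
proof -
  let ?X = "\<lambda>i \<omega>. (E i \<omega>, V i \<omega>, \<gamma> i \<omega>)"
  let ?Q = "distr M (PiM {n} (\<lambda>_. borel)) (\<lambda>\<omega>. restrict (\<lambda>i. ?X i \<omega>) {n})"
  have "indep_var (PM n) (past n) (PiM {n} (\<lambda>_. borel)) (\<lambda>\<omega>. restrict (\<lambda>i. ?X i \<omega>) {n})"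
    by (rule indep_var_restrict[OF indep]) auto
  then have rm: "(\<lambda>\<omega>. restrict (\<lambda>i. ?X i \<omega>) {n}) \<in> measurable M (PiM {n} (\<lambda>_. borel))"
    and law: "distr M (PM n) (past n) \<Otimes>\<^sub>M ?Q =
       distr M (PM n \<Otimes>\<^sub>M PiM {n} (\<lambda>_. borel)) (\<lambda>\<omega>. (past n \<omega>, restrict (\<lambda>i. ?X i \<omega>) {n}))"
    by (simp_all add: indep_var_distribution_eq)
  have cm: "(\<lambda>x. x n) \<in> measurable (PiM {n} (\<lambda>_. borel)) (borel :: (real \<times> real \<times> real) measure)"
    by (rule measurable_component_singleton) simp
  have "distr ?Q borel (\<lambda>x. x n) = distr M borel (?X n)"
    by (subst distr_distr[OF cm rm]) (simp add: comp_def)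
  then have "distr M (PM n) (past n) \<Otimes>\<^sub>M (Em \<Otimes>\<^sub>M (Dm \<Otimes>\<^sub>M distr M borel (\<gamma> n))) =
     distr (distr M (PM n) (past n)) (PM n) (\<lambda>x. x) \<Otimes>\<^sub>M distr ?Q borel (\<lambda>x. x n)"
    by (simp add: triple_law distr_id2)
  also have "\<dots> = distr (distr M (PM n) (past n) \<Otimes>\<^sub>M ?Q) (PM n \<Otimes>\<^sub>M borel) (\<lambda>(x, y). (x, y n))"
  proof (rule pair_measure_distr)
    have "prob_space (distr ?Q borel (\<lambda>x. x n))"
      by (intro prob_space.prob_space_distr prob_space_distr rm) (use cm in simp)
    then show "sigma_finite_measure (distr ?Q borel (\<lambda>x. x n))"
      by (rule prob_space_imp_sigma_finite)
  qed (use cm in simp_all)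
  also have "\<dots> = distr M (PM n \<Otimes>\<^sub>M borel) (\<lambda>\<omega>. (past n \<omega>, (E n \<omega>, V n \<omega>, \<gamma> n \<omega>)))"
    unfolding law using rm cm
    by (subst distr_distr) (auto simp: comp_def intro!: measurable_Pair measurable_compose[OF measurable_snd] measurable_fst)
  finally show ?thesis ..
qed

lemma past_triple_measurable: "(\<lambda>\<omega>. (past n \<omega>, (E n \<omega>, V n \<omega>, \<gamma> n \<omega>))) \<in> measurable M (PM n \<Otimes>\<^sub>M borel)"
  by (intro measurable_Pair past_measurable) (simp add: borel_prod[symmetric])

text \<open>
  The Markov property of the sequence in the form used below: the \<open>n\<close>-th triple is integrated out, given
  the past.
\<close>

lemma one_step:
  fixes g :: "(nat \<Rightarrow> real \<times> real \<times> real) \<Rightarrow> real \<Rightarrow> real \<Rightarrow> real \<Rightarrow> 'b :: {banach, second_countable_topology}"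
  assumes gm: "(\<lambda>(p, e, v, s). g p e v s) \<in> borel_measurable (PM n \<Otimes>\<^sub>M (borel \<Otimes>\<^sub>M (borel \<Otimes>\<^sub>M borel)))"
    and bd: "\<And>p e v s. norm (g p e v s) \<le> B"
  defines "avg \<equiv> \<lambda>p. LINT e|Em. (LINT v|Dm. (1 / 2) *\<^sub>R (g p e v 1 + g p e v (- 1)))"
  shows "(LINT \<omega>|M. g (past n \<omega>) (E n \<omega>) (V n \<omega>) (\<gamma> n \<omega>)) = (LINT \<omega>|M. avg (past n \<omega>))"
    and "avg \<in> borel_measurable (PM n)"
proof -
  let ?P = "distr M (PM n) (past n)" and ?S = "distr M borel (\<gamma> n)"
  let ?T = "Em \<Otimes>\<^sub>M (Dm \<Otimes>\<^sub>M ?S)"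
  interpret P: prob_space ?P by (rule prob_space_distr) simp
  interpret X: prob_space Em by (rule prob_space_Em)
  interpret D: prob_space Dm by (rule prob_space_Dm)
  interpret S: prob_space ?S by (rule prob_space_sign)
  interpret DS: pair_prob_space Dm ?S ..
  interpret T: pair_prob_space Em "Dm \<Otimes>\<^sub>M ?S" ..
  interpret PT: pair_prob_space ?P ?T ..
  let ?g = "\<lambda>(p, e, v, s). g p e v s"
  have gm': "?g \<in> borel_measurable (?P \<Otimes>\<^sub>M ?T)"
    using gm by (subst measurable_cong_sets[OF _ refl, where M'="PM n \<Otimes>\<^sub>M (borel \<Otimes>\<^sub>M (borel \<Otimes>\<^sub>M borel))"])
      (auto intro!: sets_pair_measure_cong)
  have gm2 [measurable]: "?g \<in> borel_measurable (PM n \<Otimes>\<^sub>M borel)"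
    using gm by (simp add: borel_prod)
  have i: "integrable (?P \<Otimes>\<^sub>M ?T) ?g"
    by (rule PT.integrable_const_bound[where B=B]) (use bd gm' in auto)
  have sp: "space ?P = space (PM n)" by simp
  have "(LINT \<omega>|M. g (past n \<omega>) (E n \<omega>) (V n \<omega>) (\<gamma> n \<omega>)) =
      (LINT x|distr M (PM n \<Otimes>\<^sub>M borel) (\<lambda>\<omega>. (past n \<omega>, (E n \<omega>, V n \<omega>, \<gamma> n \<omega>))). ?g x)"
    by (subst integral_distr[OF past_triple_measurable gm2]) simp
  also have "\<dots> = (LINT x|(?P \<Otimes>\<^sub>M ?T). ?g x)" by (simp add: joint_law)
  also have "\<dots> = (LINT p|?P. LINT x|?T. ?g (p, x))"
    by (rule PT.integral_fst'[symmetric, OF i])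
  also have "\<dots> = (LINT p|?P. avg p)"
    unfolding avg_def
  proof (rule Bochner_Integration.integral_cong[OF refl])
    fix p assume p: "p \<in> space ?P"
    have m1: "(\<lambda>(e, v, s). g p e v s) \<in> borel_measurable (borel \<Otimes>\<^sub>M (borel \<Otimes>\<^sub>M borel))"
      using measurable_Pair2[OF gm, of p] p by simp
    have m1': "(\<lambda>(e, v, s). g p e v s) \<in> borel_measurable ?T"
      using m1 by (subst measurable_cong_sets[OF _ refl, where M'="borel \<Otimes>\<^sub>M (borel \<Otimes>\<^sub>M borel)"]) (auto intro!: sets_pair_measure_cong)
    have "integrable ?T (\<lambda>(e, v, s). g p e v s)"
      by (rule T.integrable_const_bound[where B=B]) (use bd m1' in auto)
    then have "(LINT x|?T. ?g (p, x)) = (LINT e|Em. LINT y|(Dm \<Otimes>\<^sub>M ?S). (\<lambda>(v, s). g p e v s) y)"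
      by (subst T.integral_fst'[symmetric]) (auto simp: case_prod_beta')
    also have "\<dots> = (LINT e|Em. LINT v|Dm. (1 / 2) *\<^sub>R (g p e v 1 + g p e v (- 1)))"
    proof (rule Bochner_Integration.integral_cong[OF refl])
      fix e :: real
      have m2: "(\<lambda>(v, s). g p e v s) \<in> borel_measurable (borel \<Otimes>\<^sub>M borel)"
        using measurable_Pair2[OF m1, of e] by simp
      have m2': "(\<lambda>(v, s). g p e v s) \<in> borel_measurable (Dm \<Otimes>\<^sub>M ?S)"
        using m2 by (subst measurable_cong_sets[OF _ refl, where M'="borel \<Otimes>\<^sub>M borel"]) (auto intro!: sets_pair_measure_cong)
      have "integrable (Dm \<Otimes>\<^sub>M ?S) (\<lambda>(v, s). g p e v s)"
        by (rule DS.integrable_const_bound[where B=B]) (use bd m2' in auto)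
      then have "(LINT y|(Dm \<Otimes>\<^sub>M ?S). (\<lambda>(v, s). g p e v s) y) = (LINT v|Dm. LINT s|?S. g p e v s)"
        by (subst DS.integral_fst'[symmetric]) auto
      also have "\<dots> = (LINT v|Dm. (1 / 2) *\<^sub>R (g p e v 1 + g p e v (- 1)))"
      proof (rule Bochner_Integration.integral_cong[OF refl])
        fix v :: real
        show "(LINT s|?S. g p e v s) = (1 / 2) *\<^sub>R (g p e v 1 + g p e v (- 1))"
          using measurable_Pair2[OF m2, of v] by (intro sign_integral) simp
      qed
      finally show "(LINT y|(Dm \<Otimes>\<^sub>M ?S). (\<lambda>(v, s). g p e v s) y) = (LINT v|Dm. (1 / 2) *\<^sub>R (g p e v 1 + g p e v (- 1)))" .
    qed
    finally show "(LINT x|?T. ?g (p, x)) = (LINT e|Em. LINT v|Dm. (1 / 2) *\<^sub>R (g p e v 1 + g p e v (- 1)))" .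
  qed
  finally have eq: "(LINT \<omega>|M. g (past n \<omega>) (E n \<omega>) (V n \<omega>) (\<gamma> n \<omega>)) = (LINT p|?P. avg p)" .
  show avg_measurable: "avg \<in> borel_measurable (PM n)"
  proof -
    have cc: "(\<lambda>((p, e), v). g p e v s) \<in> borel_measurable ((PM n \<Otimes>\<^sub>M Em) \<Otimes>\<^sub>M Dm)" for s
    proof -
      have "(\<lambda>x. (\<lambda>(p, e, v, s). g p e v s) (fst (fst x), snd (fst x), snd x, s)) \<in> borel_measurable ((PM n \<Otimes>\<^sub>M Em) \<Otimes>\<^sub>M Dm)"
        by (rule measurable_compose[OF _ gm]) measurable
      then show ?thesis by (simp add: case_prod_beta')
    qed
    have "(\<lambda>((p, e), v). (1 / 2) *\<^sub>R (g p e v 1 + g p e v (- 1))) \<in> borel_measurable ((PM n \<Otimes>\<^sub>M Em) \<Otimes>\<^sub>M Dm)"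
      using cc[of 1] cc[of "-1"] unfolding case_prod_beta' by (intro borel_measurable_scaleR borel_measurable_add borel_measurable_const)
    then have "(\<lambda>(p, e). LINT v|Dm. (1 / 2) *\<^sub>R (g p e v 1 + g p e v (- 1))) \<in> borel_measurable (PM n \<Otimes>\<^sub>M Em)"
      unfolding case_prod_beta' by (intro D.borel_measurable_lebesgue_integral) (simp add: case_prod_beta')
    then show ?thesis
      unfolding avg_def by (intro X.borel_measurable_lebesgue_integral) simp
  qed
  show "(LINT \<omega>|M. g (past n \<omega>) (E n \<omega>) (V n \<omega>) (\<gamma> n \<omega>)) = (LINT \<omega>|M. avg (past n \<omega>))"
    unfolding eq by (rule integral_distr[OF past_measurable avg_measurable])
qed

end

section \<open>Campbell's formula\<close>

text \<open>
  The Erlang densities sum to the constant intensity of the unit Poisson process.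
\<close>

lemma erlang_densities_sum:
  assumes "0 \<le> x" shows "(\<Sum>i. ennreal (erlang_density i 1 x)) = 1"
proof -
  have "(\<lambda>i. exp (- x) * (x ^ i /\<^sub>R fact i)) sums (exp (- x) * exp x)"
    by (intro sums_mult exp_converges)
  moreover have "exp (- x) * (x ^ i /\<^sub>R fact i) = erlang_density i 1 x" for i
    using assms by (simp add: erlang_density_def field_simps)
  ultimately have "(\<lambda>i. erlang_density i 1 x) sums 1"
    by (simp add: exp_minus)
  then have "(\<Sum>i. ennreal (erlang_density i 1 x)) = ennreal 1"
    by (subst suminf_ennreal2) (auto simp: sums_iff)
  then show ?thesis by simp
qed

context marked_poisson
begin

definition arrival :: "nat \<Rightarrow> 'a \<Rightarrow> real" where "arrival n \<omega> = (\<Sum>i<n. E i \<omega>)"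

text \<open>
  The rescaling makes Lebesgue measure the intensity of the points \<open>(point i, V i)\<close>, whatever the density
  \<open>m\<close> of the marks is.
\<close>

definition point :: "nat \<Rightarrow> 'a \<Rightarrow> real" where "point i \<omega> = arrival (Suc i) \<omega> * m (V i \<omega>)"

lemma arrival_measurable [measurable]: "arrival n \<in> borel_measurable M"
  unfolding arrival_def by measurable

lemma point_measurable [measurable]: "point n \<in> borel_measurable M"
  unfolding point_def by measurable

lemma E_indep: "indep_vars (\<lambda>_. borel) E UNIV"
  using indep_vars_compose2[OF indep, of "\<lambda>_. fst" "\<lambda>_. borel"] by (simp add: borel_prod[symmetric])

lemma arrival_distributed: "distributed M lborel (arrival (Suc n)) (erlang_density n 1)"
  using exponential_distributed_sum[of "{..<Suc n}" 1 E] E_exp indep_vars_subset[OF E_indep]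
  by (simp add: arrival_def[abs_def] lessThan_empty_iff)

lemma AE_E_pos: "AE \<omega> in M. \<forall>i. 0 < E i \<omega>"
proof (subst AE_all_countable, rule allI)
  fix i
  have "AE x in distr M lborel (E i). 0 < x"
    unfolding distributed_distr_eq_density[OF E_exp]
    by (subst AE_density) (use AE_lborel_singleton[of "0::real"] in \<open>auto simp: exponential_density_def elim!: eventually_mono\<close>)
  then show "AE \<omega> in M. 0 < E i \<omega>" by (subst (asm) AE_distr_iff) auto
qed

lemma AE_arrival_nonneg: "AE \<omega> in M. \<forall>n. 0 \<le> arrival n \<omega>"
  using AE_E_pos by eventually_elim (simp add: arrival_def sum_nonneg less_imp_le)

lemma past_component_measurable:
  assumes "i < n"
  shows "(\<lambda>p. fst (p i)) \<in> borel_measurable (PM n)" "(\<lambda>p. fst (snd (p i))) \<in> borel_measurable (PM n)"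
    "(\<lambda>p. snd (snd (p i))) \<in> borel_measurable (PM n)"
  using assms by (auto intro!: measurable_compose[OF measurable_component_singleton] simp: borel_prod[symmetric])

text \<open>
  Rectangles suffice, and for them \<open>one_step\<close> separates the factor of the mark.
\<close>

lemma arrival_mark_law:
  "distr M (borel \<Otimes>\<^sub>M borel) (\<lambda>\<omega>. (arrival (Suc n) \<omega>, V n \<omega>)) = distr M borel (arrival (Suc n)) \<Otimes>\<^sub>M Dm"
proof (rule pair_measure_eqI[symmetric])
  interpret D: prob_space Dm by (rule prob_space_Dm)
  interpret X: prob_space Em by (rule prob_space_Em)
  interpret A: prob_space "distr M borel (arrival (Suc n))" by (rule prob_space_distr) simp
  show "sigma_finite_measure (distr M borel (arrival (Suc n)))" "sigma_finite_measure Dm"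
    by unfold_locales
  show "sets (distr M borel (arrival (Suc n)) \<Otimes>\<^sub>M Dm) = sets (distr M (borel \<Otimes>\<^sub>M borel) (\<lambda>\<omega>. (arrival (Suc n) \<omega>, V n \<omega>)))"
    by (simp cong: sets_pair_measure_cong)
  fix A B assume "A \<in> sets (distr M borel (arrival (Suc n)))" "B \<in> sets Dm"
  then have [measurable]: "A \<in> sets borel" "B \<in> sets borel" by auto
  let ?L = "\<lambda>p. \<Sum>i<n. fst (p i) :: real"
  have [measurable]: "?L \<in> borel_measurable (PM n)"
    by (intro borel_measurable_sum past_component_measurable) auto
  \<comment> \<open>The two equal summands are the values at the signs \<open>1\<close> and \<open>-1\<close>.\<close>
  let ?J = "\<lambda>B'. LINT \<omega>|M. (LINT e|Em. (LINT v|Dm. (1 / 2) *\<^sub>R (indicator A (?L (past n \<omega>) + e) * indicator B' v + indicator A (?L (past n \<omega>) + e) * indicator B' v)))"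
  have step: "prob {\<omega>\<in>space M. arrival (Suc n) \<omega> \<in> A \<and> V n \<omega> \<in> B'} = ?J B'" if [measurable]: "B' \<in> sets borel" for B'
  proof -
    have "prob {\<omega>\<in>space M. arrival (Suc n) \<omega> \<in> A \<and> V n \<omega> \<in> B'} = (LINT \<omega>|M. indicator {\<omega>\<in>space M. arrival (Suc n) \<omega> \<in> A \<and> V n \<omega> \<in> B'} \<omega>)"
      by simp
    also have "\<dots> = (LINT \<omega>|M. indicator A (?L (past n \<omega>) + E n \<omega>) * indicator B' (V n \<omega>))"
      by (intro Bochner_Integration.integral_cong) (auto simp: arrival_def indicator_def)
    also have "\<dots> = ?J B'"
      by (rule one_step(1)[where B=1 and g="\<lambda>p e v s. indicator A (?L p + e) * indicator B' v"]) (measurable, auto simp: indicator_def)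
    finally show ?thesis .
  qed
  have U: "UNIV \<in> sets (borel :: real measure)" by simp
  have "prob {\<omega>\<in>space M. arrival (Suc n) \<omega> \<in> A \<and> V n \<omega> \<in> B} = prob {\<omega>\<in>space M. arrival (Suc n) \<omega> \<in> A \<and> V n \<omega> \<in> UNIV} * D.prob B"
    unfolding step[OF \<open>B \<in> sets borel\<close>] step[OF U] by (simp add: D.prob_space[simplified])
  then show "emeasure (distr M borel (arrival (Suc n))) A * emeasure Dm B = emeasure (distr M (borel \<Otimes>\<^sub>M borel) (\<lambda>\<omega>. (arrival (Suc n) \<omega>, V n \<omega>))) (A \<times> B)"
    by (simp add: emeasure_distr emeasure_eq_measure D.emeasure_eq_measure ennreal_mult[symmetric] vimage_def Int_def conj_commute)
qed

lemma nn_arrival_mark: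
  fixes h :: "real \<Rightarrow> real \<Rightarrow> ennreal"
  assumes [measurable]: "case_prod h \<in> borel_measurable (borel \<Otimes>\<^sub>M borel)"
  shows "(\<integral>\<^sup>+\<omega>. h (arrival (Suc n) \<omega>) (V n \<omega>) \<partial>M) =
         (\<integral>\<^sup>+x. ennreal (erlang_density n 1 x) * (\<integral>\<^sup>+v. h x v \<partial>Dm) \<partial>lborel)"
proof -
  interpret D: prob_space Dm by (rule prob_space_Dm)
  have [measurable]: "(\<lambda>x. \<integral>\<^sup>+v. h x v \<partial>Dm) \<in> borel_measurable borel"
    by (rule D.borel_measurable_nn_integral) simp
  have hm: "case_prod h \<in> borel_measurable (distr M borel (arrival (Suc n)) \<Otimes>\<^sub>M Dm)"
    using assms by (simp cong: measurable_cong_sets)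
  have "(\<integral>\<^sup>+\<omega>. h (arrival (Suc n) \<omega>) (V n \<omega>) \<partial>M)
      = (\<integral>\<^sup>+z. case_prod h z \<partial>distr M (borel \<Otimes>\<^sub>M borel) (\<lambda>\<omega>. (arrival (Suc n) \<omega>, V n \<omega>)))"
    by (subst nn_integral_distr) auto
  also have "\<dots> = (\<integral>\<^sup>+x. (\<integral>\<^sup>+v. h x v \<partial>Dm) \<partial>distr M borel (arrival (Suc n)))"
    unfolding arrival_mark_law by (subst D.nn_integral_fst[OF hm, symmetric]) simp
  also have "\<dots> = (\<integral>\<^sup>+\<omega>. (\<integral>\<^sup>+v. h (arrival (Suc n) \<omega>) v \<partial>Dm) \<partial>M)"
    by (rule nn_integral_distr) simp_all
  also have "\<dots> = (\<integral>\<^sup>+x. ennreal (erlang_density n 1 x) * (\<integral>\<^sup>+v. h x v \<partial>Dm) \<partial>lborel)"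
    by (rule distributed_nn_integral[OF arrival_distributed, symmetric]) measurable
  finally show ?thesis .
qed

text \<open>
  The substitution \<open>y = m(v) x\<close> for fixed \<open>v\<close>: the factor \<open>m(v)\<close> of the law of the marks is the Jacobian.
\<close>

lemma intensity_scaling:
  fixes h :: "real \<Rightarrow> real \<Rightarrow> ennreal"
  assumes [measurable]: "case_prod h \<in> borel_measurable (borel \<Otimes>\<^sub>M borel)"
  shows "(\<integral>\<^sup>+x\<in>{0<..}. (\<integral>\<^sup>+v. h (x * m v) v \<partial>Dm) \<partial>lborel) = (\<integral>\<^sup>+v. (\<integral>\<^sup>+y\<in>{0<..}. h y v \<partial>lborel) \<partial>lborel)"
proof -
  have hm: "(\<lambda>z. h (fst z * m (snd z)) (snd z)) \<in> borel_measurable (borel \<Otimes>\<^sub>M borel)"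
  proof -
    have "(\<lambda>z. case_prod h (fst z * m (snd z), snd z)) \<in> borel_measurable (borel \<Otimes>\<^sub>M borel)"
      by measurable
    then show ?thesis by simp
  qed
  have hm2: "(\<lambda>(x, v). ennreal (m v) * (h (x * m v) v * indicator {0<..} x)) \<in> borel_measurable (lborel \<Otimes>\<^sub>M lborel)"
    using hm by (simp add: case_prod_beta')
  have "(\<integral>\<^sup>+x\<in>{0<..}. (\<integral>\<^sup>+v. h (x * m v) v \<partial>Dm) \<partial>lborel)
      = (\<integral>\<^sup>+x. (\<integral>\<^sup>+v. ennreal (m v) * (h (x * m v) v * indicator {0<..} x) \<partial>lborel) \<partial>lborel)"
  proof (rule nn_integral_cong)
    fix x :: real
    have hx[measurable]: "(\<lambda>v. h (x * m v) v) \<in> borel_measurable borel"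
      using measurable_compose[OF measurable_Pair1' hm, of x] by simp
    show "(\<integral>\<^sup>+v. h (x * m v) v \<partial>Dm) * indicator {0<..} x = (\<integral>\<^sup>+v. ennreal (m v) * (h (x * m v) v * indicator {0<..} x) \<partial>lborel)"
      by (cases "0 < x") (simp_all add: nn_integral_density)
  qed
  also have "\<dots> = (\<integral>\<^sup>+v. (\<integral>\<^sup>+x. ennreal (m v) * (h (x * m v) v * indicator {0<..} x) \<partial>lborel) \<partial>lborel)"
    by (rule lborel_pair.Fubini'[symmetric, OF hm2])
  also have "\<dots> = (\<integral>\<^sup>+v. (\<integral>\<^sup>+y\<in>{0<..}. h y v \<partial>lborel) \<partial>lborel)"
  proof (rule nn_integral_cong)
    fix v :: real
    have [measurable]: "(\<lambda>y. h y v) \<in> borel_measurable borel"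
      using measurable_Pair1[of "case_prod h" borel borel borel v] by simp
    have "(\<integral>\<^sup>+y\<in>{0<..}. h y v \<partial>lborel) = \<bar>m v\<bar> * (\<integral>\<^sup>+x. h (0 + m v * x) v * indicator {0<..} (0 + m v * x) \<partial>lborel)"
      by (rule nn_integral_real_affine) (use m_pos[of v] in auto)
    also have "\<dots> = (\<integral>\<^sup>+x. ennreal (m v) * (h (x * m v) v * indicator {0<..} x) \<partial>lborel)"
      using m_pos[of v] by (subst nn_integral_cmult) (auto simp: mult.commute indicator_def zero_less_mult_iff intro!: nn_integral_cong arg_cong2[where f="(*)"])
    finally show "(\<integral>\<^sup>+x. ennreal (m v) * (h (x * m v) v * indicator {0<..} x) \<partial>lborel) = (\<integral>\<^sup>+y\<in>{0<..}. h y v \<partial>lborel)" ..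
  qed
  finally show ?thesis .
qed

theorem campbell:
  fixes h :: "real \<Rightarrow> real \<Rightarrow> ennreal"
  assumes [measurable]: "case_prod h \<in> borel_measurable (borel \<Otimes>\<^sub>M borel)"
  shows "(\<integral>\<^sup>+\<omega>. (\<Sum>i. h (point i \<omega>) (V i \<omega>)) \<partial>M) = (\<integral>\<^sup>+v. (\<integral>\<^sup>+y\<in>{0<..}. h y v \<partial>lborel) \<partial>lborel)"
proof -
  interpret D: prob_space Dm by (rule prob_space_Dm)
  have hm: "(\<lambda>(x, v). h (x * m v) v) \<in> borel_measurable (borel \<Otimes>\<^sub>M borel)"
  proof -
    have "(\<lambda>z. case_prod h (fst z * m (snd z), snd z)) \<in> borel_measurable (borel \<Otimes>\<^sub>M borel)"
      by measurable
    then show ?thesis by (simp add: case_prod_beta')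
  qed
  have [measurable]: "(\<lambda>x. \<integral>\<^sup>+v. h (x * m v) v \<partial>Dm) \<in> borel_measurable borel"
    using hm by (intro D.borel_measurable_nn_integral) simp
  have "(\<integral>\<^sup>+\<omega>. (\<Sum>i. h (point i \<omega>) (V i \<omega>)) \<partial>M) = (\<Sum>i. \<integral>\<^sup>+\<omega>. h (arrival (Suc i) \<omega> * m (V i \<omega>)) (V i \<omega>) \<partial>M)"
    unfolding point_def by (rule nn_integral_suminf) measurable
  also have "\<dots> = (\<Sum>i. \<integral>\<^sup>+x. ennreal (erlang_density i 1 x) * (\<integral>\<^sup>+v. h (x * m v) v \<partial>Dm) \<partial>lborel)"
    by (intro suminf_cong nn_arrival_mark[OF hm])
  also have "\<dots> = (\<integral>\<^sup>+x. (\<Sum>i. ennreal (erlang_density i 1 x) * (\<integral>\<^sup>+v. h (x * m v) v \<partial>Dm)) \<partial>lborel)"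
    by (rule nn_integral_suminf[symmetric]) measurable
  also have "\<dots> = (\<integral>\<^sup>+x\<in>{0<..}. (\<integral>\<^sup>+v. h (x * m v) v \<partial>Dm) \<partial>lborel)"
  proof (rule nn_integral_cong_AE)
    show "AE x in lborel. (\<Sum>i. ennreal (erlang_density i 1 x) * (\<integral>\<^sup>+v. h (x * m v) v \<partial>Dm)) = (\<integral>\<^sup>+v. h (x * m v) v \<partial>Dm) * indicator {0<..} x"
      using AE_lborel_singleton[of "0::real"]
    proof eventually_elim
      case (elim x)
      show ?case
      proof (cases "x > 0")
        case True
        then show ?thesis
          unfolding ennreal_suminf_multc erlang_densities_sum[OF less_imp_le[OF True]] by simp
      next
        case False
        then have "x < 0" using elim by simp
        then show ?thesis by (simp add: erlang_density_def)
      qed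
    qed
  qed
  finally show ?thesis by (simp add: intensity_scaling)
qed

end

section \<open>Random sums over the marked points\<close>

context marked_poisson
begin

definition mark_sum_term :: "(real \<Rightarrow> real \<Rightarrow> real) \<Rightarrow> nat \<Rightarrow> 'a \<Rightarrow> real" where
  "mark_sum_term D i \<omega> = \<gamma> i \<omega> * D (point i \<omega>) (V i \<omega>)"

text \<open>
  Truncation at \<open>1\<close> combines the expected number of large terms with the expected sum of the squares of
  the small ones.
\<close>

definition energy :: "(real \<Rightarrow> real \<Rightarrow> real) \<Rightarrow> ennreal" where
  "energy D = (\<integral>\<^sup>+v. (\<integral>\<^sup>+y\<in>{0<..}. ennreal (min 1 ((D y v)\<^sup>2)) \<partial>lborel) \<partial>lborel)"

definition trunc_term :: "(real \<Rightarrow> real \<Rightarrow> real) \<Rightarrow> nat \<Rightarrow> 'a \<Rightarrow> real" where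
  "trunc_term D i \<omega> = clip 1 (\<gamma> i \<omega>) * (if \<bar>D (point i \<omega>) (V i \<omega>)\<bar> \<le> 1 then D (point i \<omega>) (V i \<omega>) else 0)"

lemma mark_sum_term_measurable [measurable]:
  assumes [measurable]: "case_prod D \<in> borel_measurable (borel \<Otimes>\<^sub>M borel)"
  shows "mark_sum_term D i \<in> borel_measurable M"
  unfolding mark_sum_term_def by measurable

lemma trunc_term_measurable [measurable]:
  assumes [measurable]: "case_prod D \<in> borel_measurable (borel \<Otimes>\<^sub>M borel)"
  shows "trunc_term D i \<in> borel_measurable M"
  unfolding trunc_term_def by measurable

lemma trunc_term_abs_le: "\<bar>trunc_term D i \<omega>\<bar> \<le> 1"
  unfolding trunc_term_def abs_mult
  using mult_mono[OF clip_abs_le[of 1 "\<gamma> i \<omega>"], of "\<bar>if \<bar>D (point i \<omega>) (V i \<omega>)\<bar> \<le> 1 then D (point i \<omega>) (V i \<omega>) else 0\<bar>" 1] by auto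

text \<open>
  The sign of the current term is independent of the past, the gap and the mark, and has mean zero.
\<close>

lemma trunc_term_martingale_differences:
  assumes Dm[measurable]: "case_prod D \<in> borel_measurable (borel \<Otimes>\<^sub>M borel)"
  shows "bounded_martingale_differences M (trunc_term D)"
proof unfold_locales
  show "trunc_term D i \<in> borel_measurable M" for i by measurable
  show "\<bar>trunc_term D i \<omega>\<bar> \<le> 1" for i \<omega> by (rule trunc_term_abs_le)
  fix j :: nat and H :: "(nat \<Rightarrow> real) \<Rightarrow> real" and B
  assume H[measurable]: "H \<in> borel_measurable (PiM {..<j} (\<lambda>_. borel))"
    and bd: "\<And>\<omega>. \<bar>H (\<lambda>i\<in>{..<j}. trunc_term D i \<omega>)\<bar> \<le> B"
  have B0: "0 \<le> B" using bd[of undefined] by linarith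
  let ?t = "\<lambda>x v s. clip 1 s * (if \<bar>D (x * m v) v\<bar> \<le> 1 then D (x * m v) v else 0)"
  \<comment> \<open>the truncated terms as functions of the past triples\<close>
  define W where "W p = (\<lambda>i\<in>{..<j}. ?t (\<Sum>k<Suc i. fst (p k)) (fst (snd (p i))) (snd (snd (p i))))"
    for p :: "nat \<Rightarrow> real \<times> real \<times> real"
  have Wm[measurable]: "W \<in> measurable (PM j) (PiM {..<j} (\<lambda>_. borel))"
    unfolding W_def
  proof (rule measurable_restrict)
    fix i assume i: "i \<in> {..<j}"
    have [measurable]: "(\<lambda>p. \<Sum>k<Suc i. fst (p k)) \<in> borel_measurable (PM j)"
      by (intro borel_measurable_sum past_component_measurable) (use i in auto)
    have [measurable]: "(\<lambda>p. fst (snd (p i))) \<in> borel_measurable (PM j)" "(\<lambda>p. snd (snd (p i))) \<in> borel_measurable (PM j)"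
      using past_component_measurable i by auto
    show "(\<lambda>p. ?t (\<Sum>k<Suc i. fst (p k)) (fst (snd (p i))) (snd (snd (p i)))) \<in> borel_measurable (PM j)"
      by measurable
  qed
  have Wp: "W (past j \<omega>) = (\<lambda>i\<in>{..<j}. trunc_term D i \<omega>)" for \<omega>
    unfolding W_def trunc_term_def point_def arrival_def
    by (auto simp: fun_eq_iff restrict_def intro!: if_cong arg_cong2[where f="(*)"])
  \<comment> \<open>The test function is bounded only along the process, hence the clipping.\<close>
  let ?g = "\<lambda>p e v s. ?t ((\<Sum>k<j. fst (p k)) + e) v s * clip B (H (W p))"
  have [measurable]: "(\<lambda>p. \<Sum>k<j. fst (p k)) \<in> borel_measurable (PM j)"
    by (intro borel_measurable_sum past_component_measurable) auto
  have "(LINT \<omega>|M. trunc_term D j \<omega> * H (\<lambda>i\<in>{..<j}. trunc_term D i \<omega>))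
      = (LINT \<omega>|M. ?g (past j \<omega>) (E j \<omega>) (V j \<omega>) (\<gamma> j \<omega>))"
    by (intro Bochner_Integration.integral_cong refl)
       (simp add: Wp clip_eq[OF bd], simp add: trunc_term_def point_def arrival_def add.commute)
  also have "\<dots> = (LINT \<omega>|M. (LINT e|Em. (LINT v|Dm. (1 / 2) *\<^sub>R (?g (past j \<omega>) e v 1 + ?g (past j \<omega>) e v (- 1)))))"
  proof (rule one_step(1))
    show "norm (?g p e v s) \<le> 1 * 1 * B" for p e v s
      unfolding real_norm_def abs_mult
      by (intro mult_mono) (use B0 clip_abs_le[of 1 s] clip_abs_le[OF B0, of "H (W p)"] in auto)
  qed measurable
  also have "\<dots> = 0" by (simp add: clip_def)
  finally show "(LINT \<omega>|M. trunc_term D j \<omega> * H (\<lambda>i\<in>{..<j}. trunc_term D i \<omega>)) = 0" .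
qed

lemma energy_campbell:
  assumes Dm[measurable]: "case_prod D \<in> borel_measurable (borel \<Otimes>\<^sub>M borel)"
  shows "(\<integral>\<^sup>+\<omega>. (\<Sum>i. ennreal (min 1 ((D (point i \<omega>) (V i \<omega>))\<^sup>2))) \<partial>M) = energy D"
  unfolding energy_def
  by (rule campbell[of "\<lambda>y v. ennreal (min 1 ((D y v)\<^sup>2))"]) (simp add: case_prod_beta')

lemma trunc_term_square_le: "(trunc_term D i \<omega>)\<^sup>2 \<le> min 1 ((D (point i \<omega>) (V i \<omega>))\<^sup>2)"
proof -
  have "(clip 1 (\<gamma> i \<omega>))\<^sup>2 \<le> 1" using clip_abs_le[of 1 "\<gamma> i \<omega>"] by (simp add: abs_square_le_1)
  then have "(clip 1 (\<gamma> i \<omega>))\<^sup>2 * d\<^sup>2 \<le> 1 * d\<^sup>2" for d :: real by (intro mult_right_mono) auto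
  then show ?thesis
    using trunc_term_abs_le[of D i \<omega>] by (auto simp: trunc_term_def power_mult_distrib abs_square_le_1[symmetric] min_def)
qed

lemma trunc_term_second_moments:
  assumes Dm[measurable]: "case_prod D \<in> borel_measurable (borel \<Otimes>\<^sub>M borel)" and fin: "energy D < \<infinity>"
  shows "summable (\<lambda>i. expectation (\<lambda>\<omega>. (trunc_term D i \<omega>)\<^sup>2))"
    and "(\<Sum>i. expectation (\<lambda>\<omega>. (trunc_term D i \<omega>)\<^sup>2)) \<le> enn2real (energy D)"
proof -
  interpret Z: bounded_martingale_differences M "trunc_term D" by (rule trunc_term_martingale_differences[OF Dm])
  have eq: "ennreal (expectation (\<lambda>\<omega>. (trunc_term D i \<omega>)\<^sup>2)) = (\<integral>\<^sup>+\<omega>. ennreal ((trunc_term D i \<omega>)\<^sup>2) \<partial>M)" for i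
    by (rule nn_integral_eq_integral[symmetric, OF Z.Z_square_integrable]) auto
  have "(\<Sum>i. ennreal (expectation (\<lambda>\<omega>. (trunc_term D i \<omega>)\<^sup>2))) = (\<integral>\<^sup>+\<omega>. (\<Sum>i. ennreal ((trunc_term D i \<omega>)\<^sup>2)) \<partial>M)"
    unfolding eq by (rule nn_integral_suminf[symmetric]) measurable
  also have "\<dots> \<le> (\<integral>\<^sup>+\<omega>. (\<Sum>i. ennreal (min 1 ((D (point i \<omega>) (V i \<omega>))\<^sup>2))) \<partial>M)"
    by (intro nn_integral_mono suminf_le ennreal_leI trunc_term_square_le) auto
  also have "\<dots> = energy D" by (rule energy_campbell[OF Dm])
  finally have le: "(\<Sum>i. ennreal (expectation (\<lambda>\<omega>. (trunc_term D i \<omega>)\<^sup>2))) \<le> energy D" .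
  then show sm: "summable (\<lambda>i. expectation (\<lambda>\<omega>. (trunc_term D i \<omega>)\<^sup>2))"
    using fin by (intro summable_suminf_not_top) (auto simp: less_top[symmetric] top_unique)
  have e: "(\<Sum>i. ennreal (expectation (\<lambda>\<omega>. (trunc_term D i \<omega>)\<^sup>2))) = ennreal (\<Sum>i. expectation (\<lambda>\<omega>. (trunc_term D i \<omega>)\<^sup>2))"
    by (rule suminf_ennreal2[OF _ sm]) simp
  have "energy D = ennreal (enn2real (energy D))" using fin by simp
  then have "ennreal (\<Sum>i. expectation (\<lambda>\<omega>. (trunc_term D i \<omega>)\<^sup>2)) \<le> ennreal (enn2real (energy D))"
    using le unfolding e by metis
  then show "(\<Sum>i. expectation (\<lambda>\<omega>. (trunc_term D i \<omega>)\<^sup>2)) \<le> enn2real (energy D)"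
    by (simp add: ennreal_le_iff)
qed

lemma AE_few_large_terms:
  assumes Dm[measurable]: "case_prod D \<in> borel_measurable (borel \<Otimes>\<^sub>M borel)" and fin: "energy D < \<infinity>"
  shows "AE \<omega> in M. \<exists>N. \<forall>i\<ge>N. \<bar>D (point i \<omega>) (V i \<omega>)\<bar> \<le> 1"
proof -
  have "AE \<omega> in M. (\<Sum>i. ennreal (min 1 ((D (point i \<omega>) (V i \<omega>))\<^sup>2))) \<noteq> \<infinity>"
    by (rule nn_integral_noteq_infinite) (use fin energy_campbell[OF Dm] in auto)
  then show ?thesis
  proof eventually_elim
    case (elim \<omega>)
    then have "summable (\<lambda>i. min 1 ((D (point i \<omega>) (V i \<omega>))\<^sup>2))"
      by (intro summable_suminf_not_top) auto
    then have "(\<lambda>i. min 1 ((D (point i \<omega>) (V i \<omega>))\<^sup>2)) \<longlonglongrightarrow> 0" by (rule summable_LIMSEQ_zero)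
    then have "eventually (\<lambda>i. min 1 ((D (point i \<omega>) (V i \<omega>))\<^sup>2) < 1) sequentially"
      by (rule order_tendstoD) simp
    then have "eventually (\<lambda>i. \<bar>D (point i \<omega>) (V i \<omega>)\<bar> \<le> 1) sequentially"
      by (rule eventually_mono) (auto simp: min_less_iff_disj abs_square_less_1)
    then show ?case by (simp add: eventually_sequentially)
  qed
qed

lemma mark_sum_term_eq_trunc:
  assumes "\<gamma> i \<omega> = 1 \<or> \<gamma> i \<omega> = - 1" "\<bar>D (point i \<omega>) (V i \<omega>)\<bar> \<le> 1"
  shows "mark_sum_term D i \<omega> = trunc_term D i \<omega>"
  using assms by (auto simp: mark_sum_term_def trunc_term_def clip_def)

text \<open>
  Up to finitely many terms, the series is one of bounded martingale differences with summable
  variances.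
\<close>

theorem mark_sum_AE_summable:
  assumes Dm[measurable]: "case_prod D \<in> borel_measurable (borel \<Otimes>\<^sub>M borel)" and fin: "energy D < \<infinity>"
  shows "AE \<omega> in M. summable (\<lambda>i. mark_sum_term D i \<omega>)"
proof -
  interpret Z: bounded_martingale_differences M "trunc_term D" by (rule trunc_term_martingale_differences[OF Dm])
  have "AE \<omega> in M. \<forall>i. \<gamma> i \<omega> = 1 \<or> \<gamma> i \<omega> = - 1"
    unfolding AE_all_countable using AE_sign by blast
  with Z.AE_summable[OF trunc_term_second_moments(1)[OF assms]] AE_few_large_terms[OF assms]
  show ?thesis
  proof eventually_elim
    case (elim \<omega>)
    then have "eventually (\<lambda>i. mark_sum_term D i \<omega> = trunc_term D i \<omega>) sequentially"
      using mark_sum_term_eq_trunc unfolding eventually_sequentially by meson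
    then show ?case using elim(1) by (subst summable_cong)
  qed
qed

text \<open>
  Either some term exceeds \<open>1\<close>, which has probability at most the energy, or the sum is the sum of the
  truncated terms.
\<close>

theorem mark_sum_tail:
  assumes Dm[measurable]: "case_prod D \<in> borel_measurable (borel \<Otimes>\<^sub>M borel)" and fin: "energy D < \<infinity>" and e: "\<epsilon> > 0"
  shows "prob {\<omega>\<in>space M. 2 * \<epsilon> \<le> \<bar>\<Sum>i. mark_sum_term D i \<omega>\<bar>} \<le> enn2real (energy D) * (1 + 1 / \<epsilon>\<^sup>2)"
proof -
  interpret Z: bounded_martingale_differences M "trunc_term D" by (rule trunc_term_martingale_differences[OF Dm])
  let ?L = "{\<omega>\<in>space M. \<exists>i. 1 < \<bar>D (point i \<omega>) (V i \<omega>)\<bar>}" and ?S = "{\<omega>\<in>space M. 2 * \<epsilon> \<le> \<bar>\<Sum>i. trunc_term D i \<omega>\<bar>}"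
  have Ls[measurable]: "?L \<in> sets M" by measurable
  have Ss[measurable]: "?S \<in> sets M" by measurable
  have "emeasure M ?L = (\<integral>\<^sup>+\<omega>. indicator ?L \<omega> \<partial>M)" by simp
  also have "\<dots> \<le> (\<integral>\<^sup>+\<omega>. (\<Sum>i. ennreal (min 1 ((D (point i \<omega>) (V i \<omega>))\<^sup>2))) \<partial>M)"
  proof (rule nn_integral_mono)
    fix \<omega> assume "\<omega> \<in> space M"
    show "indicator ?L \<omega> \<le> (\<Sum>i. ennreal (min 1 ((D (point i \<omega>) (V i \<omega>))\<^sup>2)))"
    proof (cases "\<omega> \<in> ?L")
      case True
      then obtain i where i: "1 < \<bar>D (point i \<omega>) (V i \<omega>)\<bar>" by auto
      have "1 \<le> (D (point i \<omega>) (V i \<omega>))\<^sup>2" using i abs_square_less_1[of "D (point i \<omega>) (V i \<omega>)"] by linarith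
      then have "(1::ennreal) = (\<Sum>j\<in>{i}. ennreal (min 1 ((D (point j \<omega>) (V j \<omega>))\<^sup>2)))" by (simp add: min_def)
      also have "\<dots> \<le> (\<Sum>j. ennreal (min 1 ((D (point j \<omega>) (V j \<omega>))\<^sup>2)))" by (rule sum_le_suminf) auto
      finally show ?thesis using True by simp
    qed simp
  qed
  also have "\<dots> = energy D" by (rule energy_campbell[OF Dm])
  finally have "ennreal (prob ?L) \<le> ennreal (enn2real (energy D))" using fin by (simp add: emeasure_eq_measure)
  then have L: "prob ?L \<le> enn2real (energy D)" by (simp add: ennreal_le_iff)
  have "prob ?S \<le> (\<Sum>i. expectation (\<lambda>\<omega>. (trunc_term D i \<omega>)\<^sup>2)) / \<epsilon>\<^sup>2"
    by (rule Z.suminf_tail_bound[OF e trunc_term_second_moments(1)[OF Dm fin]])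
  also have "\<dots> \<le> enn2real (energy D) / \<epsilon>\<^sup>2"
    by (intro divide_right_mono trunc_term_second_moments(2)[OF Dm fin]) simp
  finally have S: "prob ?S \<le> enn2real (energy D) / \<epsilon>\<^sup>2" .
  have "AE \<omega> in M. \<forall>i. \<gamma> i \<omega> = 1 \<or> \<gamma> i \<omega> = - 1"
    unfolding AE_all_countable using AE_sign by blast
  then have "AE \<omega> in M. \<omega> \<in> {\<omega>\<in>space M. 2 * \<epsilon> \<le> \<bar>\<Sum>i. mark_sum_term D i \<omega>\<bar>} \<longrightarrow> \<omega> \<in> ?L \<union> ?S"
  proof eventually_elim
    case (elim \<omega>)
    show ?case
    proof (intro impI, rule ccontr)
      assume w: "\<omega> \<in> {\<omega>\<in>space M. 2 * \<epsilon> \<le> \<bar>\<Sum>i. mark_sum_term D i \<omega>\<bar>}" and "\<omega> \<notin> ?L \<union> ?S"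
      then have "\<bar>D (point i \<omega>) (V i \<omega>)\<bar> \<le> 1" for i by (auto simp: not_less)
      then have "mark_sum_term D i \<omega> = trunc_term D i \<omega>" for i using elim mark_sum_term_eq_trunc by blast
      then show False using w \<open>\<omega> \<notin> ?L \<union> ?S\<close> by simp
    qed
  qed
  then have "prob {\<omega>\<in>space M. 2 * \<epsilon> \<le> \<bar>\<Sum>i. mark_sum_term D i \<omega>\<bar>} \<le> prob (?L \<union> ?S)"
    by (rule finite_measure_mono_AE) measurable
  also have "\<dots> \<le> prob ?L + prob ?S" by (rule measure_Un_le) measurable
  finally show ?thesis using L S by (simp add: distrib_left)
qed

text \<open>
  The expected number of arrivals up to \<open>K\<close> is \<open>K\<close>, so almost surely there are finitely many.
\<close>

lemma AE_arrival_at_top: "AE \<omega> in M. filterlim (\<lambda>n. arrival n \<omega>) at_top sequentially"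
proof -
  have "AE \<omega> in M. (\<Sum>i. indicator {..real K} (arrival (Suc i) \<omega>) :: ennreal) \<noteq> \<infinity>" for K :: nat
  proof (rule nn_integral_noteq_infinite)
    have "(\<integral>\<^sup>+\<omega>. (\<Sum>i. indicator {..real K} (arrival (Suc i) \<omega>)) \<partial>M)
        = (\<Sum>i. \<integral>\<^sup>+\<omega>. indicator {..real K} (arrival (Suc i) \<omega>) \<partial>M)"
      by (rule nn_integral_suminf) measurable
    also have "\<dots> = (\<Sum>i. \<integral>\<^sup>+x. ennreal (erlang_density i 1 x) * indicator {..real K} x \<partial>lborel)"
      by (intro suminf_cong distributed_nn_integral[OF arrival_distributed, symmetric]) simp
    also have "\<dots> = (\<integral>\<^sup>+x. (\<Sum>i. ennreal (erlang_density i 1 x) * indicator {..real K} x) \<partial>lborel)"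
      by (rule nn_integral_suminf[symmetric]) measurable
    also have "\<dots> \<le> (\<integral>\<^sup>+x. indicator {0..real K} x \<partial>lborel)"
    proof (rule nn_integral_mono)
      fix x :: real
      show "(\<Sum>i. ennreal (erlang_density i 1 x) * indicator {..real K} x) \<le> indicator {0..real K} x"
      proof (cases "0 \<le> x")
        case True
        then show ?thesis unfolding ennreal_suminf_multc erlang_densities_sum[OF True] by (simp add: indicator_def)
      qed (simp add: erlang_density_def)
    qed
    also have "\<dots> < \<infinity>" by simp
    finally show "(\<integral>\<^sup>+\<omega>. (\<Sum>i. indicator {..real K} (arrival (Suc i) \<omega>)) \<partial>M) \<noteq> \<infinity>" by simp
  qed measurable
  then have "AE \<omega> in M. \<forall>K::nat. (\<Sum>i. indicator {..real K} (arrival (Suc i) \<omega>) :: ennreal) \<noteq> \<infinity>"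
    unfolding AE_all_countable by blast
  then show ?thesis
  proof eventually_elim
    case (elim \<omega>)
    have "filterlim (\<lambda>n. arrival (Suc n) \<omega>) at_top sequentially"
      unfolding filterlim_at_top
    proof
      fix Z :: real
      obtain K :: nat where K: "Z \<le> real K" using real_arch_simple by blast
      have "(\<Sum>i. ennreal (indicator {..real K} (arrival (Suc i) \<omega>))) \<noteq> \<infinity>" using elim by (simp add: ennreal_indicator)
      then have "summable (\<lambda>i. indicator {..real K} (arrival (Suc i) \<omega>) :: real)"
        by (intro summable_suminf_not_top) auto
      then have "(\<lambda>i. indicator {..real K} (arrival (Suc i) \<omega>) :: real) \<longlonglongrightarrow> 0" by (rule summable_LIMSEQ_zero)
      then have "eventually (\<lambda>i. (indicator {..real K} (arrival (Suc i) \<omega>) :: real) < 1) sequentially"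
        by (rule order_tendstoD) simp
      then show "eventually (\<lambda>i. Z \<le> arrival (Suc i) \<omega>) sequentially"
        by eventually_elim (use K in \<open>auto simp: indicator_def split: if_splits\<close>)
    qed
    then show ?case using filterlim_sequentially_Suc[of "\<lambda>n. arrival n \<omega>"] by blast
  qed
qed

text \<open>
  The factor \<open>survival\<close> is the expected contribution of the points still to come. Averaging over the next
  sign replaces \<open>iexp\<close> of the new term by its cosine, averaging over the mark gives \<open>1 - k\<close> at the
  next arrival time, and averaging over the gap is \<open>survival_renewal\<close>.
\<close>

lemma survival_martingale:
  assumes Dm[measurable]: "case_prod D \<in> borel_measurable (borel \<Otimes>\<^sub>M borel)"
    and k: "thinning_rate k"
    and kD: "\<And>x. 0 < x \<Longrightarrow> (LINT v|Dm. cos (D (x * m v) v)) = 1 - k x"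
  shows "(CLINT \<omega>|M. iexp (\<Sum>i<n. mark_sum_term D i \<omega>) * thinning_rate.survival k (arrival n \<omega>)) = thinning_rate.survival k 0"
proof (induction n)
  case 0
  then show ?case by (simp add: arrival_def prob_space)
next
  case (Suc n)
  interpret k: thinning_rate k by fact
  let ?L = "\<lambda>p. \<Sum>i<n. fst (p i) :: real"
  let ?S = "\<lambda>p. \<Sum>i<n. snd (snd (p i)) * D ((\<Sum>j<Suc i. fst (p j)) * m (fst (snd (p i)))) (fst (snd (p i)))"
  let ?g = "\<lambda>p e v s. iexp (?S p + s * D ((?L p + e) * m v) v) * complex_of_real (k.survival (?L p + e))"
  have Lm[measurable]: "?L \<in> borel_measurable (PM n)"
    by (intro borel_measurable_sum past_component_measurable) auto
  have Sm[measurable]: "?S \<in> borel_measurable (PM n)"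
  proof (rule borel_measurable_sum)
    fix i assume i: "i \<in> {..<n}"
    have [measurable]: "(\<lambda>p. \<Sum>k<Suc i. fst (p k)) \<in> borel_measurable (PM n)"
      by (intro borel_measurable_sum past_component_measurable) (use i in auto)
    have [measurable]: "(\<lambda>p. fst (snd (p i))) \<in> borel_measurable (PM n)" "(\<lambda>p. snd (snd (p i))) \<in> borel_measurable (PM n)"
      using past_component_measurable i by auto
    show "(\<lambda>p. snd (snd (p i)) * D ((\<Sum>j<Suc i. fst (p j)) * m (fst (snd (p i)))) (fst (snd (p i)))) \<in> borel_measurable (PM n)"
      by measurable
  qed
  have Lp: "?L (past n \<omega>) = arrival n \<omega>" for \<omega> by (simp add: arrival_def)
  have Sp: "?S (past n \<omega>) = (\<Sum>i<n. mark_sum_term D i \<omega>)" for \<omega>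
    unfolding mark_sum_term_def point_def arrival_def by (intro sum.cong) auto
  interpret DD: prob_space Dm by (rule prob_space_Dm)
  have gm: "(\<lambda>(p, e, v, s). ?g p e v s) \<in> borel_measurable (PM n \<Otimes>\<^sub>M (borel \<Otimes>\<^sub>M (borel \<Otimes>\<^sub>M borel)))"
    by measurable
  have gb: "norm (?g p e v s) \<le> 1" for p e v s
    using k.survival_bounds by (simp add: norm_mult less_imp_le)
  have "(CLINT \<omega>|M. iexp (\<Sum>i<Suc n. mark_sum_term D i \<omega>) * k.survival (arrival (Suc n) \<omega>))
     = (LINT \<omega>|M. ?g (past n \<omega>) (E n \<omega>) (V n \<omega>) (\<gamma> n \<omega>))"
    unfolding Lp Sp by (simp add: arrival_def mark_sum_term_def point_def)
  also have "\<dots> = (LINT \<omega>|M. (LINT e|Em. (LINT v|Dm. (1 / 2) *\<^sub>R (?g (past n \<omega>) e v 1 + ?g (past n \<omega>) e v (- 1)))))"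
    by (rule one_step(1)[OF gm gb])
  also have "\<dots> = (CLINT \<omega>|M. iexp (\<Sum>i<n. mark_sum_term D i \<omega>) * k.survival (arrival n \<omega>))"
  proof (rule integral_cong_AE)
    show "AE \<omega> in M. (LINT e|Em. (LINT v|Dm. (1 / 2) *\<^sub>R (?g (past n \<omega>) e v 1 + ?g (past n \<omega>) e v (- 1)))) =
       iexp (\<Sum>i<n. mark_sum_term D i \<omega>) * k.survival (arrival n \<omega>)"
      using AE_arrival_nonneg
    proof eventually_elim
      case (elim \<omega>)
      let ?s = "\<Sum>i<n. mark_sum_term D i \<omega>" and ?l = "arrival n \<omega>"
      have avg: "(1 / 2) *\<^sub>R (?g (past n \<omega>) e v 1 + ?g (past n \<omega>) e v (- 1)) =
         iexp ?s * complex_of_real (k.survival (?l + e)) * complex_of_real (cos (D ((?l + e) * m v) v))" for e v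
      proof -
        have "iexp (a + 1 * b) + iexp (a + (- 1) * b) = iexp a * (2 * complex_of_real (cos b))" for a b :: real
          by (simp add: exp_add exp_diff cos_of_real[symmetric] cos_exp_eq ring_distribs exp_minus inverse_eq_divide)
        from this[of ?s "D ((?l + e) * m v) v"] show ?thesis
          unfolding Lp Sp distrib_right[symmetric] by (simp add: scaleR_conv_of_real)
      qed
      have "(LINT e|Em. (LINT v|Dm. (1 / 2) *\<^sub>R (?g (past n \<omega>) e v 1 + ?g (past n \<omega>) e v (- 1))))
         = (LINT e|Em. iexp ?s * complex_of_real (k.survival (?l + e)) * (LINT v|Dm. complex_of_real (cos (D ((?l + e) * m v) v))))"
        unfolding avg by simp
      also have "\<dots> = (LINT e|Em. iexp ?s * complex_of_real ((1 - k (?l + e)) * k.survival (?l + e)))"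
      proof (rule integral_cong_AE)
        show "(\<lambda>e. iexp ?s * complex_of_real (k.survival (?l + e)) * (LINT v|Dm. complex_of_real (cos (D ((?l + e) * m v) v)))) \<in> borel_measurable Em"
        proof -
          have "(\<lambda>(e, v). complex_of_real (cos (D ((?l + e) * m v) v))) \<in> borel_measurable (Em \<Otimes>\<^sub>M Dm)"
          proof -
            have "(\<lambda>z. complex_of_real (cos (case_prod D ((?l + fst z) * m (snd z), snd z)))) \<in> borel_measurable (borel \<Otimes>\<^sub>M borel)"
              by measurable
            then show ?thesis by (simp add: case_prod_beta' cong: measurable_cong_sets)
          qed
          then have "(\<lambda>e. LINT v|Dm. complex_of_real (cos (D ((?l + e) * m v) v))) \<in> borel_measurable Em"
            by (intro DD.borel_measurable_lebesgue_integral)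
          then show ?thesis by measurable
        qed
        have "AE e in Em. 0 < e"
          by (subst AE_density) (use AE_lborel_singleton[of "0::real"] in \<open>auto simp: exponential_density_def elim!: eventually_mono\<close>)
        then show "AE e in Em. iexp ?s * complex_of_real (k.survival (?l + e)) * (LINT v|Dm. complex_of_real (cos (D ((?l + e) * m v) v)))
            = iexp ?s * complex_of_real ((1 - k (?l + e)) * k.survival (?l + e))"
        proof eventually_elim
          fix e :: real assume "0 < e"
          then have "0 < ?l + e" using elim[rule_format, of n] by linarith
          from kD[OF this] show "iexp ?s * complex_of_real (k.survival (?l + e)) * (LINT v|Dm. complex_of_real (cos (D ((?l + e) * m v) v)))
            = iexp ?s * complex_of_real ((1 - k (?l + e)) * k.survival (?l + e))"
            by (simp add: mult_ac)
        qed
      qed measurable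
      also have "\<dots> = iexp ?s * complex_of_real (LINT e|Em. (1 - k (?l + e)) * k.survival (?l + e))"
        by (simp only: integral_mult_right_zero integral_complex_of_real)
      also have "\<dots> = iexp ?s * k.survival ?l"
        using k.survival_renewal[of ?l] elim by simp
      finally show ?case .
    qed
    show "(\<lambda>\<omega>. iexp (\<Sum>i<n. mark_sum_term D i \<omega>) * k.survival (arrival n \<omega>)) \<in> borel_measurable M" by measurable
    show "(\<lambda>\<omega>. LINT e|Em. (LINT v|Dm. (1 / 2) *\<^sub>R (?g (past n \<omega>) e v 1 + ?g (past n \<omega>) e v (- 1)))) \<in> borel_measurable M"
      by (rule measurable_compose[OF past_measurable one_step(2)[OF gm gb]])
  qed
  also have "\<dots> = k.survival 0" by (rule Suc.IH)
  finally show ?case .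
qed

text \<open>
  Let \<open>n\<close> tend to infinity in \<open>survival_martingale\<close>: the arrival times diverge, so the survival factor
  tends to \<open>1\<close>.
\<close>

theorem mark_sum_char:
  assumes Dm[measurable]: "case_prod D \<in> borel_measurable (borel \<Otimes>\<^sub>M borel)" and fin: "energy D < \<infinity>"
    and cont: "\<And>v y. 0 < y \<Longrightarrow> isCont (\<lambda>y. D y v) y"
    and \<kappa>: "(\<integral>\<^sup>+v. (\<integral>\<^sup>+y\<in>{0<..}. ennreal (1 - cos (D y v)) \<partial>lborel) \<partial>lborel) = ennreal \<kappa>" "0 \<le> \<kappa>"
  shows "(CLINT \<omega>|M. iexp (\<Sum>i. mark_sum_term D i \<omega>)) = of_real (exp (- \<kappa>))"
proof -
  interpret DD: prob_space Dm by (rule prob_space_Dm)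
  define k where "k x = (if 0 < x then 1 - (LINT v|Dm. cos (D (x * m v) v)) else 0)" for x
  have Dx[measurable]: "(\<lambda>v. D (x * m v) v) \<in> borel_measurable borel" for x
  proof -
    have "(\<lambda>v. case_prod D (x * m v, v)) \<in> borel_measurable borel" by measurable
    then show ?thesis by simp
  qed
  have ic: "integrable Dm (\<lambda>v. cos (D (x * m v) v))" for x
    by (rule DD.integrable_const_bound[where B=1]) auto
  have k1: "k x = (LINT v|Dm. 1 - cos (D (x * m v) v))" if "0 < x" for x
    using that ic[of x] by (simp add: k_def DD.prob_space[simplified])
  have kn: "0 \<le> k x" for x
    by (cases "0 < x") (auto simp: k1 intro!: integral_nonneg_AE, simp add: k_def)
  have kle: "k x \<le> 2" for x
  proof (cases "0 < x")
    case True
    have "(LINT v|Dm. 1 - cos (D (x * m v) v)) \<le> (LINT v|Dm. 2)"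
      using ic[of x] by (intro integral_mono) (auto intro: order_trans[OF diff_left_mono[OF cos_ge_minus_one]])
    then show ?thesis using True by (simp add: k1 DD.prob_space[simplified])
  qed (simp add: k_def)
  have kc: "isCont k x" if x: "0 < x" for x
  proof -
    have "isCont (\<lambda>x. 1 - (LINT v|Dm. cos (D (x * m v) v))) x"
    proof (intro continuous_intros)
      show "isCont (\<lambda>x. LINT v|Dm. cos (D (x * m v) v)) x"
        unfolding continuous_at_sequentially comp_def
      proof (intro allI impI)
        fix X :: "nat \<Rightarrow> real" assume X: "X \<longlonglongrightarrow> x"
        show "(\<lambda>n. LINT v|Dm. cos (D (X n * m v) v)) \<longlonglongrightarrow> (LINT v|Dm. cos (D (x * m v) v))"
        proof (rule integral_dominated_convergence[where w="\<lambda>_. 1"])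
          show "AE v in Dm. (\<lambda>n. cos (D (X n * m v) v)) \<longlonglongrightarrow> cos (D (x * m v) v)"
          proof (intro AE_I2 tendsto_cos)
            fix v
            have "(\<lambda>n. X n * m v) \<longlonglongrightarrow> x * m v" by (intro tendsto_intros X)
            then show "(\<lambda>n. D (X n * m v) v) \<longlonglongrightarrow> D (x * m v) v"
              using cont[of "x * m v" v] x m_pos[of v] by (intro isCont_tendsto_compose[where g="\<lambda>y. D y v"]) auto
          qed
        qed auto
      qed
    qed
    moreover have "eventually (\<lambda>y. k y = 1 - (LINT v|Dm. cos (D (y * m v) v))) (nhds x)"
      using eventually_nhds_in_open[of "{0<..}" x] x by (auto elim!: eventually_mono simp: k_def)
    ultimately show ?thesis by (subst isCont_cong)
  qed
  have hm[measurable]: "case_prod (\<lambda>y v. ennreal (1 - cos (D y v))) \<in> borel_measurable (borel \<Otimes>\<^sub>M borel)"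
    by (simp add: case_prod_beta')
  have nk: "(\<integral>\<^sup>+x. ennreal (k x) \<partial>lborel) = ennreal \<kappa>"
  proof -
    have "(\<integral>\<^sup>+x. ennreal (k x) \<partial>lborel) = (\<integral>\<^sup>+x\<in>{0<..}. (\<integral>\<^sup>+v. ennreal (1 - cos (D (x * m v) v)) \<partial>Dm) \<partial>lborel)"
    proof (rule nn_integral_cong)
      fix x :: real
      have "ennreal (k x) = (\<integral>\<^sup>+v. ennreal (1 - cos (D (x * m v) v)) \<partial>Dm)" if "0 < x"
        unfolding k1[OF that] by (rule nn_integral_eq_integral[symmetric]) (use ic[of x] in auto)
      then show "ennreal (k x) = (\<integral>\<^sup>+v. ennreal (1 - cos (D (x * m v) v)) \<partial>Dm) * indicator {0<..} x"
        by (cases "0 < x") (simp_all add: k_def)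
    qed
    also have "\<dots> = ennreal \<kappa>" by (subst intensity_scaling[OF hm]) (rule \<kappa>)
    finally show ?thesis .
  qed
  have km[measurable]: "k \<in> borel_measurable borel"
  proof -
    have "(\<lambda>z. cos (case_prod D (fst z * m (snd z), snd z))) \<in> borel_measurable (borel \<Otimes>\<^sub>M borel)"
      by measurable
    then have "(\<lambda>(x, v). cos (D (x * m v) v)) \<in> borel_measurable (borel \<Otimes>\<^sub>M Dm)"
      by (simp add: case_prod_beta' cong: measurable_cong_sets)
    then have "(\<lambda>x. LINT v|Dm. cos (D (x * m v) v)) \<in> borel_measurable borel"
      by (intro DD.borel_measurable_lebesgue_integral)
    then show ?thesis unfolding k_def[abs_def] by measurable
  qed
  have ki: "integrable lborel k"
    by (rule integrableI_nonneg) (use nk kn in auto)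
  have k: "thinning_rate k"
    by unfold_locales (use kn kle kc ki in \<open>auto simp: k_def\<close>)
  interpret k: thinning_rate k by fact
  have kint: "(LINT x|lborel. k x) = \<kappa>"
    using nk \<kappa>(2) kn by (subst integral_eq_nn_integral) auto
  have mart: "(CLINT \<omega>|M. iexp (\<Sum>i<n. mark_sum_term D i \<omega>) * k.survival (arrival n \<omega>)) = of_real (exp (- \<kappa>))" for n
    by (subst survival_martingale[OF Dm k]) (simp_all add: k.survival_0 kint, simp add: k_def)
  have "(\<lambda>n. CLINT \<omega>|M. iexp (\<Sum>i<n. mark_sum_term D i \<omega>) * k.survival (arrival n \<omega>)) \<longlonglongrightarrow> (CLINT \<omega>|M. iexp (\<Sum>i. mark_sum_term D i \<omega>) * 1)"
  proof (rule integral_dominated_convergence[where w="\<lambda>_. 1"])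
    show "AE \<omega> in M. (\<lambda>n. iexp (\<Sum>i<n. mark_sum_term D i \<omega>) * complex_of_real (k.survival (arrival n \<omega>))) \<longlonglongrightarrow> iexp (\<Sum>i. mark_sum_term D i \<omega>) * 1"
      using AE_arrival_at_top mark_sum_AE_summable[OF Dm fin]
    proof eventually_elim
      case (elim \<omega>)
      have "(\<lambda>n. k.survival (arrival n \<omega>)) \<longlonglongrightarrow> 1"
        using elim(1) by (rule filterlim_compose[OF k.survival_at_top])
      then have "(\<lambda>n. complex_of_real (k.survival (arrival n \<omega>))) \<longlonglongrightarrow> of_real 1" by (intro tendsto_intros)
      moreover have "(\<lambda>n. iexp (\<Sum>i<n. mark_sum_term D i \<omega>)) \<longlonglongrightarrow> iexp (\<Sum>i. mark_sum_term D i \<omega>)"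
        by (intro tendsto_intros summable_LIMSEQ elim)
      ultimately show ?case by (intro tendsto_mult) simp_all
    qed
    show "AE \<omega> in M. norm (iexp (\<Sum>i<n. mark_sum_term D i \<omega>) * complex_of_real (k.survival (arrival n \<omega>))) \<le> 1" for n
      using k.survival_bounds by (intro AE_I2) (simp add: norm_mult less_imp_le)
  qed measurable
  then show ?thesis unfolding mart by (simp add: LIMSEQ_const_iff)
qed

end

section \<open>Stable integrals as random sums\<close>

context marked_poisson
begin

definition mark_sum :: "(real \<Rightarrow> real \<Rightarrow> real) \<Rightarrow> 'a \<Rightarrow> real" where
  "mark_sum D \<omega> = (\<Sum>i. mark_sum_term D i \<omega>)"

text \<open>
  For \<open>p = 1/a\<close> these are the kernels of the \<open>a\<close>-stable integrals.
\<close>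

definition stable_kernel :: "real \<Rightarrow> (real \<Rightarrow> real) \<Rightarrow> real \<Rightarrow> real \<Rightarrow> real" where
  "stable_kernel p f = (\<lambda>y v. f v * y powr (- p))"

lemma mark_sum_measurable [measurable]:
  assumes [measurable]: "case_prod D \<in> borel_measurable (borel \<Otimes>\<^sub>M borel)"
  shows "mark_sum D \<in> borel_measurable M"
  unfolding mark_sum_def[abs_def] by measurable

lemma stable_kernel_measurable [measurable]:
  assumes [measurable]: "f \<in> borel_measurable borel"
  shows "case_prod (stable_kernel p f) \<in> borel_measurable (borel \<Otimes>\<^sub>M borel)"
  unfolding stable_kernel_def case_prod_beta' by measurable

lemma mark_sum_linear:
  assumes D: "case_prod D1 \<in> borel_measurable (borel \<Otimes>\<^sub>M borel)" "energy D1 < \<infinity>"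
    "case_prod D2 \<in> borel_measurable (borel \<Otimes>\<^sub>M borel)" "energy D2 < \<infinity>"
  shows "AE \<omega> in M. mark_sum (\<lambda>y v. p * D1 y v + q * D2 y v) \<omega> = p * mark_sum D1 \<omega> + q * mark_sum D2 \<omega>"
  using mark_sum_AE_summable[OF D(1,2)] mark_sum_AE_summable[OF D(3,4)]
proof eventually_elim
  case (elim \<omega>)
  have "mark_sum_term (\<lambda>y v. p * D1 y v + q * D2 y v) i \<omega> = p * mark_sum_term D1 i \<omega> + q * mark_sum_term D2 i \<omega>" for i
    by (simp add: mark_sum_term_def algebra_simps)
  then show ?case
    unfolding mark_sum_def using elim
    by (simp add: suminf_add[symmetric] summable_mult suminf_mult[symmetric])
qed

lemma energy_mono:
  assumes "\<And>y v. 0 < y \<Longrightarrow> \<bar>D y v\<bar> \<le> \<bar>D' y v\<bar>"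
  shows "energy D \<le> energy D'"
  unfolding energy_def
proof (intro nn_integral_mono)
  fix v y
  show "ennreal (min 1 ((D y v)\<^sup>2)) * indicator {0<..} y \<le> ennreal (min 1 ((D' y v)\<^sup>2)) * indicator {0<..} y"
  proof (cases "0 < y")
    case True
    have "(D y v)\<^sup>2 \<le> (D' y v)\<^sup>2" using assms[OF True] by (simp add: abs_le_square_iff)
    then show ?thesis by (intro mult_right_mono ennreal_leI min.mono) auto
  qed simp
qed

lemma energy_add:
  assumes [measurable]: "case_prod D1 \<in> borel_measurable (borel \<Otimes>\<^sub>M borel)" "case_prod D2 \<in> borel_measurable (borel \<Otimes>\<^sub>M borel)"
  shows "energy (\<lambda>y v. D1 y v + D2 y v) \<le> 4 * (energy D1 + energy D2)"
proof -
  have meas: "(\<lambda>(v, y). ennreal (min 1 ((D y v)\<^sup>2)) * indicator {0<..} y) \<in> borel_measurable (borel \<Otimes>\<^sub>M borel)"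
    if [measurable]: "case_prod D \<in> borel_measurable (borel \<Otimes>\<^sub>M borel)" for D :: "real \<Rightarrow> real \<Rightarrow> real"
  proof -
    have "(\<lambda>z. ennreal (min 1 ((case_prod D (snd z, fst z))\<^sup>2)) * indicator {0<..} (snd z)) \<in> borel_measurable (borel \<Otimes>\<^sub>M borel)"
      by measurable
    then show ?thesis by (simp add: case_prod_beta')
  qed
  have m1: "(\<lambda>v. \<integral>\<^sup>+y\<in>{0<..}. ennreal (min 1 ((D y v)\<^sup>2)) \<partial>lborel) \<in> borel_measurable lborel"
    and m2: "(\<lambda>y. ennreal (min 1 ((D y v)\<^sup>2)) * indicator {0<..} y) \<in> borel_measurable lborel"
    if "case_prod D \<in> borel_measurable (borel \<Otimes>\<^sub>M borel)" for D :: "real \<Rightarrow> real \<Rightarrow> real" and v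
    using lborel.borel_measurable_nn_integral[of "\<lambda>v y. ennreal (min 1 ((D y v)\<^sup>2)) * indicator {0<..} y" borel]
      meas[OF that] measurable_Pair2[OF meas[OF that], of v] by simp_all
  have "energy (\<lambda>y v. D1 y v + D2 y v) \<le> (\<integral>\<^sup>+v. (\<integral>\<^sup>+y. 4 * (ennreal (min 1 ((D1 y v)\<^sup>2)) * indicator {0<..} y + ennreal (min 1 ((D2 y v)\<^sup>2)) * indicator {0<..} y) \<partial>lborel) \<partial>lborel)"
    unfolding energy_def
  proof (intro nn_integral_mono)
    fix v y
    have "min 1 ((a + b)\<^sup>2) \<le> 4 * (min 1 (a\<^sup>2) + min 1 (b\<^sup>2))" for a b :: real
    proof -
      have "(a + b)\<^sup>2 \<le> 2 * a\<^sup>2 + 2 * b\<^sup>2"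
        using zero_le_power2[of "a - b"] by (simp add: power2_eq_square algebra_simps)
      then show ?thesis by (auto simp: min_def) (use zero_le_power2[of a] zero_le_power2[of b] in linarith)+
    qed
    from ennreal_leI[OF this[of "D1 y v" "D2 y v"]]
    show "ennreal (min 1 ((D1 y v + D2 y v)\<^sup>2)) * indicator {0<..} y
      \<le> 4 * (ennreal (min 1 ((D1 y v)\<^sup>2)) * indicator {0<..} y + ennreal (min 1 ((D2 y v)\<^sup>2)) * indicator {0<..} y)"
      by (cases "0 < y") (auto simp: ennreal_mult ennreal_plus)
  qed
  also have "\<dots> = 4 * (energy D1 + energy D2)"
    unfolding energy_def using m1[OF assms(1)] m1[OF assms(2)] m2[OF assms(1)] m2[OF assms(2)]
    by (simp add: nn_integral_cmult nn_integral_add)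
  finally show ?thesis .
qed

text \<open>
  By scaling in \<open>y\<close>, the inner integral of the energy is the \<open>1/p\<close>-th power of the factor \<open>c f(v)\<close> times a
  constant.
\<close>

lemma energy_stable_kernel:
  assumes p: "1 / 2 < p" "p < 1"
  obtains K where "0 \<le> K" "\<And>c f. f \<in> L_space (1 / p) \<Longrightarrow>
    energy (stable_kernel p (\<lambda>v. c * f v)) = ennreal (K * \<bar>c\<bar> powr (1 / p) * (LINT v|lborel. \<bar>f v\<bar> powr (1 / p)))"
proof -
  obtain K where K: "K \<ge> 0" "\<And>c. (\<integral>\<^sup>+ y\<in>{0<..}. ennreal (min 1 ((c * y powr (- p))\<^sup>2)) \<partial>lborel) = ennreal (\<bar>c\<bar> powr (1 / p) * K)"
    using truncated_power_integral[OF p] by blast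
  show ?thesis
  proof (rule that[OF K(1)])
    fix c and f :: "real \<Rightarrow> real" assume f: "f \<in> L_space (1 / p)"
    have "energy (stable_kernel p (\<lambda>v. c * f v)) = (\<integral>\<^sup>+v. ennreal (K * \<bar>c\<bar> powr (1 / p) * \<bar>f v\<bar> powr (1 / p)) \<partial>lborel)"
      unfolding energy_def stable_kernel_def K by (simp add: abs_mult powr_mult mult_ac)
    also have "\<dots> = ennreal (LINT v|lborel. K * \<bar>c\<bar> powr (1 / p) * \<bar>f v\<bar> powr (1 / p))"
      using f K(1) by (intro nn_integral_eq_integral) (auto simp: L_space_def)
    finally show "energy (stable_kernel p (\<lambda>v. c * f v)) = ennreal (K * \<bar>c\<bar> powr (1 / p) * (LINT v|lborel. \<bar>f v\<bar> powr (1 / p)))"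
      by simp
  qed
qed

lemma energy_stable_kernel_finite:
  assumes p: "1 / 2 < p" "p < 1" and f: "f \<in> L_space (1 / p)"
  shows "energy (stable_kernel p f) < \<infinity>"
proof -
  obtain K where "\<And>c f. f \<in> L_space (1 / p) \<Longrightarrow>
    energy (stable_kernel p (\<lambda>v. c * f v)) = ennreal (K * \<bar>c\<bar> powr (1 / p) * (LINT v|lborel. \<bar>f v\<bar> powr (1 / p)))"
    using energy_stable_kernel[OF p] by blast
  from this[OF f, of 1] show ?thesis by simp
qed

text \<open>
  The LePage representation of a symmetric stable integral.
\<close>

lemma stable_char:
  assumes a: "1 < a" "a < 2" and f: "f \<in> L_space a"
  shows "(CLINT \<omega>|M. iexp (mark_sum (stable_kernel (1 / a) f) \<omega>)) =
    of_real (exp (- (sine_moment a * (LINT v|lborel. \<bar>f v\<bar> powr a))))"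
  unfolding mark_sum_def
proof (rule mark_sum_char)
  have fm[measurable]: "f \<in> borel_measurable borel" using f by (simp add: L_space_def)
  show "case_prod (stable_kernel (1 / a) f) \<in> borel_measurable (borel \<Otimes>\<^sub>M borel)" by measurable
  show "energy (stable_kernel (1 / a) f) < \<infinity>"
    using a f by (intro energy_stable_kernel_finite) (auto simp: field_simps)
  show "isCont (\<lambda>y. stable_kernel (1 / a) f y v) y" if "0 < y" for v y
    using that unfolding stable_kernel_def by (intro continuous_intros) auto
  have "(\<integral>\<^sup>+v. (\<integral>\<^sup>+y\<in>{0<..}. ennreal (1 - cos (stable_kernel (1 / a) f y v)) \<partial>lborel) \<partial>lborel)
      = (\<integral>\<^sup>+v. ennreal (sine_moment a * \<bar>f v\<bar> powr a) \<partial>lborel)"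
    unfolding stable_kernel_def using one_minus_cos_scaled_integral[OF a] by (simp add: mult.commute)
  also have "\<dots> = ennreal (sine_moment a * (LINT v|lborel. \<bar>f v\<bar> powr a))"
    using f sine_moment_pos[OF a] by (subst nn_integral_eq_integral) (auto simp: L_space_def)
  finally show "(\<integral>\<^sup>+v. (\<integral>\<^sup>+y\<in>{0<..}. ennreal (1 - cos (stable_kernel (1 / a) f y v)) \<partial>lborel) \<partial>lborel)
      = ennreal (sine_moment a * (LINT v|lborel. \<bar>f v\<bar> powr a))" .
  show "0 \<le> sine_moment a * (LINT v|lborel. \<bar>f v\<bar> powr a)"
    using sine_moment_pos[OF a] by (intro mult_nonneg_nonneg integral_nonneg_AE) auto
qed

end

lemma L_space_linear:
  assumes a: "0 < a" and f: "f \<in> L_space a" and g: "g \<in> L_space a"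
  shows "(\<lambda>x. p * f x + q * g x) \<in> L_space a"
proof -
  have [measurable]: "f \<in> borel_measurable borel" "g \<in> borel_measurable borel" using f g by (auto simp: L_space_def)
  have i: "integrable lborel (\<lambda>x. (2 * \<bar>p\<bar>) powr a * \<bar>f x\<bar> powr a + (2 * \<bar>q\<bar>) powr a * \<bar>g x\<bar> powr a)"
    using f g by (auto simp: L_space_def)
  have "integrable lborel (\<lambda>x. \<bar>p * f x + q * g x\<bar> powr a)"
  proof (rule Bochner_Integration.integrable_bound[OF i])
    show "AE x in lborel. norm (\<bar>p * f x + q * g x\<bar> powr a) \<le> norm ((2 * \<bar>p\<bar>) powr a * \<bar>f x\<bar> powr a + (2 * \<bar>q\<bar>) powr a * \<bar>g x\<bar> powr a)"
    proof (intro AE_I2)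
      fix x
      let ?A = "2 * \<bar>p\<bar> * \<bar>f x\<bar>" and ?B = "2 * \<bar>q\<bar> * \<bar>g x\<bar>"
      have "\<bar>p * f x + q * g x\<bar> \<le> \<bar>p * f x\<bar> + \<bar>q * g x\<bar>" by (rule abs_triangle_ineq)
      then have "\<bar>p * f x + q * g x\<bar> \<le> max ?A ?B" by (auto simp: abs_mult max_def)
      then have "\<bar>p * f x + q * g x\<bar> powr a \<le> max ?A ?B powr a" using a by (intro powr_mono2) auto
      also have "\<dots> \<le> ?A powr a + ?B powr a" by (auto simp: max_def)
      finally show "norm (\<bar>p * f x + q * g x\<bar> powr a) \<le> norm ((2 * \<bar>p\<bar>) powr a * \<bar>f x\<bar> powr a + (2 * \<bar>q\<bar>) powr a * \<bar>g x\<bar> powr a)"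
        by (simp add: powr_mult)
    qed
  qed measurable
  then show ?thesis by (simp add: L_space_def)
qed

lemma L_space_indicator:
  assumes "A \<in> sets borel" "emeasure lborel A < \<infinity>"
  shows "indicator A \<in> L_space a"
proof -
  have "integrable lborel (indicator A :: real \<Rightarrow> real)" using assms by (intro integrable_real_indicator) auto
  moreover have "\<bar>indicator A x\<bar> powr a = (indicator A x :: real)" for x by (simp add: indicator_def)
  ultimately show ?thesis using assms by (simp add: L_space_def)
qed

lemma L_space_sum:
  assumes a: "0 < a" and T: "finite T" and f: "\<And>t. t \<in> T \<Longrightarrow> f t \<in> L_space a"
  shows "(\<lambda>x. \<Sum>t\<in>T. \<xi> t * f t x) \<in> L_space a"
  using T f
proof (induction T rule: finite_induct)
  case empty
  then show ?case using a by (simp add: L_space_def)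
next
  case (insert t T)
  then have "(\<lambda>x. \<xi> t * f t x + 1 * (\<Sum>t\<in>T. \<xi> t * f t x)) \<in> L_space a"
    by (intro L_space_linear a) auto
  then show ?case using insert by simp
qed

lemma truncated_exponential_L_space:
  assumes "0 < a" "0 < lam"
  shows "(\<lambda>v. c * exp (- lam * (v - u)) * indicator {w..} v) \<in> L_space a"
proof -
  have "((\<lambda>v. exp (- (a * lam) * v)) has_integral exp (- (a * lam) * w) / (a * lam)) {w..}"
    by (rule has_integral_exp_minus_to_infinity) (use assms in simp)
  then have "(\<integral>\<^sup>+ v. ennreal (indicator {w..} v * exp (- (a * lam) * v)) \<partial>lborel) < \<infinity>"
    by (subst nn_integral_has_integral_lebesgue) auto
  then have i: "integrable lborel (\<lambda>v. indicator {w..} v * exp (- (a * lam) * v))"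
    by (intro integrableI_nonneg) auto
  have "\<bar>c * exp (- lam * (v - u)) * indicator {w..} v\<bar> powr a
     = (\<bar>c\<bar> powr a * exp (a * lam * u)) * (indicator {w..} v * exp (- (a * lam) * v))" for v
    by (auto simp: indicator_def abs_mult powr_mult powr_def[of "exp _"] exp_add[symmetric] algebra_simps)
  then show ?thesis using i by (simp add: L_space_def)
qed

section \<open>Regularity of the kernel in time\<close>

lemma locally_lipschitz_at_of_derivative:
  fixes g :: "real \<Rightarrow> real"
  assumes "(g has_real_derivative D) (at u)"
  obtains C \<delta> where "0 \<le> C" "0 < \<delta>" "\<And>s. \<bar>s - u\<bar> < \<delta> \<Longrightarrow> \<bar>g s - g u\<bar> \<le> C * \<bar>s - u\<bar>"
proof -
  have "((\<lambda>s. (g s - g u) / (s - u)) \<longlongrightarrow> D) (at u)"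
    using assms by (simp add: has_field_derivative_iff)
  then have "eventually (\<lambda>s. dist ((g s - g u) / (s - u)) D < 1) (at u)" by (rule tendstoD) simp
  then obtain \<delta> where \<delta>: "\<delta> > 0" "\<And>s. s \<noteq> u \<Longrightarrow> dist s u < \<delta> \<Longrightarrow> dist ((g s - g u) / (s - u)) D < 1"
    unfolding eventually_at by blast
  show ?thesis
  proof (rule that[of "\<bar>D\<bar> + 1" \<delta>])
    fix s assume s: "\<bar>s - u\<bar> < \<delta>"
    show "\<bar>g s - g u\<bar> \<le> (\<bar>D\<bar> + 1) * \<bar>s - u\<bar>"
    proof (cases "s = u")
      case False
      then have "\<bar>(g s - g u) / (s - u)\<bar> \<le> \<bar>D\<bar> + 1"
        using \<delta>(2)[of s] s unfolding dist_real_def by linarith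
      then show ?thesis using False by (simp add: abs_divide divide_le_eq)
    qed simp
  qed (use \<delta> in auto)
qed

text \<open>
  The factor in front of the double series.
\<close>

definition amplitude :: "(real \<Rightarrow> real) \<Rightarrow> (real \<Rightarrow> real) \<Rightarrow> real \<Rightarrow> real" where
  "amplitude \<alpha> b t = b t * C_const (\<alpha> t) powr (1 / \<alpha> t)"

lemma C_const_sine_moment: "C_const a = inverse (sine_moment a)"
  by (simp add: C_const_def sine_moment_def)

lemma amplitude_differentiable:
  assumes "1 < \<alpha> u" "\<alpha> u < 2"
    and \<alpha>: "(\<alpha> has_real_derivative a') (at u)" and b: "(b has_real_derivative b') (at u)"
  obtains D where "(amplitude \<alpha> b has_real_derivative D) (at u)"
proof -
  obtain S where S: "(sine_moment has_real_derivative S) (at (\<alpha> u))"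
    using sine_moment_differentiable assms by blast
  have pos: "sine_moment (\<alpha> u) > 0" using sine_moment_pos assms by blast
  have 1: "((\<lambda>t. sine_moment (\<alpha> t)) has_real_derivative S * a') (at u)"
    by (rule DERIV_chain2[OF S \<alpha>])
  have 2: "((\<lambda>t. inverse (sine_moment (\<alpha> t))) has_real_derivative - (inverse (sine_moment (\<alpha> u)) * (S * a') * inverse (sine_moment (\<alpha> u)))) (at u)"
    by (rule DERIV_inverse'[OF 1]) (use pos in simp)
  have 3: "((\<lambda>t. 1 / \<alpha> t) has_real_derivative (0 * \<alpha> u - 1 * a') / (\<alpha> u * \<alpha> u)) (at u)"
    by (rule DERIV_divide[OF DERIV_const \<alpha>]) (use assms in simp)
  have 4: "inverse (sine_moment (\<alpha> u)) > 0" using pos by simp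
  show ?thesis
    using DERIV_mult[OF b DERIV_powr[OF 2 4 3]] that
    unfolding amplitude_def[abs_def] C_const_sine_moment by blast
qed

lemma powr_le_sum_of_powers:
  fixes y :: real
  assumes "0 < y" "q \<le> x" "x \<le> p"
  shows "y powr (- x) \<le> y powr (- p) + y powr (- q)"
proof (cases "1 \<le> y")
  case True
  then have "y powr (- x) \<le> y powr (- q)" using assms by (intro powr_mono) auto
  then show ?thesis by (simp add: add_increasing)
next
  case False
  then have "y powr (- x) \<le> y powr (- p)" using assms by (intro powr_mono') auto
  then show ?thesis by (simp add: add_increasing2)
qed

text \<open>
  The tangent inequality \<open>1 + x \<le> exp x\<close>, applied at the larger of the two values.
\<close>

lemma exp_diff_le_max:
  fixes x y :: real shows "\<bar>exp x - exp y\<bar> \<le> \<bar>x - y\<bar> * max (exp x) (exp y)"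
proof -
  have *: "exp x - exp y \<le> (x - y) * exp x" for x y :: real
  proof -
    have "1 + (y - x) \<le> exp (y - x)" by (rule exp_ge_add_one_self)
    then have "(1 + (y - x)) * exp x \<le> exp (y - x) * exp x" by (rule mult_right_mono) simp
    then show ?thesis by (simp add: exp_diff algebra_simps)
  qed
  show ?thesis
  proof (cases "y \<le> x")
    case True
    then show ?thesis using *[of x y] by (simp add: max_def abs_if)
  next
    case False
    then show ?thesis using *[of y x] by (simp add: max_def abs_if)
  qed
qed

text \<open>
  Subtracting from the kernel its jump at the left end leaves a function that is Lipschitz in time. The
  bound must be integrable in \<open>v\<close> and uniform in \<open>s\<close>, which the factor \<open>exp lam\<close> and the shift by \<open>1\<close>
  achieve for \<open>s\<close> within distance \<open>1\<close> of \<open>u\<close>.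
\<close>

lemma kernel_minus_step_lipschitz:
  fixes lam u s v :: real
  assumes lam: "0 < lam" and s: "\<bar>s - u\<bar> \<le> 1"
  shows "\<bar>(exp (- lam * (v - s)) * indicator {s..} v - exp (- lam * (v - u)) * indicator {u..} v) -
      (indicator {s..} v - indicator {u..} v)\<bar> \<le> lam * \<bar>s - u\<bar> * (exp lam * exp (- lam * (v - u)) * indicator {u - 1..} v)"
proof -
  let ?F = "exp lam * exp (- lam * (v - u))"
  \<comment> \<open>Where only one of the two indicators is active, \<open>v\<close> is within distance \<open>1\<close> of \<open>u\<close>, and the dominating function is at least \<open>1\<close>.\<close>
  have one: "1 \<le> ?F" if "v \<le> u + 1"
  proof -
    have "0 \<le> lam * (1 - (v - u))" using that lam by (intro mult_nonneg_nonneg) auto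
    then show ?thesis by (simp add: exp_add[symmetric] algebra_simps)
  qed
  have step: "\<bar>exp (- lam * (v - w)) - 1\<bar> \<le> lam * \<bar>s - u\<bar> * ?F" if w: "0 \<le> v - w" "v - w \<le> \<bar>s - u\<bar>" and v: "v \<le> u + 1" for w
  proof -
    have "\<bar>exp (- lam * (v - w)) - exp 0\<bar> \<le> \<bar>- lam * (v - w) - 0\<bar> * max (exp (- lam * (v - w))) (exp 0)"
      by (rule exp_diff_le_max)
    also have "\<dots> = lam * (v - w)" using w lam by (simp add: abs_mult max_def)
    also have "\<dots> \<le> lam * \<bar>s - u\<bar> * 1" using w lam by simp
    also have "\<dots> \<le> lam * \<bar>s - u\<bar> * ?F" using one[OF v] lam by (intro mult_left_mono) auto
    finally show ?thesis by simp
  qed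
  have both: "\<bar>exp (- lam * (v - s)) - exp (- lam * (v - u))\<bar> \<le> lam * \<bar>s - u\<bar> * ?F"
  proof -
    have "\<bar>exp (- lam * (v - s)) - exp (- lam * (v - u))\<bar> \<le> \<bar>- lam * (v - s) - (- lam * (v - u))\<bar> * max (exp (- lam * (v - s))) (exp (- lam * (v - u)))"
      by (rule exp_diff_le_max)
    also have "- lam * (v - s) - (- lam * (v - u)) = lam * (s - u)"
      by (simp add: algebra_simps)
    also have "\<bar>lam * (s - u)\<bar> = lam * \<bar>s - u\<bar>"
      using lam by (simp add: abs_mult)
    also have "max (exp (- lam * (v - s))) (exp (- lam * (v - u))) \<le> ?F"
    proof -
      have "lam * (s - u) \<le> lam * 1" using lam s by (intro mult_left_mono) auto
      then show ?thesis using lam by (simp add: exp_add[symmetric] algebra_simps)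
    qed
    finally show ?thesis using lam by (simp add: mult_left_mono)
  qed
  consider "v < s" "v < u" | "s \<le> v" "v < u" | "v < s" "u \<le> v" | "s \<le> v" "u \<le> v" by linarith
  then show ?thesis
  proof cases
    case 1 then show ?thesis using lam by simp
  next
    case 2 then show ?thesis using step[of s] s by simp
  next
    case 3 then show ?thesis using step[of u] s by (simp add: abs_minus_commute)
  next
    case 4 then show ?thesis using both by simp
  qed
qed

definition ou_kernel :: "real \<Rightarrow> real \<Rightarrow> real \<Rightarrow> real" where
  "ou_kernel lam t v = exp (- lam * (v - t)) * indicator {t..} v"

text \<open>
  Two sources of error: the dependence of \<open>B(s) y powr (-1/\<alpha>(s))\<close> on \<open>s\<close>, controlled by the
  differentiability of \<open>B\<close> and \<open>\<alpha>\<close> at \<open>u\<close>, and the continuous part of the change of the kernel. Both are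
  linear in \<open>|s - u|\<close>, at the price of a small widening \<open>\<eta>\<close> of the exponents.
\<close>

lemma increment_remainder_bound:
  fixes lam c d u :: real and \<alpha> b :: "real \<Rightarrow> real"
  assumes lam: "0 < lam" and cd: "1 < c" "d < 2" "\<And>t. \<alpha> t \<in> {c..d}" and b: "\<And>t. 0 < b t"
    and \<alpha>': "(\<alpha> has_real_derivative a') (at u)" and b': "(b has_real_derivative b') (at u)"
    and e: "0 < \<eta>"
  obtains C \<delta> where "0 \<le> C" "0 < \<delta>"
    "\<And>s y v. \<bar>s - u\<bar> < \<delta> \<Longrightarrow> 0 < y \<Longrightarrow>
      \<bar>(amplitude \<alpha> b s * y powr (- (1 / \<alpha> s)) * ou_kernel lam s v - amplitude \<alpha> b u * y powr (- (1 / \<alpha> u)) * ou_kernel lam u v)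
        - amplitude \<alpha> b u * y powr (- (1 / \<alpha> u)) * (indicator {s..} v - indicator {u..} v)\<bar>
      \<le> C * \<bar>s - u\<bar> * ((y powr (- (1 / c + \<eta>)) + y powr (- (1 / d - \<eta>))) * (exp (- lam * (v - u)) * indicator {u - 1..} v))"
proof -
  let ?B = "amplitude \<alpha> b"
  have au: "1 < \<alpha> t" "\<alpha> t < 2" for t using cd(1,2) cd(3)[of t] by auto
  obtain D where D: "(?B has_real_derivative D) (at u)"
    using amplitude_differentiable[where \<alpha>=\<alpha> and b=b and u=u, OF au \<alpha>' b'] by blast
  have inv': "((\<lambda>t. 1 / \<alpha> t) has_real_derivative (0 * \<alpha> u - 1 * a') / (\<alpha> u * \<alpha> u)) (at u)"
    by (rule DERIV_divide[OF DERIV_const \<alpha>']) (use au[of u] in simp)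
  obtain C1 \<delta>1 where C1: "0 \<le> C1" "0 < \<delta>1" "\<And>s. \<bar>s - u\<bar> < \<delta>1 \<Longrightarrow> \<bar>?B s - ?B u\<bar> \<le> C1 * \<bar>s - u\<bar>"
    using locally_lipschitz_at_of_derivative[OF D] by blast
  obtain C2 \<delta>2 where C2: "0 \<le> C2" "0 < \<delta>2" "\<And>s. \<bar>s - u\<bar> < \<delta>2 \<Longrightarrow> \<bar>1 / \<alpha> s - 1 / \<alpha> u\<bar> \<le> C2 * \<bar>s - u\<bar>"
    using locally_lipschitz_at_of_derivative[OF inv'] by blast
  have Bu: "0 \<le> ?B u" using b[of u] by (simp add: amplitude_def)
  define C where "C = (C1 + ?B u * (C2 / \<eta>) + ?B u * lam) * exp lam"
  show ?thesis
  proof (rule that[of C "min 1 (min \<delta>1 \<delta>2)"])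
    show "0 \<le> C" unfolding C_def using C1 C2 Bu lam e by (intro mult_nonneg_nonneg add_nonneg_nonneg) auto
    fix s y v :: real assume s: "\<bar>s - u\<bar> < min 1 (min \<delta>1 \<delta>2)" and y: "0 < y"
    let ?W = "y powr (- (1 / c + \<eta>)) + y powr (- (1 / d - \<eta>))"
    let ?E = "exp (- lam * (v - u)) * indicator {u - 1..} v :: real"
    let ?d = "\<bar>s - u\<bar>"
    have ia: "1 / d \<le> 1 / \<alpha> t" "1 / \<alpha> t \<le> 1 / c" for t
      using cd(1) cd(3)[of t] by (auto intro!: divide_left_mono)
    have W0: "0 \<le> ?W" by simp
    have E0: "0 \<le> ?E" by simp
    have pw: "y powr (- (1 / \<alpha> t)) \<le> ?W" for t
      using ia[of t] e y by (intro powr_le_sum_of_powers) auto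
    have k: "0 \<le> ou_kernel lam s v" "ou_kernel lam s v \<le> exp lam * ?E"
    proof -
      have "lam * (s - u) \<le> lam * 1" using lam s by (intro mult_left_mono) auto
      then have "exp (- lam * (v - s)) \<le> exp lam * exp (- lam * (v - u))"
        by (simp add: exp_add[symmetric] algebra_simps)
      then show "ou_kernel lam s v \<le> exp lam * ?E" using s by (auto simp: ou_kernel_def indicator_def)
    qed (simp add: ou_kernel_def)
    have t1: "\<bar>?B s * y powr (- (1 / \<alpha> s)) - ?B u * y powr (- (1 / \<alpha> u))\<bar> \<le> (C1 + ?B u * (C2 / \<eta>)) * ?d * ?W"
    proof -
      have "?B s * y powr (- (1 / \<alpha> s)) - ?B u * y powr (- (1 / \<alpha> u))
         = (?B s - ?B u) * y powr (- (1 / \<alpha> s)) + ?B u * (y powr (- (1 / \<alpha> s)) - y powr (- (1 / \<alpha> u)))"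
        by (simp add: algebra_simps)
      then have "\<bar>?B s * y powr (- (1 / \<alpha> s)) - ?B u * y powr (- (1 / \<alpha> u))\<bar>
         \<le> \<bar>?B s - ?B u\<bar> * y powr (- (1 / \<alpha> s)) + ?B u * \<bar>y powr (- (1 / \<alpha> s)) - y powr (- (1 / \<alpha> u))\<bar>"
        using Bu by (simp add: abs_triangle_ineq[THEN order_trans] abs_mult)
      also have "\<dots> \<le> (C1 * ?d) * ?W + ?B u * (C2 * ?d / \<eta> * ?W)"
      proof (intro add_mono mult_mono mult_left_mono)
        show "\<bar>?B s - ?B u\<bar> \<le> C1 * ?d" using C1(3) s by simp
        have "\<bar>y powr (- (1 / \<alpha> s)) - y powr (- (1 / \<alpha> u))\<bar> \<le> \<bar>1 / \<alpha> s - 1 / \<alpha> u\<bar> / \<eta> * ?W"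
          by (rule powr_exponent_difference[OF y]) (use ia e in auto)
        also have "\<dots> \<le> C2 * ?d / \<eta> * ?W"
          using C2(3)[of s] s e by (intro mult_right_mono divide_right_mono) auto
        finally show "\<bar>y powr (- (1 / \<alpha> s)) - y powr (- (1 / \<alpha> u))\<bar> \<le> C2 * ?d / \<eta> * ?W" .
      qed (use pw C1 Bu in auto)
      also have "\<dots> = (C1 + ?B u * (C2 / \<eta>)) * ?d * ?W" by (simp add: algebra_simps)
      finally show ?thesis .
    qed
    have t2: "\<bar>(ou_kernel lam s v - ou_kernel lam u v) - (indicator {s..} v - indicator {u..} v)\<bar> \<le> lam * ?d * (exp lam * ?E)"
      using kernel_minus_step_lipschitz[OF lam, of s u v] s by (simp add: ou_kernel_def mult.assoc)
    have "(?B s * y powr (- (1 / \<alpha> s)) * ou_kernel lam s v - ?B u * y powr (- (1 / \<alpha> u)) * ou_kernel lam u v)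
        - ?B u * y powr (- (1 / \<alpha> u)) * (indicator {s..} v - indicator {u..} v)
      = (?B s * y powr (- (1 / \<alpha> s)) - ?B u * y powr (- (1 / \<alpha> u))) * ou_kernel lam s v
       + ?B u * y powr (- (1 / \<alpha> u)) * ((ou_kernel lam s v - ou_kernel lam u v) - (indicator {s..} v - indicator {u..} v))"
      by (simp add: algebra_simps)
    also have "\<bar>\<dots>\<bar> \<le> \<bar>?B s * y powr (- (1 / \<alpha> s)) - ?B u * y powr (- (1 / \<alpha> u))\<bar> * ou_kernel lam s v
       + ?B u * y powr (- (1 / \<alpha> u)) * \<bar>(ou_kernel lam s v - ou_kernel lam u v) - (indicator {s..} v - indicator {u..} v)\<bar>"
      using Bu k by (intro order_trans[OF abs_triangle_ineq]) (simp add: abs_mult)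
    also have "\<dots> \<le> ((C1 + ?B u * (C2 / \<eta>)) * ?d * ?W) * (exp lam * ?E) + (?B u * ?W) * (lam * ?d * (exp lam * ?E))"
      by (intro add_mono mult_mono t1 t2 k pw mult_left_mono mult_nonneg_nonneg) (use Bu C1 C2 e W0 E0 lam in auto)
    also have "\<dots> = C * ?d * (?W * ?E)" by (simp add: C_def algebra_simps)
    finally show "\<bar>(?B s * y powr (- (1 / \<alpha> s)) * ou_kernel lam s v - ?B u * y powr (- (1 / \<alpha> u)) * ou_kernel lam u v)
        - ?B u * y powr (- (1 / \<alpha> u)) * (indicator {s..} v - indicator {u..} v)\<bar> \<le> C * ?d * (?W * ?E)" .
  qed (use C1 C2 in auto)
qed

section \<open>Gaps, marks and signs of the series process\<close>

definition triple_rectangles :: "(real \<times> real \<times> real) set set" where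
  "triple_rectangles = {A \<times> (B \<times> C) | A B C. A \<in> sets borel \<and> B \<in> sets borel \<and> C \<in> sets borel}"

lemma sets_borel_triple: "sets (borel :: (real \<times> real \<times> real) measure) = sigma_sets UNIV triple_rectangles"
proof -
  let ?b = "borel :: real measure"
  let ?R = "{B \<times> C | B C. B \<in> sets ?b \<and> C \<in> sets ?b}"
  have "sets (?b \<Otimes>\<^sub>M (?b \<Otimes>\<^sub>M ?b)) = sets (sigma (space ?b \<times> space (?b \<Otimes>\<^sub>M ?b)) {a \<times> b | a b. a \<in> sets ?b \<and> b \<in> ?R})"
  proof (rule sets_pair_eq)
    show "sets ?b \<subseteq> Pow (space ?b)" "sets ?b = sigma_sets (space ?b) (sets ?b)"
      by (rule sets.space_closed, rule sets.sigma_sets_eq[symmetric])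
    show "?R \<subseteq> Pow (space (?b \<Otimes>\<^sub>M ?b))" by (auto simp: space_pair_measure)
    show "sets (?b \<Otimes>\<^sub>M ?b) = sigma_sets (space (?b \<Otimes>\<^sub>M ?b)) ?R"
      by (simp only: sets_pair_measure space_pair_measure)
    show "countable {UNIV :: real set}" "{UNIV} \<subseteq> sets ?b" "\<Union>{UNIV} = space ?b" by auto
    show "countable {UNIV :: (real \<times> real) set}" "\<Union>{UNIV} = space (?b \<Otimes>\<^sub>M ?b)" by (auto simp: space_pair_measure)
    have "(UNIV :: (real \<times> real) set) = UNIV \<times> UNIV" by simp
    moreover have "(UNIV :: real set) \<in> sets ?b" by simp
    ultimately show "{UNIV} \<subseteq> ?R" by blast
  qed
  also have "{a \<times> b | a b. a \<in> sets ?b \<and> b \<in> ?R} = triple_rectangles"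
    unfolding triple_rectangles_def by blast
  also have "space ?b \<times> space (?b \<Otimes>\<^sub>M ?b) = UNIV" by (simp add: space_pair_measure)
  finally have "sets (?b \<Otimes>\<^sub>M (?b \<Otimes>\<^sub>M ?b)) = sigma_sets UNIV triple_rectangles" by simp
  then show ?thesis by (simp only: borel_prod)
qed

lemma Int_stable_triple_rectangles: "Int_stable triple_rectangles"
  unfolding Int_stable_def triple_rectangles_def
proof safe
  fix A B C A' B' C' :: "real set"
  assume "A \<in> sets borel" "B \<in> sets borel" "C \<in> sets borel" "A' \<in> sets borel" "B' \<in> sets borel" "C' \<in> sets borel"
  then show "\<exists>A'' B'' C''. A \<times> B \<times> C \<inter> A' \<times> B' \<times> C' = A'' \<times> B'' \<times> C'' \<and>
       A'' \<in> sets borel \<and> B'' \<in> sets borel \<and> C'' \<in> sets borel"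
    by (intro exI[of _ "A \<inter> A'"] exI[of _ "B \<inter> B'"] exI[of _ "C \<inter> C'"]) auto
qed

context prob_space
begin

text \<open>
  It suffices to factorise the probabilities of rectangles, which form an intersection-stable generator
  of the Borel sets of triples.
\<close>

lemma indep_vars_triples:
  fixes X Y Z :: "nat \<Rightarrow> 'a \<Rightarrow> real"
  assumes X[measurable]: "\<And>i. X i \<in> borel_measurable M" and Y[measurable]: "\<And>i. Y i \<in> borel_measurable M"
    and Z[measurable]: "\<And>i. Z i \<in> borel_measurable M"
    and fact: "\<And>J A B C. finite J \<Longrightarrow> J \<noteq> {} \<Longrightarrow> (\<And>i. i \<in> J \<Longrightarrow> A i \<in> sets borel) \<Longrightarrow>
      (\<And>i. i \<in> J \<Longrightarrow> B i \<in> sets borel) \<Longrightarrow> (\<And>i. i \<in> J \<Longrightarrow> C i \<in> sets borel) \<Longrightarrow>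
      prob {\<omega>\<in>space M. \<forall>i\<in>J. X i \<omega> \<in> A i \<and> Y i \<omega> \<in> B i \<and> Z i \<omega> \<in> C i} =
      (\<Prod>i\<in>J. prob (X i -` A i \<inter> space M)) * (\<Prod>i\<in>J. prob (Y i -` B i \<inter> space M)) * (\<Prod>i\<in>J. prob (Z i -` C i \<inter> space M))"
  shows "indep_vars (\<lambda>_. borel) (\<lambda>i \<omega>. (X i \<omega>, Y i \<omega>, Z i \<omega>)) UNIV"
    and "distr M borel (\<lambda>\<omega>. (X i \<omega>, Y i \<omega>, Z i \<omega>)) = distr M borel (X i) \<Otimes>\<^sub>M (distr M borel (Y i) \<Otimes>\<^sub>M distr M borel (Z i))"
proof -
  let ?T = "\<lambda>i \<omega>. (X i \<omega>, Y i \<omega>, Z i \<omega>)"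
  have Tm[measurable]: "?T i \<in> borel_measurable M" for i
    by (simp add: borel_prod[symmetric])
  have gs: "{?T i -` S \<inter> space M | S. S \<in> sets borel} = sigma_sets (space M) {?T i -` S \<inter> space M | S. S \<in> triple_rectangles}" for i
    unfolding sets_borel_triple by (rule sigma_sets_vimage_commute) auto
  have one: "prob {\<omega>\<in>space M. X i \<omega> \<in> A \<and> Y i \<omega> \<in> B \<and> Z i \<omega> \<in> C} =
      prob (X i -` A \<inter> space M) * prob (Y i -` B \<inter> space M) * prob (Z i -` C \<inter> space M)"
    if "A \<in> sets borel" "B \<in> sets borel" "C \<in> sets borel" for i A B C
    using fact[of "{i}" "\<lambda>_. A" "\<lambda>_. B" "\<lambda>_. C"] that by simp
  have sub: "triple_rectangles \<subseteq> sets borel" unfolding sets_borel_triple by auto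
  show "indep_vars (\<lambda>_. borel) ?T UNIV"
    unfolding indep_vars_def2 gs
  proof (intro conjI ballI Tm indep_sets_sigma)
    show "indep_sets (\<lambda>i. {?T i -` S \<inter> space M | S. S \<in> triple_rectangles}) UNIV"
    proof (rule indep_setsI)
      show "{?T i -` S \<inter> space M | S. S \<in> triple_rectangles} \<subseteq> events" for i
        using sub measurable_sets[OF Tm[of i]] by auto
      fix F J assume J: "J \<noteq> {}" "finite J" and FJ: "\<forall>j\<in>J. F j \<in> {?T j -` S \<inter> space M | S. S \<in> triple_rectangles}"
      have "\<forall>j\<in>J. \<exists>A B C. F j = ?T j -` (A \<times> (B \<times> C)) \<inter> space M \<and> A \<in> sets borel \<and> B \<in> sets borel \<and> C \<in> sets borel"
      proof
        fix j assume "j \<in> J"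
        then obtain S where S: "F j = ?T j -` S \<inter> space M" "S \<in> triple_rectangles" using FJ by auto
        then obtain A B C where "S = A \<times> (B \<times> C)" "A \<in> sets borel" "B \<in> sets borel" "C \<in> sets borel"
          unfolding triple_rectangles_def by auto
        with S(1) show "\<exists>A B C. F j = ?T j -` (A \<times> (B \<times> C)) \<inter> space M \<and> A \<in> sets borel \<and> B \<in> sets borel \<and> C \<in> sets borel"
          by auto
      qed
      from bchoice[OF this] obtain A where "\<forall>j\<in>J. \<exists>B C. F j = ?T j -` (A j \<times> (B \<times> C)) \<inter> space M \<and> A j \<in> sets borel \<and> B \<in> sets borel \<and> C \<in> sets borel"
        by (elim exE)
      from bchoice[OF this] obtain B where "\<forall>j\<in>J. \<exists>C. F j = ?T j -` (A j \<times> (B j \<times> C)) \<inter> space M \<and> A j \<in> sets borel \<and> B j \<in> sets borel \<and> C \<in> sets borel"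
        by (elim exE)
      from bchoice[OF this] obtain C where ABC: "\<forall>j\<in>J. F j = ?T j -` (A j \<times> (B j \<times> C j)) \<inter> space M \<and> A j \<in> sets borel \<and> B j \<in> sets borel \<and> C j \<in> sets borel"
        by (elim exE)
      then have F: "\<And>j. j \<in> J \<Longrightarrow> F j = ?T j -` (A j \<times> (B j \<times> C j)) \<inter> space M"
        and s: "\<And>j. j \<in> J \<Longrightarrow> A j \<in> sets borel" "\<And>j. j \<in> J \<Longrightarrow> B j \<in> sets borel" "\<And>j. j \<in> J \<Longrightarrow> C j \<in> sets borel"
        by simp_all
      have "(\<Inter>j\<in>J. F j) = {\<omega>\<in>space M. \<forall>i\<in>J. X i \<omega> \<in> A i \<and> Y i \<omega> \<in> B i \<and> Z i \<omega> \<in> C i}"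
        using J F by auto
      then have "prob (\<Inter>j\<in>J. F j) = (\<Prod>j\<in>J. prob (X j -` A j \<inter> space M) * prob (Y j -` B j \<inter> space M) * prob (Z j -` C j \<inter> space M))"
        using fact[OF J(2,1) s] by (simp add: prod.distrib)
      also have "\<dots> = (\<Prod>j\<in>J. prob (F j))"
      proof (rule prod.cong[OF refl])
        fix j assume j: "j \<in> J"
        have "F j = {\<omega>\<in>space M. X j \<omega> \<in> A j \<and> Y j \<omega> \<in> B j \<and> Z j \<omega> \<in> C j}" using F[OF j] by auto
        then show "prob (X j -` A j \<inter> space M) * prob (Y j -` B j \<inter> space M) * prob (Z j -` C j \<inter> space M) = prob (F j)"
          using one[OF s(1)[OF j] s(2)[OF j] s(3)[OF j]] by simp
      qed
      finally show "prob (\<Inter>j\<in>J. F j) = (\<Prod>j\<in>J. prob (F j))" .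
    qed
    show "Int_stable {?T i -` S \<inter> space M | S. S \<in> triple_rectangles}" for i
    proof (unfold Int_stable_def, safe)
      fix S S' assume "S \<in> triple_rectangles" "S' \<in> triple_rectangles"
      then have "S \<inter> S' \<in> triple_rectangles" using Int_stable_triple_rectangles by (auto simp: Int_stable_def)
      then show "\<exists>S''. ?T i -` S \<inter> space M \<inter> (?T i -` S' \<inter> space M) = ?T i -` S'' \<inter> space M \<and> S'' \<in> triple_rectangles"
        by (intro exI[of _ "S \<inter> S'"]) auto
    qed
  qed
  let ?PX = "distr M borel (X i)" and ?PY = "distr M borel (Y i)" and ?PZ = "distr M borel (Z i)"
  interpret PX: prob_space ?PX by (rule prob_space_distr) simp
  interpret PY: prob_space ?PY by (rule prob_space_distr) simp
  interpret PZ: prob_space ?PZ by (rule prob_space_distr) simp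
  interpret PYZ: pair_prob_space ?PY ?PZ ..
  show "distr M borel (?T i) = ?PX \<Otimes>\<^sub>M (?PY \<Otimes>\<^sub>M ?PZ)"
  proof (rule measure_eqI_generator_eq[OF Int_stable_triple_rectangles, where A="\<lambda>_. UNIV" and \<Omega>=UNIV])
    show "sets (distr M borel (?T i)) = sigma_sets UNIV triple_rectangles" by (simp add: sets_borel_triple)
    have "sets (?PX \<Otimes>\<^sub>M (?PY \<Otimes>\<^sub>M ?PZ)) = sets (borel \<Otimes>\<^sub>M (borel \<Otimes>\<^sub>M borel :: (real \<times> real) measure))"
      by (intro sets_pair_measure_cong) auto
    then show "sets (?PX \<Otimes>\<^sub>M (?PY \<Otimes>\<^sub>M ?PZ)) = sigma_sets UNIV triple_rectangles"
      by (simp only: borel_prod sets_borel_triple)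
    fix S assume "S \<in> triple_rectangles"
    then obtain A B C where S: "S = A \<times> (B \<times> C)" and s[measurable]: "A \<in> sets borel" "B \<in> sets borel" "C \<in> sets borel"
      unfolding triple_rectangles_def by blast
    have "emeasure (distr M borel (?T i)) S = emeasure M (?T i -` S \<inter> space M)"
      using \<open>S \<in> triple_rectangles\<close> sub by (intro emeasure_distr) auto
    also have "?T i -` S \<inter> space M = {\<omega>\<in>space M. X i \<omega> \<in> A \<and> Y i \<omega> \<in> B \<and> Z i \<omega> \<in> C}"
      using S by auto
    also have "emeasure M \<dots> = ennreal (prob (X i -` A \<inter> space M) * (prob (Y i -` B \<inter> space M) * prob (Z i -` C \<inter> space M)))"
      using one[OF s, of i] by (simp add: emeasure_eq_measure mult.assoc)
    also have "\<dots> = emeasure ?PX A * (emeasure ?PY B * emeasure ?PZ C)"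
      by (simp add: emeasure_distr emeasure_eq_measure ennreal_mult)
    also have "\<dots> = emeasure (?PX \<Otimes>\<^sub>M (?PY \<Otimes>\<^sub>M ?PZ)) S"
      unfolding S by (subst PYZ.emeasure_pair_measure_Times) (auto simp: PZ.emeasure_pair_measure_Times)
    finally show "emeasure (distr M borel (?T i)) S = emeasure (?PX \<Otimes>\<^sub>M (?PY \<Otimes>\<^sub>M ?PZ)) S" .
  next
    have "UNIV \<in> triple_rectangles"
      unfolding triple_rectangles_def by (auto intro!: exI[of _ UNIV])
    then show "range (\<lambda>_. UNIV) \<subseteq> triple_rectangles" by auto
    have "prob_space (distr M borel (?T i))" by (rule prob_space_distr) simp
    then show "emeasure (distr M borel (?T i)) UNIV \<noteq> \<infinity>"
      by (simp add: prob_space_def finite_measure.emeasure_eq_measure)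
  qed auto
qed

end

lemma indep_sequences3_factor:
  assumes "prob_space M" "indep_sequences3 M X Y Z"
    and S: "S1 \<in> sets (PiM UNIV (\<lambda>_. borel))" "S2 \<in> sets (PiM UNIV (\<lambda>_. borel))" "S3 \<in> sets (PiM UNIV (\<lambda>_. borel))"
  shows "measure M {\<omega>\<in>space M. (\<lambda>i. X i \<omega>) \<in> S1 \<and> (\<lambda>i. Y i \<omega>) \<in> S2 \<and> (\<lambda>i. Z i \<omega>) \<in> S3} =
    measure M {\<omega>\<in>space M. (\<lambda>i. X i \<omega>) \<in> S1} * measure M {\<omega>\<in>space M. (\<lambda>i. Y i \<omega>) \<in> S2} * measure M {\<omega>\<in>space M. (\<lambda>i. Z i \<omega>) \<in> S3}"
proof -
  interpret prob_space M by fact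
  let ?F = "\<lambda>k \<omega> i. ([X, Y, Z] ! k) i \<omega>" and ?S = "\<lambda>k. [S1, S2, S3] ! k"
  have three: "{..<3::nat} = {0, 1, 2}" by auto
  have "prob (\<Inter>k\<in>{..<3}. ?F k -` ?S k \<inter> space M) = (\<Prod>k\<in>{..<3}. prob (?F k -` ?S k \<inter> space M))"
    using assms(2) unfolding indep_sequences3_def
    by (rule indep_varsD_finite) (use S in \<open>auto simp: three\<close>)
  moreover have "(\<Inter>k\<in>{..<3}. ?F k -` ?S k \<inter> space M) = {\<omega>\<in>space M. (\<lambda>i. X i \<omega>) \<in> S1 \<and> (\<lambda>i. Y i \<omega>) \<in> S2 \<and> (\<lambda>i. Z i \<omega>) \<in> S3}"
    unfolding three by auto
  ultimately show ?thesis
    unfolding three by (simp add: vimage_def Int_def conj_commute mult.assoc)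
qed

definition block_index :: "real \<Rightarrow> nat" where
  "block_index v = (if 0 \<le> v then nat \<lfloor>v\<rfloor> else nat (- \<lfloor>v\<rfloor> - 1))"

lemma block_iff: "v \<in> block (Suc j) \<longleftrightarrow> j = block_index v"
proof (cases "0 \<le> v")
  case True
  then have "v \<in> block (Suc j) \<longleftrightarrow> real j \<le> v \<and> v < real j + 1" by (auto simp: block_def)
  also have "\<dots> \<longleftrightarrow> \<lfloor>v\<rfloor> = int j" by (auto simp: floor_eq_iff)
  also have "\<dots> \<longleftrightarrow> j = nat \<lfloor>v\<rfloor>" using True by auto
  finally show ?thesis using True by (simp add: block_index_def)
next
  case False
  then have "v \<in> block (Suc j) \<longleftrightarrow> - real j - 1 \<le> v \<and> v < - real j" by (auto simp: block_def)
  also have "\<dots> \<longleftrightarrow> \<lfloor>v\<rfloor> = - int j - 1" by (auto simp: floor_eq_iff)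
  also have "\<dots> \<longleftrightarrow> j = nat (- \<lfloor>v\<rfloor> - 1)" using False floor_less_zero[of v] by auto
  finally show ?thesis using False by (simp add: block_index_def)
qed

lemma block_measurable [measurable]: "block j \<in> sets borel"
  unfolding block_def by measurable

lemma suminf_over_blocks:
  fixes g :: "nat \<Rightarrow> real"
  shows "(\<Sum>j. g j * indicator (A \<inter> block (Suc j)) v) = g (block_index v) * indicator A v"
proof -
  have "(\<lambda>j. if j = block_index v then g j * indicator A v else 0) sums (g (block_index v) * indicator A v)"
    by (rule sums_single)
  moreover have "(\<lambda>j. if j = block_index v then g j * indicator A v else 0) = (\<lambda>j. g j * indicator (A \<inter> block (Suc j)) v)"
    by (auto simp: fun_eq_iff indicator_def block_iff)
  ultimately show ?thesis by (simp add: sums_iff)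
qed

lemma mhat_density_eq: "mhat_density v = 2 powr (- real (Suc (block_index v)) - 1)"
  using suminf_over_blocks[of "\<lambda>j. 2 powr (- real (Suc j) - 1)" UNIV v] by (simp add: mhat_density_def)

lemma mhat_density_pos: "0 < mhat_density v" by (simp add: mhat_density_eq)

lemma mhat_density_measurable [measurable]: "mhat_density \<in> borel_measurable borel"
  unfolding mhat_density_def[abs_def] by measurable

text \<open>
  The gaps are functions of the whole sequence of arrival times, so the independence of the three
  sequences, together with the independence within each, factorises rectangle probabilities.
\<close>

lemma marked_poisson_of_assumptions:
  assumes M: "prob_space M" and \<Gamma>: "unit_poisson_arrivals M \<Gamma>" and V: "iid_mhat M V" and \<gamma>: "iid_signs M \<gamma>"
    and ind: "indep_sequences3 M \<Gamma> V \<gamma>"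
  shows "marked_poisson M (arrival_gap \<Gamma>) V \<gamma> mhat_density"
proof -
  interpret prob_space M by fact
  let ?E = "arrival_gap \<Gamma>"
  have iE: "indep_vars (\<lambda>_. borel) ?E UNIV" and dE: "\<And>i. distributed M lborel (?E i) (exponential_density 1)"
    using \<Gamma> by (auto simp: unit_poisson_arrivals_def)
  have iV: "indep_vars (\<lambda>_. borel) V UNIV" and dV: "\<And>i. distributed M lborel (V i) mhat_density"
    using V by (auto simp: iid_mhat_def)
  have ig: "indep_vars (\<lambda>_. borel) \<gamma> UNIV" and sg: "\<And>i. prob {\<omega> \<in> space M. \<gamma> i \<omega> = 1} = 1 / 2" "\<And>i. prob {\<omega> \<in> space M. \<gamma> i \<omega> = - 1} = 1 / 2"
    using \<gamma> by (auto simp: iid_signs_def)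
  have Em[measurable]: "?E i \<in> borel_measurable M" for i using dE[of i] by (simp add: distributed_def)
  have Vm[measurable]: "V i \<in> borel_measurable M" for i using dV[of i] by (simp add: distributed_def)
  have gm[measurable]: "\<gamma> i \<in> borel_measurable M" for i using ig by (simp add: indep_vars_def)
  define gap where "gap x i = (case i of 0 \<Rightarrow> x 0 | Suc k \<Rightarrow> x (Suc k) - x k)" for x :: "nat \<Rightarrow> real" and i
  have gap: "gap (\<lambda>i. \<Gamma> i \<omega>) i = ?E i \<omega>" for \<omega> i by (simp add: gap_def arrival_gap_def)
  have gapm[measurable]: "(\<lambda>x. gap x i) \<in> borel_measurable (PiM UNIV (\<lambda>_. borel))" for i
    unfolding gap_def by (cases i) auto
  have fact: "prob {\<omega>\<in>space M. \<forall>i\<in>J. ?E i \<omega> \<in> A i \<and> V i \<omega> \<in> B i \<and> \<gamma> i \<omega> \<in> C i} =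
      (\<Prod>i\<in>J. prob (?E i -` A i \<inter> space M)) * (\<Prod>i\<in>J. prob (V i -` B i \<inter> space M)) * (\<Prod>i\<in>J. prob (\<gamma> i -` C i \<inter> space M))"
    if J: "finite J" "J \<noteq> {}" and A: "\<And>i. i \<in> J \<Longrightarrow> A i \<in> sets borel" and B: "\<And>i. i \<in> J \<Longrightarrow> B i \<in> sets borel"
      and C: "\<And>i. i \<in> J \<Longrightarrow> C i \<in> sets borel" for J A B C
  proof -
    let ?P = "PiM UNIV (\<lambda>_::nat. borel :: real measure)"
    let ?S1 = "{x\<in>space ?P. \<forall>i\<in>J. gap x i \<in> A i}" and ?S2 = "{x\<in>space ?P. \<forall>i\<in>J. x i \<in> B i}" and ?S3 = "{x\<in>space ?P. \<forall>i\<in>J. x i \<in> C i}"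
    have S1: "?S1 \<in> sets ?P"
      by (rule sets.sets_Collect_finite_All'[OF _ J]) (use A in measurable)
    have S2: "?S2 \<in> sets ?P" and S3: "?S3 \<in> sets ?P"
      by (rule sets.sets_Collect_finite_All'[OF _ J]; use B C in measurable)+
    have ev: "prob {\<omega>\<in>space M. \<forall>i\<in>J. U i \<omega> \<in> D i} = (\<Prod>i\<in>J. prob (U i -` D i \<inter> space M))"
      if "indep_vars (\<lambda>_. borel) U UNIV" "\<And>i. i \<in> J \<Longrightarrow> D i \<in> sets borel" for U :: "nat \<Rightarrow> 'a \<Rightarrow> real" and D
    proof -
      have "prob (\<Inter>i\<in>J. U i -` D i \<inter> space M) = (\<Prod>i\<in>J. prob (U i -` D i \<inter> space M))"
        by (rule indep_varsD[OF that(1)]) (use J that in auto)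
      moreover have "(\<Inter>i\<in>J. U i -` D i \<inter> space M) = {\<omega>\<in>space M. \<forall>i\<in>J. U i \<omega> \<in> D i}" using J by auto
      ultimately show ?thesis by simp
    qed
    have "prob {\<omega>\<in>space M. \<forall>i\<in>J. ?E i \<omega> \<in> A i \<and> V i \<omega> \<in> B i \<and> \<gamma> i \<omega> \<in> C i}
       = prob {\<omega>\<in>space M. (\<lambda>i. \<Gamma> i \<omega>) \<in> ?S1 \<and> (\<lambda>i. V i \<omega>) \<in> ?S2 \<and> (\<lambda>i. \<gamma> i \<omega>) \<in> ?S3}"
      by (intro arg_cong[where f=prob]) (auto simp: gap space_PiM)
    also have "\<dots> = prob {\<omega>\<in>space M. (\<lambda>i. \<Gamma> i \<omega>) \<in> ?S1} * prob {\<omega>\<in>space M. (\<lambda>i. V i \<omega>) \<in> ?S2} * prob {\<omega>\<in>space M. (\<lambda>i. \<gamma> i \<omega>) \<in> ?S3}"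
      by (rule indep_sequences3_factor[OF M ind S1 S2 S3])
    also have "\<dots> = prob {\<omega>\<in>space M. \<forall>i\<in>J. ?E i \<omega> \<in> A i} * prob {\<omega>\<in>space M. \<forall>i\<in>J. V i \<omega> \<in> B i} * prob {\<omega>\<in>space M. \<forall>i\<in>J. \<gamma> i \<omega> \<in> C i}"
      by (simp add: gap space_PiM)
    finally show ?thesis using ev[OF iE A] ev[OF iV B] ev[OF ig C] by simp
  qed
  have law: "distr M borel (?E i) = density lborel (exponential_density 1)" "distr M borel (V i) = density lborel mhat_density" for i
    using distributed_distr_eq_density[OF dE[of i]] distributed_distr_eq_density[OF dV[of i]]
    by (metis distr_cong sets_lborel)+
  show ?thesis
  proof (unfold_locales)
    show "indep_vars (\<lambda>_. borel) (\<lambda>i \<omega>. (?E i \<omega>, V i \<omega>, \<gamma> i \<omega>)) UNIV"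
      by (rule indep_vars_triples(1)[OF Em Vm gm fact])
    show "distr M borel (\<lambda>\<omega>. (?E i \<omega>, V i \<omega>, \<gamma> i \<omega>)) =
      density lborel (exponential_density 1) \<Otimes>\<^sub>M (density lborel mhat_density \<Otimes>\<^sub>M distr M borel (\<gamma> i))" for i
      unfolding law[of i, symmetric] by (rule indep_vars_triples(2)[OF Em Vm gm fact])
  qed (fact dE dV sg gm mhat_density_measurable mhat_density_pos)+
qed

section \<open>Convergence of finite-dimensional distributions\<close>

text \<open>
  A finite set of times is enumerated, so that continuous functions of the values at these times become
  continuous functions on sequences. On sequences, the Borel sets and the product \<open>\<sigma>\<close>-algebra agree.
\<close>

lemma fdd_convergesI:
  fixes X A :: "real \<Rightarrow> real \<Rightarrow> 'a \<Rightarrow> real" and Z :: "real \<Rightarrow> 'b \<Rightarrow> real"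
  assumes M: "prob_space M" and N: "prob_space N"
    and Xm: "\<And>r t. X r t \<in> borel_measurable M" and Am: "\<And>r t. A r t \<in> borel_measurable M"
    and Zm: "\<And>t. Z t \<in> borel_measurable N"
    and char: "eventually (\<lambda>r. \<forall>T \<xi>. finite T \<longrightarrow>
       (CLINT \<omega>|M. iexp (\<Sum>t\<in>T. \<xi> t * A r t \<omega>)) = (CLINT \<omega>|N. iexp (\<Sum>t\<in>T. \<xi> t * Z t \<omega>))) F"
    and small: "\<And>t e. e > 0 \<Longrightarrow> ((\<lambda>r. measure M {\<omega>\<in>space M. e \<le> \<bar>X r t \<omega> - A r t \<omega>\<bar>}) \<longlongrightarrow> 0) F"
  shows "fdd_converges M X F N Z"
  unfolding fdd_converges_def
proof (intro allI impI, elim conjE)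
  fix T :: "real set" and f :: "(real \<Rightarrow> real) \<Rightarrow> real"
  assume T: "finite T" and f: "continuous_map (product_topology (\<lambda>_. euclideanreal) T) euclideanreal f"
    and bdf: "bounded (f ` (T \<rightarrow>\<^sub>E UNIV))"
  obtain h where h: "bij_betw h {0..<card T} T" using ex_bij_betw_nat_finite[OF T] by blast
  define n where "n = card T"
  define idx where "idx = the_inv_into {0..<n} h"
  have hn: "bij_betw h {..<n} T" using h by (simp add: n_def atLeast0LessThan)
  have idx: "idx t < n" "h (idx t) = t" if "t \<in> T" for t
    using the_inv_into_into[of h "{0..<n}" t "{0..<n}"] f_the_inv_into_f_bij_betw[OF h, of t] h that
    by (auto simp: idx_def n_def bij_betw_def)
  define g where "g y = f (\<lambda>t\<in>T. y (idx t))" for y :: "nat \<Rightarrow> real"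
  obtain B where B: "\<And>x. x \<in> T \<rightarrow>\<^sub>E UNIV \<Longrightarrow> \<bar>f x\<bar> \<le> B"
    using bdf by (auto simp: bounded_iff)
  have lim: "((\<lambda>r. LINT \<omega>|M. g (\<lambda>i. (if i < n then X r (h i) \<omega> else 0))) \<longlongrightarrow> (LINT \<omega>|N. g (\<lambda>i. (if i < n then Z (h i) \<omega> else 0)))) F"
  proof (rule expectation_tendsto_of_small_perturbation[OF M N, where g=g and n=n and B=B and A="\<lambda>r i \<omega>. if i < n then A r (h i) \<omega> else 0"
      and X="\<lambda>r i \<omega>. if i < n then X r (h i) \<omega> else 0" and Z="\<lambda>i \<omega>. if i < n then Z (h i) \<omega> else 0"])
    have "continuous_map (product_topology (\<lambda>_. euclideanreal) UNIV) (product_topology (\<lambda>_. euclideanreal) T) (\<lambda>y. \<lambda>t\<in>T. y (idx t))"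
      unfolding continuous_map_componentwise
      by (auto intro!: continuous_map_product_projection)
    then have "continuous_map (product_topology (\<lambda>_. euclideanreal) UNIV) euclideanreal (f \<circ> (\<lambda>y. \<lambda>t\<in>T. y (idx t)))"
      using f by (rule continuous_map_compose)
    then have "continuous_map (euclidean :: (nat \<Rightarrow> real) topology) euclideanreal g"
      unfolding euclidean_product_topology by (simp add: g_def[abs_def] comp_def)
    then show "continuous_on UNIV g" by simp
    show "g x = g y" if "\<And>i. i < n \<Longrightarrow> x i = y i" for x y
      unfolding g_def using that idx by (intro arg_cong[where f=f]) (auto simp: fun_eq_iff restrict_def)
    show "\<bar>g x\<bar> \<le> B" for x unfolding g_def by (rule B) auto
    show "(\<lambda>\<omega>. if i < n then A r (h i) \<omega> else 0) \<in> borel_measurable M" "(\<lambda>\<omega>. if i < n then X r (h i) \<omega> else 0) \<in> borel_measurable M"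
      "(\<lambda>\<omega>. if i < n then Z (h i) \<omega> else 0) \<in> borel_measurable N" for r i
      using Am Xm Zm by auto
    show "((\<lambda>r. measure M {\<omega> \<in> space M. e \<le> \<bar>(if i < n then X r (h i) \<omega> else 0) - (if i < n then A r (h i) \<omega> else 0)\<bar>}) \<longlongrightarrow> 0) F"
      if "i < n" "e > 0" for i e
      using small[OF that(2), of "h i"] that(1) by simp
    from char show "eventually (\<lambda>r. distr M (PiM UNIV (\<lambda>_. borel)) (\<lambda>\<omega> i. (if i < n then A r (h i) \<omega> else 0)) =
       distr N (PiM UNIV (\<lambda>_. borel)) (\<lambda>\<omega> i. (if i < n then Z (h i) \<omega> else 0))) F"
    proof eventually_elim
      case (elim r)
      have re: "(\<Sum>i<n. \<xi> i * U (h i)) = (\<Sum>t\<in>T. \<xi> (idx t) * U t)" for \<xi> and U :: "real \<Rightarrow> real"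
        by (rule sum.reindex_bij_witness[where i=idx and j=h])
           (use idx hn bij_betwE[OF hn] in \<open>auto simp: idx_def n_def the_inv_into_f_f[OF bij_betw_imp_inj_on[OF h]]\<close>)
      have eq: "distr M (PiM {..<n} (\<lambda>_. borel)) (\<lambda>\<omega>. \<lambda>i\<in>{..<n}. A r (h i) \<omega>) = distr N (PiM {..<n} (\<lambda>_. borel)) (\<lambda>\<omega>. \<lambda>i\<in>{..<n}. Z (h i) \<omega>)"
      proof (rule distr_PiM_eq_of_char_eq[OF M N])
        fix \<xi> :: "nat \<Rightarrow> real"
        show "(CLINT \<omega>|M. iexp (\<Sum>i<n. \<xi> i * A r (h i) \<omega>)) = (CLINT \<omega>|N. iexp (\<Sum>i<n. \<xi> i * Z (h i) \<omega>))"
          using elim[rule_format, OF T, of "\<lambda>t. \<xi> (idx t)"]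
          by (simp only: re[of \<xi> "\<lambda>t. A r t \<omega>" for \<omega>] re[of \<xi> "\<lambda>t. Z t \<omega>" for \<omega>])
      qed (use Am Zm in auto)
      define k where "k x = (\<lambda>i. if i < n then x i else 0)" for x :: "nat \<Rightarrow> real"
      have km: "k \<in> measurable (PiM {..<n} (\<lambda>_. borel)) (PiM UNIV (\<lambda>_. borel))"
      proof (rule measurable_PiM_single')
        show "(\<lambda>x. k x i) \<in> borel_measurable (PiM {..<n} (\<lambda>_. borel))" for i
          by (cases "i < n") (auto simp: k_def intro!: measurable_component_singleton)
      qed (auto simp: space_PiM)
      have 1: "(\<lambda>\<omega>. \<lambda>i\<in>{..<n}. A r (h i) \<omega>) \<in> measurable M (PiM {..<n} (\<lambda>_. borel))"
        and 2: "(\<lambda>\<omega>. \<lambda>i\<in>{..<n}. Z (h i) \<omega>) \<in> measurable N (PiM {..<n} (\<lambda>_. borel))"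
        by (auto intro!: measurable_restrict Am Zm)
      have 3: "k \<circ> (\<lambda>\<omega>. \<lambda>i\<in>{..<n}. U i \<omega>) = (\<lambda>\<omega> i. if i < n then U i \<omega> else 0)" for U :: "nat \<Rightarrow> 'x \<Rightarrow> real"
        by (auto simp: k_def fun_eq_iff)
      from arg_cong[OF eq, of "\<lambda>D. distr D (PiM UNIV (\<lambda>_. borel)) k"]
      show ?case unfolding distr_distr[OF km 1] distr_distr[OF km 2] 3 .
    qed
  qed
  have gX: "g (\<lambda>i. if i < n then U (h i) else 0) = f (restrict U T)" for U
    unfolding g_def using idx by (intro arg_cong[where f=f]) (auto simp: fun_eq_iff restrict_def)
  show "((\<lambda>r. LINT \<omega>|M. f (\<lambda>t\<in>T. X r t \<omega>)) \<longlongrightarrow> (LINT \<omega>|N. f (\<lambda>t\<in>T. Z t \<omega>))) F"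
    using lim by (simp only: gX[of "\<lambda>t. X r t \<omega>" for r \<omega>] gX[of "\<lambda>t. Z t \<omega>" for \<omega>])
qed

text \<open>
  The mark lies in exactly one block, whose weight is a power of the density at the mark.
\<close>

lemma series_process_eq_mark_sum:
  assumes M: "prob_space M" and \<Gamma>: "unit_poisson_arrivals M \<Gamma>" and V: "iid_mhat M V" and \<gamma>: "iid_signs M \<gamma>"
    and ind: "indep_sequences3 M \<Gamma> V \<gamma>"
  shows "series_process lam \<alpha> b \<Gamma> V \<gamma> t \<omega> =
    amplitude \<alpha> b t * marked_poisson.mark_sum (arrival_gap \<Gamma>) V \<gamma> mhat_density (marked_poisson.stable_kernel (1 / \<alpha> t) (ou_kernel lam t)) \<omega>"
proof -
  interpret P: marked_poisson M "arrival_gap \<Gamma>" V \<gamma> mhat_density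
    by (rule marked_poisson_of_assumptions[OF assms])
  have arr: "P.arrival (Suc i) \<omega> = \<Gamma> i \<omega>" for i \<omega>
    unfolding P.arrival_def by (induction i) (simp_all add: arrival_gap_def)
  have "(\<Sum>j. \<gamma> i \<omega> * \<Gamma> i \<omega> powr (- 1 / \<alpha> t) * 2 powr ((real (Suc j) + 1) / \<alpha> t) *
      exp (- lam * (V i \<omega> - t)) * indicator ({t..} \<inter> block (Suc j)) (V i \<omega>)) =
      P.mark_sum_term (P.stable_kernel (1 / \<alpha> t) (ou_kernel lam t)) i \<omega>" for i
  proof -
    let ?J = "block_index (V i \<omega>)"
    have "(- a - 1) * (- (1 / c)) = (a + 1) / c" for a c :: real
      by (cases "c = 0") (simp_all add: field_simps)
    then have m: "mhat_density (V i \<omega>) powr (- (1 / \<alpha> t)) = 2 powr ((real (Suc ?J) + 1) / \<alpha> t)"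
      unfolding mhat_density_eq powr_powr by (simp only:)
    have "(\<Gamma> i \<omega> * mhat_density (V i \<omega>)) powr (- (1 / \<alpha> t)) = \<Gamma> i \<omega> powr (- (1 / \<alpha> t)) * 2 powr ((real (Suc ?J) + 1) / \<alpha> t)"
      by (simp only: powr_mult m)
    then show ?thesis
      unfolding suminf_over_blocks P.mark_sum_term_def P.stable_kernel_def ou_kernel_def P.point_def arr
      by (simp add: mult_ac)
  qed
  then show ?thesis
    unfolding series_process_def P.mark_sum_def amplitude_def by simp
qed

lemma sas_linear:
  assumes "sas_random_measure N a I" "f \<in> L_space a" "g \<in> L_space a"
  shows "AE \<omega> in N. I (\<lambda>x. p * f x + q * g x) \<omega> = p * I f \<omega> + q * I g \<omega>"
  using assms unfolding sas_random_measure_def by blast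

text \<open>
  The empty sum is covered by the linearity with both scalars zero.
\<close>

lemma sas_integral_sum:
  assumes S: "sas_random_measure N a I" and a: "0 < a" and T: "finite T" and f: "\<And>t. t \<in> T \<Longrightarrow> f t \<in> L_space a"
  shows "AE \<omega> in N. I (\<lambda>x. \<Sum>t\<in>T. \<xi> t * f t x) \<omega> = (\<Sum>t\<in>T. \<xi> t * I (f t) \<omega>)"
  using T f
proof (induction T rule: finite_induct)
  case empty
  have z: "(\<lambda>_. 0) \<in> L_space a" using a by (simp add: L_space_def)
  have "AE \<omega> in N. I (\<lambda>x. 0 * 0 + 0 * 0) \<omega> = 0 * I (\<lambda>_. 0) \<omega> + 0 * I (\<lambda>_. 0) \<omega>"
    by (rule sas_linear[OF S z z])
  then show ?case by simp
next
  case (insert t T)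
  have "(\<lambda>x. \<Sum>t\<in>T. \<xi> t * f t x) \<in> L_space a" by (rule L_space_sum[OF a]) (use insert in auto)
  moreover have "f t \<in> L_space a" using insert by simp
  ultimately have "AE \<omega> in N. I (\<lambda>x. \<xi> t * f t x + 1 * (\<Sum>t\<in>T. \<xi> t * f t x)) \<omega> = \<xi> t * I (f t) \<omega> + 1 * I (\<lambda>x. \<Sum>t\<in>T. \<xi> t * f t x) \<omega>"
    by (intro sas_linear[OF S])
  moreover have "AE \<omega> in N. I (\<lambda>x. \<Sum>t\<in>T. \<xi> t * f t x) \<omega> = (\<Sum>t\<in>T. \<xi> t * I (f t) \<omega>)" using insert by simp
  ultimately show ?case
    by eventually_elim (use insert in simp)
qed

definition levy_kernel :: "real \<Rightarrow> real \<Rightarrow> real" where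
  "levy_kernel t x = (if 0 \<le> t then indicator {0..t} x else - indicator {t..0} x)"

text \<open>
  The change of the jump of the kernel between the times \<open>0\<close> and \<open>t\<close>. Up to null sets it is minus the
  integrand of Levy motion at \<open>t\<close>; symmetry makes the sign immaterial.
\<close>

definition step_kernel :: "real \<Rightarrow> real \<Rightarrow> real" where
  "step_kernel t x = indicator {t..} x - indicator {0..} x"

lemma step_kernel_L_space: "step_kernel t \<in> L_space a"
proof (cases "0 \<le> t")
  case True
  have "indicator {0..<t} \<in> L_space a" by (rule L_space_indicator) (use True in auto)
  moreover have "step_kernel t x = - indicator {0..<t} x" for x using True by (auto simp: step_kernel_def indicator_def)
  ultimately show ?thesis by (simp add: L_space_def fun_Compl_def cong: measurable_cong)
next
  case False
  have "indicator {t..<0} \<in> L_space a" by (rule L_space_indicator) (use False in auto)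
  moreover have "step_kernel t = indicator {t..<0}" using False by (auto simp: step_kernel_def indicator_def fun_eq_iff)
  ultimately show ?thesis by simp
qed

lemma levy_kernel_L_space: "levy_kernel t \<in> L_space a"
proof (cases "0 \<le> t")
  case True
  have "indicator {0..t} \<in> L_space a" by (rule L_space_indicator) (use True in auto)
  moreover have "levy_kernel t = indicator {0..t}" using True by (auto simp: levy_kernel_def fun_eq_iff)
  ultimately show ?thesis by simp
next
  case False
  have "indicator {t..0} \<in> L_space a" by (rule L_space_indicator) (use False in auto)
  moreover have "levy_kernel t x = - indicator {t..0} x" for x using False by (auto simp: levy_kernel_def)
  ultimately show ?thesis by (simp add: L_space_def fun_Compl_def cong: measurable_cong)
qed

lemma levy_kernel_eq_neg_step_kernel: "x \<noteq> 0 \<Longrightarrow> x \<noteq> t \<Longrightarrow> levy_kernel t x = - step_kernel t x"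
  by (auto simp: levy_kernel_def step_kernel_def indicator_def)

lemma levy_motion_AE_eq:
  assumes S: "sas_random_measure N a I"
  shows "AE \<omega> in N. levy_motion I t \<omega> = I (levy_kernel t) \<omega>"
proof (cases "0 \<le> t")
  case True
  then have "levy_kernel t = indicator {0..t}" by (auto simp: levy_kernel_def fun_eq_iff)
  then show ?thesis using True by (simp add: levy_motion_def)
next
  case False
  have L: "indicator {t..0} \<in> L_space a" by (rule L_space_indicator) (use False in auto)
  have "AE \<omega> in N. I (\<lambda>x. (- 1) * indicator {t..0} x + 0 * indicator {t..0} x) \<omega> = (- 1) * I (indicator {t..0}) \<omega> + 0 * I (indicator {t..0}) \<omega>"
    by (rule sas_linear[OF S L L])
  moreover have "(\<lambda>x. (- 1) * indicator {t..0} x + 0 * indicator {t..0} x) = levy_kernel t"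
    using False by (auto simp: levy_kernel_def fun_eq_iff)
  ultimately show ?thesis using False by (auto simp: levy_motion_def elim!: eventually_mono)
qed

lemma sas_char:
  assumes S: "sas_random_measure N a I" and f: "f \<in> L_space a"
  shows "(CLINT \<omega>|N. iexp (\<theta> * I f \<omega>)) = of_real (exp (- (\<bar>\<theta>\<bar> powr a) * (LINT x|lborel. \<bar>f x\<bar> powr a)))"
proof -
  have m: "I f \<in> borel_measurable N" and c: "char (distr N borel (I f)) \<theta> = of_real (exp (- (\<bar>\<theta>\<bar> powr a) * (LINT x|lborel. \<bar>f x\<bar> powr a)))"
    using S f unfolding sas_random_measure_def by blast+
  have "char (distr N borel (I f)) \<theta> = (CLINT \<omega>|N. iexp (\<theta> * I f \<omega>))"
    unfolding char_def by (rule integral_distr) (use m in auto)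
  then show ?thesis using c by simp
qed

lemma levy_motion_measurable:
  assumes S: "sas_random_measure N a I" shows "levy_motion I t \<in> borel_measurable N"
proof -
  have "I (indicator {0..t}) \<in> borel_measurable N" "I (indicator {t..0}) \<in> borel_measurable N"
    using S L_space_indicator[of "{0..t}" a] L_space_indicator[of "{t..0}" a] unfolding sas_random_measure_def
    by (auto simp: emeasure_lborel_Icc_eq)
  then show ?thesis unfolding levy_motion_def[abs_def] by auto
qed

text \<open>
  Stated with the kernels \<open>step_kernel\<close>, so that the formula can be compared with that of the main term.
\<close>

lemma levy_motion_joint_char:
  assumes S: "sas_random_measure N a I" and a: "0 < a" and T: "finite T" and b: "0 < b"
  shows "(CLINT \<omega>|N. iexp (\<Sum>t\<in>T. \<xi> t * (b * levy_motion I t \<omega>))) =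
     of_real (exp (- (b powr a * (LINT x|lborel. \<bar>\<Sum>t\<in>T. \<xi> t * step_kernel t x\<bar> powr a))))"
proof -
  let ?f = "\<lambda>x. \<Sum>t\<in>T. \<xi> t * levy_kernel t x"
  have fL: "?f \<in> L_space a" by (rule L_space_sum[OF a T]) (rule levy_kernel_L_space)
  have "AE \<omega> in N. \<forall>t\<in>T. levy_motion I t \<omega> = I (levy_kernel t) \<omega>"
    using levy_motion_AE_eq[OF S] T by (simp add: AE_finite_all)
  moreover have "AE \<omega> in N. I ?f \<omega> = (\<Sum>t\<in>T. \<xi> t * I (levy_kernel t) \<omega>)"
    by (rule sas_integral_sum[OF S a T]) (rule levy_kernel_L_space)
  ultimately have ae: "AE \<omega> in N. (\<Sum>t\<in>T. \<xi> t * (b * levy_motion I t \<omega>)) = b * I ?f \<omega>"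
    by eventually_elim (simp add: sum_distrib_left mult_ac)
  have [measurable]: "I ?f \<in> borel_measurable N" using S fL unfolding sas_random_measure_def by blast
  have [measurable]: "levy_motion I t \<in> borel_measurable N" for t by (rule levy_motion_measurable[OF S])
  have "(CLINT \<omega>|N. iexp (\<Sum>t\<in>T. \<xi> t * (b * levy_motion I t \<omega>))) = (CLINT \<omega>|N. iexp (b * I ?f \<omega>))"
  proof (rule integral_cong_AE)
    show "AE \<omega> in N. iexp (\<Sum>t\<in>T. \<xi> t * (b * levy_motion I t \<omega>)) = iexp (b * I ?f \<omega>)"
      using ae by eventually_elim (simp only:)
  qed measurable
  also have "\<dots> = of_real (exp (- (\<bar>b\<bar> powr a) * (LINT x|lborel. \<bar>?f x\<bar> powr a)))"
    by (rule sas_char[OF S fL])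
  also have "(LINT x|lborel. \<bar>?f x\<bar> powr a) = (LINT x|lborel. \<bar>\<Sum>t\<in>T. \<xi> t * step_kernel t x\<bar> powr a)"
  proof (rule integral_cong_AE)
    have "AE x in lborel. x \<notin> insert 0 T"
      using T by (intro AE_not_in finite_imp_null_set_lborel) auto
    then show "AE x in lborel. \<bar>?f x\<bar> powr a = \<bar>\<Sum>t\<in>T. \<xi> t * step_kernel t x\<bar> powr a"
    proof eventually_elim
      case (elim x)
      then have "levy_kernel t x = - step_kernel t x" if "t \<in> T" for t using that by (intro levy_kernel_eq_neg_step_kernel) auto
      then have "?f x = - (\<Sum>t\<in>T. \<xi> t * step_kernel t x)" by (simp add: sum_negf)
      then show ?case by simp
    qed
    show "(\<lambda>x. \<bar>?f x\<bar> powr a) \<in> borel_measurable lborel" using fL by (auto simp: L_space_def)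
    have "(\<lambda>x. \<Sum>t\<in>T. \<xi> t * step_kernel t x) \<in> L_space a" by (rule L_space_sum[OF a T]) (rule step_kernel_L_space)
    then show "(\<lambda>x. \<bar>\<Sum>t\<in>T. \<xi> t * step_kernel t x\<bar> powr a) \<in> borel_measurable lborel" by (auto simp: L_space_def)
  qed
  finally show ?thesis using b by simp
qed

section \<open>The local form\<close>

lemma L_space_affine:
  assumes f: "f \<in> L_space a" and r: "r \<noteq> 0"
  shows "(\<lambda>v. f ((v - u) / r)) \<in> L_space a"
proof -
  have [measurable]: "f \<in> borel_measurable borel" using f by (simp add: L_space_def)
  have e: "(v - u) / r = - u / r + (1 / r) * v" for v by (simp add: diff_divide_distrib)
  have "integrable lborel (\<lambda>v. \<bar>f (- u / r + (1 / r) * v)\<bar> powr a)"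
    using lborel_integrable_real_affine[of "\<lambda>x. \<bar>f x\<bar> powr a" "1 / r" "- u / r"] f r by (simp add: L_space_def)
  then show ?thesis unfolding L_space_def e by simp
qed

lemma L_space_cmult:
  assumes "0 < a" "f \<in> L_space a" shows "(\<lambda>v. c * f v) \<in> L_space a"
  using L_space_linear[OF assms(1,2,2), of c 0] by simp

context marked_poisson
begin

lemma mark_sum_sum:
  assumes T: "finite T"
    and D: "\<And>t. t \<in> T \<Longrightarrow> case_prod (D t) \<in> borel_measurable (borel \<Otimes>\<^sub>M borel)" "\<And>t. t \<in> T \<Longrightarrow> energy (D t) < \<infinity>"
  shows "AE \<omega> in M. mark_sum (\<lambda>y v. \<Sum>t\<in>T. \<xi> t * D t y v) \<omega> = (\<Sum>t\<in>T. \<xi> t * mark_sum (D t) \<omega>)"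
proof -
  have "AE \<omega> in M. \<forall>t\<in>T. summable (\<lambda>i. mark_sum_term (D t) i \<omega>)"
    using mark_sum_AE_summable D T by (simp add: AE_finite_all)
  then show ?thesis
  proof eventually_elim
    case (elim \<omega>)
    have "mark_sum_term (\<lambda>y v. \<Sum>t\<in>T. \<xi> t * D t y v) i \<omega> = (\<Sum>t\<in>T. \<xi> t * mark_sum_term (D t) i \<omega>)" for i
      by (simp add: mark_sum_term_def sum_distrib_left mult_ac)
    then have "mark_sum (\<lambda>y v. \<Sum>t\<in>T. \<xi> t * D t y v) \<omega> = (\<Sum>t\<in>T. \<Sum>i. \<xi> t * mark_sum_term (D t) i \<omega>)"
      unfolding mark_sum_def using elim by (simp add: suminf_sum summable_mult)
    also have "\<dots> = (\<Sum>t\<in>T. \<xi> t * mark_sum (D t) \<omega>)"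
      unfolding mark_sum_def using elim by (intro sum.cong refl suminf_mult) auto
    finally show ?case .
  qed
qed

text \<open>
  With \<open>B = B(u)\<close>, the part of the rescaled increment that has the law of the limit.
\<close>

definition main_term :: "real \<Rightarrow> real \<Rightarrow> real \<Rightarrow> real \<Rightarrow> real \<Rightarrow> 'a \<Rightarrow> real" where
  "main_term a B u r t = mark_sum (stable_kernel (1 / a) (\<lambda>v. B * r powr (- (1 / a)) * step_kernel t ((v - u) / r)))"

lemma step_kernel_measurable [measurable]: "step_kernel t \<in> borel_measurable borel"
  using step_kernel_L_space[of t 1] by (simp add: L_space_def)

lemma main_term_measurable [measurable]: "main_term a B u r t \<in> borel_measurable M"
  unfolding main_term_def by measurable

text \<open>
  Substituting \<open>v = u + r x\<close> produces a factor \<open>r\<close> that cancels the \<open>a\<close>-th power of \<open>r powr (-1/a)\<close>: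
  the result does not depend on \<open>r\<close>.
\<close>

lemma main_term_char:
  assumes a: "1 < a" "a < 2" and r: "0 < r" and T: "finite T" and B: "0 \<le> B"
  shows "(CLINT \<omega>|M. iexp (\<Sum>t\<in>T. \<xi> t * main_term a B u r t \<omega>)) =
    of_real (exp (- (sine_moment a * B powr a * (LINT x|lborel. \<bar>\<Sum>t\<in>T. \<xi> t * step_kernel t x\<bar> powr a))))"
proof -
  have a0: "0 < a" using a by simp
  let ?c = "B * r powr (- (1 / a))"
  let ?k = "\<lambda>t v. ?c * step_kernel t ((v - u) / r)"
  let ?f = "\<lambda>v. \<Sum>t\<in>T. \<xi> t * ?k t v"
  have kL: "?k t \<in> L_space a" for t
    by (intro L_space_cmult a0 L_space_affine step_kernel_L_space) (use r in simp)
  have fL: "?f \<in> L_space a" by (rule L_space_sum[OF a0 T kL])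
  have p: "1 / 2 < 1 / a" "1 / a < 1" using a by (simp_all add: field_simps)
  have fin: "energy (stable_kernel (1 / a) (?k t)) < \<infinity>" for t
    by (rule energy_stable_kernel_finite[OF p]) (use kL in simp)
  have "AE \<omega> in M. mark_sum (\<lambda>y v. \<Sum>t\<in>T. \<xi> t * stable_kernel (1 / a) (?k t) y v) \<omega> = (\<Sum>t\<in>T. \<xi> t * mark_sum (stable_kernel (1 / a) (?k t)) \<omega>)"
    by (rule mark_sum_sum[OF T _ fin]) measurable
  moreover have "(\<lambda>y v. \<Sum>t\<in>T. \<xi> t * stable_kernel (1 / a) (?k t) y v) = stable_kernel (1 / a) ?f"
    by (simp add: stable_kernel_def fun_eq_iff sum_distrib_right mult.assoc)
  ultimately have ae: "AE \<omega> in M. (\<Sum>t\<in>T. \<xi> t * main_term a B u r t \<omega>) = mark_sum (stable_kernel (1 / a) ?f) \<omega>"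
    unfolding main_term_def by (auto elim!: eventually_mono)
  have [measurable]: "?f \<in> borel_measurable borel" using fL by (simp add: L_space_def)
  have "(CLINT \<omega>|M. iexp (\<Sum>t\<in>T. \<xi> t * main_term a B u r t \<omega>)) = (CLINT \<omega>|M. iexp (mark_sum (stable_kernel (1 / a) ?f) \<omega>))"
  proof (rule integral_cong_AE)
    show "AE \<omega> in M. iexp (\<Sum>t\<in>T. \<xi> t * main_term a B u r t \<omega>) = iexp (mark_sum (stable_kernel (1 / a) ?f) \<omega>)"
      using ae by eventually_elim (simp only:)
  qed measurable
  also have "\<dots> = of_real (exp (- (sine_moment a * (LINT v|lborel. \<bar>?f v\<bar> powr a))))"
    by (rule stable_char[OF a fL])
  also have "(LINT v|lborel. \<bar>?f v\<bar> powr a) = B powr a * (LINT x|lborel. \<bar>\<Sum>t\<in>T. \<xi> t * step_kernel t x\<bar> powr a)"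
  proof -
    have e: "\<bar>?f (u + r * x)\<bar> powr a = (B powr a * (1 / r)) * \<bar>\<Sum>t\<in>T. \<xi> t * step_kernel t x\<bar> powr a" for x
    proof -
      have "?f (u + r * x) = ?c * (\<Sum>t\<in>T. \<xi> t * step_kernel t x)"
        using r by (simp add: sum_distrib_left mult_ac)
      moreover have "?c powr a = B powr a * (1 / r)"
      proof -
        have "- (1 / a) * a = - 1" using a0 by simp
        then have "?c powr a = B powr a * r powr (- 1)" by (simp only: powr_mult powr_powr)
        then show ?thesis using r by (simp add: powr_minus_divide)
      qed
      ultimately show ?thesis using B by (simp add: abs_mult powr_mult)
    qed
    have "(LINT v|lborel. \<bar>?f v\<bar> powr a) = \<bar>r\<bar> *\<^sub>R (LINT x|lborel. \<bar>?f (u + r * x)\<bar> powr a)"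
      by (rule lborel_integral_real_affine) (use r in simp)
    then show ?thesis unfolding e using r by simp
  qed
  finally show ?thesis by (simp add: mult.assoc)
qed

text \<open>
  By \<open>increment_remainder_bound\<close>, the kernel of the remainder is dominated by \<open>\<kappa>(r)\<close> times two stable
  kernels with exponents in \<open>(1/2,1)\<close>, where \<open>\<kappa>(r)\<close> is a multiple of \<open>r powr (1 - 1/\<alpha>(u))\<close>. The energy of
  these is a combination of positive powers of \<open>\<kappa>(r)\<close>.
\<close>

lemma remainder_tendsto_0:
  fixes lam c d u :: real and \<alpha> b :: "real \<Rightarrow> real"
  assumes lam: "0 < lam" and cd: "1 < c" "d < 2" "\<And>t. \<alpha> t \<in> {c..d}" and b: "\<And>t. 0 < b t"
    and \<alpha>': "(\<alpha> has_real_derivative a') (at u)" and b': "(b has_real_derivative b') (at u)" and e: "0 < e"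
  defines "Y \<equiv> \<lambda>s \<omega>. amplitude \<alpha> b s * mark_sum (stable_kernel (1 / \<alpha> s) (ou_kernel lam s)) \<omega>"
  shows "((\<lambda>r. prob {\<omega>\<in>space M. e \<le> \<bar>r powr (- (1 / \<alpha> u)) * (Y (u + r * t) \<omega> - Y u \<omega>) - main_term (\<alpha> u) (amplitude \<alpha> b u) u r t \<omega>\<bar>}) \<longlongrightarrow> 0) (at_right 0)"
proof -
  let ?a = "\<alpha> u" and ?B = "amplitude \<alpha> b"
  have ab: "1 < \<alpha> s" "\<alpha> s < 2" "0 < \<alpha> s" for s using cd(1,2) cd(3)[of s] by auto
  have cd': "c \<le> d" using cd(3)[of u] by auto
  \<comment> \<open>Both exponents stay inside \<open>(1/2,1)\<close>, where the energy of stable kernels is finite.\<close>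
  define \<eta> where "\<eta> = min (1 / d - 1 / 2) (1 - 1 / c) / 2"
  have h1: "0 < 1 / d - 1 / 2" "0 < 1 - 1 / c" "1 / d \<le> 1 / c"
    using cd(1,2) cd' by (simp_all add: field_simps)
  have \<eta>: "0 < \<eta>" "\<eta> < 1 / d - 1 / 2" "\<eta> < 1 - 1 / c" using h1 by (auto simp: \<eta>_def min_def)
  define P where "P = 1 / c + \<eta>"
  define Q where "Q = 1 / d - \<eta>"
  have P: "1 / 2 < P" "P < 1" and Q: "1 / 2 < Q" "Q < 1" using h1 \<eta> by (auto simp: P_def Q_def)
  obtain C \<delta> where C: "0 \<le> C" "0 < \<delta>"
    "\<And>s y v. \<bar>s - u\<bar> < \<delta> \<Longrightarrow> 0 < y \<Longrightarrow>
      \<bar>(?B s * y powr (- (1 / \<alpha> s)) * ou_kernel lam s v - ?B u * y powr (- (1 / \<alpha> u)) * ou_kernel lam u v)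
        - ?B u * y powr (- (1 / \<alpha> u)) * (indicator {s..} v - indicator {u..} v)\<bar>
      \<le> C * \<bar>s - u\<bar> * ((y powr (- P) + y powr (- Q)) * (exp (- lam * (v - u)) * indicator {u - 1..} v))"
    using increment_remainder_bound[OF lam cd b \<alpha>' b' \<eta>(1)] unfolding P_def Q_def by blast
  define F where "F v = exp (- lam * (v - u)) * indicator {u - 1..} v" for v
  have F0: "0 \<le> F v" for v by (simp add: F_def)
  have FL: "F \<in> L_space p" if "0 < p" for p
    using truncated_exponential_L_space[OF that lam, of 1 u "u - 1"] by (simp add: F_def[abs_def])
  have [measurable]: "F \<in> borel_measurable borel" using FL[of 1] by (simp add: L_space_def)
  have [measurable]: "ou_kernel lam s \<in> borel_measurable borel" for s unfolding ou_kernel_def[abs_def] by measurable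
  obtain KP where KP: "0 \<le> KP" "\<And>c f. f \<in> L_space (1 / P) \<Longrightarrow>
    energy (stable_kernel P (\<lambda>v. c * f v)) = ennreal (KP * \<bar>c\<bar> powr (1 / P) * (LINT v|lborel. \<bar>f v\<bar> powr (1 / P)))"
    using energy_stable_kernel[OF P] by blast
  obtain KQ where KQ: "0 \<le> KQ" "\<And>c f. f \<in> L_space (1 / Q) \<Longrightarrow>
    energy (stable_kernel Q (\<lambda>v. c * f v)) = ennreal (KQ * \<bar>c\<bar> powr (1 / Q) * (LINT v|lborel. \<bar>f v\<bar> powr (1 / Q)))"
    using energy_stable_kernel[OF Q] by blast
  define \<kappa> where "\<kappa> r = C * \<bar>t\<bar> * r powr (1 - 1 / ?a)" for r
  have \<kappa>0: "0 \<le> \<kappa> r" for r using C(1) by (simp add: \<kappa>_def)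
  define IP where "IP = (LINT v|lborel. \<bar>F v\<bar> powr (1 / P))"
  define IQ where "IQ = (LINT v|lborel. \<bar>F v\<bar> powr (1 / Q))"
  have I0: "0 \<le> IP" "0 \<le> IQ" unfolding IP_def IQ_def by (auto intro!: integral_nonneg_AE)
  define G where "G r = 4 * (KP * \<kappa> r powr (1 / P) * IP + KQ * \<kappa> r powr (1 / Q) * IQ)" for r
  have bound: "prob {\<omega>\<in>space M. e \<le> \<bar>r powr (- (1 / ?a)) * (Y (u + r * t) \<omega> - Y u \<omega>) - main_term ?a (?B u) u r t \<omega>\<bar>}
     \<le> G r * (1 + 1 / (e / 2)\<^sup>2)" if r: "0 < r" "\<bar>r * t\<bar> < \<delta>" for r
  proof -
    define s where "s = u + r * t"
    let ?q = "r powr (- (1 / ?a))"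
    let ?g = "\<lambda>v. ?B u * ?q * step_kernel t ((v - u) / r)"
    let ?K1 = "stable_kernel (1 / \<alpha> s) (ou_kernel lam s)" and ?K2 = "stable_kernel (1 / ?a) (ou_kernel lam u)"
      and ?K3 = "stable_kernel (1 / ?a) ?g"
    define D where "D y v = (?q * ?B s) * ?K1 y v + (- ?q * ?B u) * ?K2 y v + (- 1) * ?K3 y v" for y v
    have ouL: "ou_kernel lam w \<in> L_space p" if "0 < p" for w p
      using truncated_exponential_L_space[OF that lam, of 1 w w] by (simp add: ou_kernel_def[abs_def])
    have half: "1 / 2 < 1 / \<alpha> w" "1 / \<alpha> w < 1" for w using ab[of w] by (simp_all add: field_simps)
    have e1: "energy ?K1 < \<infinity>" and e2: "energy ?K2 < \<infinity>"
      by (intro energy_stable_kernel_finite half ouL; use ab in simp)+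
    have e3: "energy ?K3 < \<infinity>"
      using ab r by (intro energy_stable_kernel_finite half L_space_cmult L_space_affine step_kernel_L_space) auto
    have Dmeas[measurable]: "case_prod D \<in> borel_measurable (borel \<Otimes>\<^sub>M borel)"
    proof -
      have "(\<lambda>z. (?q * ?B s) * case_prod ?K1 z + (- ?q * ?B u) * case_prod ?K2 z + (- 1) * case_prod ?K3 z) \<in> borel_measurable (borel \<Otimes>\<^sub>M borel)"
        by measurable
      then show ?thesis by (simp add: D_def case_prod_beta')
    qed
    have "AE \<omega> in M. summable (\<lambda>i. mark_sum_term ?K1 i \<omega>)" "AE \<omega> in M. summable (\<lambda>i. mark_sum_term ?K2 i \<omega>)"
      "AE \<omega> in M. summable (\<lambda>i. mark_sum_term ?K3 i \<omega>)"
      by (rule mark_sum_AE_summable[OF _ e1] mark_sum_AE_summable[OF _ e2] mark_sum_AE_summable[OF _ e3]; measurable)+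
    then have ae: "AE \<omega> in M. ?q * (Y s \<omega> - Y u \<omega>) - main_term ?a (?B u) u r t \<omega> = mark_sum D \<omega>"
    proof eventually_elim
      case (elim \<omega>)
      have "mark_sum_term D i \<omega> = (?q * ?B s) * mark_sum_term ?K1 i \<omega> + (- ?q * ?B u) * mark_sum_term ?K2 i \<omega> + (- 1) * mark_sum_term ?K3 i \<omega>" for i
        by (simp add: mark_sum_term_def D_def algebra_simps)
      moreover have "(\<lambda>i. (?q * ?B s) * mark_sum_term ?K1 i \<omega> + (- ?q * ?B u) * mark_sum_term ?K2 i \<omega> + (- 1) * mark_sum_term ?K3 i \<omega>)
          sums ((?q * ?B s) * mark_sum ?K1 \<omega> + (- ?q * ?B u) * mark_sum ?K2 \<omega> + (- 1) * mark_sum ?K3 \<omega>)"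
        unfolding mark_sum_def by (intro sums_add sums_mult summable_sums elim)
      ultimately have "mark_sum D \<omega> = (?q * ?B s) * mark_sum ?K1 \<omega> + (- ?q * ?B u) * mark_sum ?K2 \<omega> + (- 1) * mark_sum ?K3 \<omega>"
        unfolding mark_sum_def[of D] by (simp only: sums_iff)
      then show ?case by (simp add: Y_def main_term_def algebra_simps)
    qed
    have le: "energy D \<le> energy (\<lambda>y v. stable_kernel P (\<lambda>v. \<kappa> r * F v) y v + stable_kernel Q (\<lambda>v. \<kappa> r * F v) y v)"
    proof (rule energy_mono)
      fix y v :: real assume y: "0 < y"
      have st: "step_kernel t ((v - u) / r) = indicator {s..} v - indicator {u..} v"
        using r by (auto simp: step_kernel_def indicator_def s_def field_simps)
      have "D y v = ?q * ((?B s * y powr (- (1 / \<alpha> s)) * ou_kernel lam s v - ?B u * y powr (- (1 / \<alpha> u)) * ou_kernel lam u v)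
        - ?B u * y powr (- (1 / \<alpha> u)) * (indicator {s..} v - indicator {u..} v))"
        unfolding D_def stable_kernel_def st by (simp add: algebra_simps)
      then have "\<bar>D y v\<bar> \<le> ?q * (C * \<bar>s - u\<bar> * ((y powr (- P) + y powr (- Q)) * F v))"
        using C(3)[of s y v] y r by (simp add: abs_mult F_def s_def mult_left_mono)
      also have "\<dots> = (C * \<bar>t\<bar> * (?q * r)) * ((y powr (- P) + y powr (- Q)) * F v)"
        using r by (simp add: s_def abs_mult mult_ac)
      also have "?q * r = r powr (1 - 1 / ?a)"
        using r by (simp add: powr_diff powr_minus field_simps)
      also have "(C * \<bar>t\<bar> * r powr (1 - 1 / ?a)) * ((y powr (- P) + y powr (- Q)) * F v)
         = stable_kernel P (\<lambda>v. \<kappa> r * F v) y v + stable_kernel Q (\<lambda>v. \<kappa> r * F v) y v"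
        by (simp add: stable_kernel_def \<kappa>_def algebra_simps)
      finally show "\<bar>D y v\<bar> \<le> \<bar>stable_kernel P (\<lambda>v. \<kappa> r * F v) y v + stable_kernel Q (\<lambda>v. \<kappa> r * F v) y v\<bar>"
        by (rule order_trans) (rule abs_ge_self)
    qed
    also have "\<dots> \<le> 4 * (energy (stable_kernel P (\<lambda>v. \<kappa> r * F v)) + energy (stable_kernel Q (\<lambda>v. \<kappa> r * F v)))"
      by (rule energy_add) measurable
    also have "\<dots> = ennreal (G r)"
      using P Q \<kappa>0[of r] KP(1) KQ(1) I0 by (subst KP(2) KQ(2); simp add: FL)+ (simp add: G_def IP_def[symmetric] IQ_def[symmetric] ennreal_mult ennreal_plus)
    finally have ED: "energy D \<le> ennreal (G r)" .
    have G0: "0 \<le> G r" using KP(1) KQ(1) I0 by (simp add: G_def)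
    have fin: "energy D < \<infinity>" using ED by (simp add: le_less_trans[OF _ ennreal_less_top])
    have ER: "enn2real (energy D) \<le> G r" using ED G0 by (simp add: enn2real_leI)
    have "prob {\<omega>\<in>space M. e \<le> \<bar>?q * (Y s \<omega> - Y u \<omega>) - main_term ?a (?B u) u r t \<omega>\<bar>} = prob {\<omega>\<in>space M. 2 * (e / 2) \<le> \<bar>mark_sum D \<omega>\<bar>}"
    proof (rule measure_eq_AE)
      show "AE \<omega> in M. \<omega> \<in> {\<omega>\<in>space M. e \<le> \<bar>?q * (Y s \<omega> - Y u \<omega>) - main_term ?a (?B u) u r t \<omega>\<bar>} \<longleftrightarrow> \<omega> \<in> {\<omega>\<in>space M. 2 * (e / 2) \<le> \<bar>mark_sum D \<omega>\<bar>}"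
        using ae by eventually_elim simp
    qed (unfold Y_def, measurable)
    also have "\<dots> \<le> enn2real (energy D) * (1 + 1 / (e / 2)\<^sup>2)"
      unfolding mark_sum_def by (rule mark_sum_tail[OF Dmeas fin]) (use e in simp)
    also have "\<dots> \<le> G r * (1 + 1 / (e / 2)\<^sup>2)" by (rule mult_right_mono[OF ER]) simp
    finally show ?thesis by (simp add: s_def)
  qed
  have "((\<lambda>r. r powr (1 - 1 / ?a)) \<longlongrightarrow> 0) (at_right 0)"
    by (rule tendsto_zero_powrI[OF _ tendsto_const]) (use ab[of u] in \<open>auto simp: eventually_at_filter intro: tendsto_ident_at\<close>)
  then have "(\<kappa> \<longlongrightarrow> C * \<bar>t\<bar> * 0) (at_right 0)" unfolding \<kappa>_def[abs_def] by (intro tendsto_intros)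
  then have \<kappa>lim: "(\<kappa> \<longlongrightarrow> 0) (at_right 0)" by simp
  have pl: "((\<lambda>r. \<kappa> r powr (1 / p)) \<longlongrightarrow> 0) (at_right 0)" if "0 < p" for p
    by (rule tendsto_zero_powrI[OF \<kappa>lim tendsto_const]) (use \<kappa>0 that in auto)
  have "((\<lambda>r. G r * (1 + 1 / (e / 2)\<^sup>2)) \<longlongrightarrow> 4 * (KP * 0 * IP + KQ * 0 * IQ) * (1 + 1 / (e / 2)\<^sup>2)) (at_right 0)"
    unfolding G_def[abs_def] by (intro tendsto_intros pl) (use P Q in auto)
  then have Glim: "((\<lambda>r. G r * (1 + 1 / (e / 2)\<^sup>2)) \<longlongrightarrow> 0) (at_right 0)" by simp
  have "((\<lambda>r. \<bar>r * t\<bar>) \<longlongrightarrow> \<bar>0 * t\<bar>) (at_right 0)" by (intro tendsto_intros)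
  then have "eventually (\<lambda>r. \<bar>r * t\<bar> < \<delta>) (at_right 0)" by (rule order_tendstoD) (use C(2) in simp)
  moreover have "eventually (\<lambda>r::real. 0 < r) (at_right 0)" by (simp add: eventually_at_filter)
  ultimately have ev: "eventually (\<lambda>r. prob {\<omega>\<in>space M. e \<le> \<bar>r powr (- (1 / ?a)) * (Y (u + r * t) \<omega> - Y u \<omega>) - main_term ?a (?B u) u r t \<omega>\<bar>}
     \<le> G r * (1 + 1 / (e / 2)\<^sup>2)) (at_right 0)"
    by eventually_elim (rule bound)
  show ?thesis
    by (rule tendsto_sandwich[OF _ ev tendsto_const Glim]) simp
qed

text \<open>
  The LePage series of all integrands, viewed as one random function on the space of integrands.
  Non-integrable arguments are sent to \<open>0\<close>.
\<close>

lemma sas_random_measure_exists: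
  assumes a: "1 < a" "a < 2"
  shows "\<exists>(N :: ((real \<Rightarrow> real) \<Rightarrow> real) measure) I. sas_random_measure N a I"
proof -
  have a0: "0 < a" using a by simp
  \<comment> \<open>the normalisation \<open>C\<^sub>a powr (1/a)\<close>\<close>
  define c where "c = inverse (sine_moment a) powr (1 / a)"
  have c0: "0 < c" and ca: "c powr a * sine_moment a = 1"
    using sine_moment_pos[OF a] a0 by (simp_all add: c_def powr_powr)
  define \<Phi> where "\<Phi> f \<omega> = (if f \<in> L_space a then c * mark_sum (stable_kernel (1 / a) f) \<omega> else 0)" for f \<omega>
  have \<Phi>m[measurable]: "\<Phi> f \<in> borel_measurable M" for f
  proof (cases "f \<in> L_space a")
    case True
    then have [measurable]: "f \<in> borel_measurable borel" by (simp add: L_space_def)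
    show ?thesis unfolding \<Phi>_def[abs_def] using True by simp
  qed (simp add: \<Phi>_def[abs_def])
  let ?P = "PiM UNIV (\<lambda>_ :: real \<Rightarrow> real. borel :: real measure)"
  have map: "(\<lambda>\<omega> f. \<Phi> f \<omega>) \<in> measurable M ?P"
    by (rule measurable_PiM_single') (auto simp: space_PiM)
  define N where "N = distr M ?P (\<lambda>\<omega> f. \<Phi> f \<omega>)"
  define I where "I f \<phi> = \<phi> f" for f :: "real \<Rightarrow> real" and \<phi> :: "(real \<Rightarrow> real) \<Rightarrow> real"
  have Im: "I f \<in> borel_measurable ?P" for f unfolding I_def[abs_def] by (rule measurable_component_singleton) simp
  have p: "1 / 2 < 1 / a" "1 / a < 1" using a by (simp_all add: field_simps)
  have fin: "energy (stable_kernel (1 / a) f) < \<infinity>" if "f \<in> L_space a" for f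
    by (rule energy_stable_kernel_finite[OF p]) (use that in simp)
  have sk: "case_prod (stable_kernel (1 / a) f) \<in> borel_measurable (borel \<Otimes>\<^sub>M borel)" if "f \<in> L_space a" for f
    using that by (intro stable_kernel_measurable) (simp add: L_space_def)
  have lin: "AE \<omega> in M. mark_sum (stable_kernel (1 / a) (\<lambda>x. p * f x + q * g x)) \<omega> = p * mark_sum (stable_kernel (1 / a) f) \<omega> + q * mark_sum (stable_kernel (1 / a) g) \<omega>"
    if f: "f \<in> L_space a" and g: "g \<in> L_space a" for f g p q
  proof -
    have "stable_kernel (1 / a) (\<lambda>x. p * f x + q * g x) = (\<lambda>y v. p * stable_kernel (1 / a) f y v + q * stable_kernel (1 / a) g y v)"
      by (simp add: stable_kernel_def fun_eq_iff algebra_simps)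
    then show ?thesis using mark_sum_linear[OF sk[OF f] fin[OF f] sk[OF g] fin[OF g], of p q] by simp
  qed
  have "sas_random_measure N a I"
    unfolding sas_random_measure_def
  proof (intro conjI ballI allI)
    show "prob_space N" unfolding N_def by (rule prob_space_distr[OF map])
    fix f assume f: "f \<in> L_space a"
    show "I f \<in> borel_measurable N" unfolding N_def using Im by simp
    fix \<theta> :: real
    have "char (distr N borel (I f)) \<theta> = (CLINT \<omega>|M. iexp (\<theta> * \<Phi> f \<omega>))"
    proof -
      have "distr N borel (I f) = distr M borel (\<Phi> f)"
        unfolding N_def by (subst distr_distr[OF Im map]) (simp add: comp_def I_def)
      then show ?thesis unfolding char_def by (simp add: integral_distr)
    qed
    also have "\<dots> = (CLINT \<omega>|M. iexp (mark_sum (stable_kernel (1 / a) (\<lambda>v. (\<theta> * c) * f v)) \<omega>))"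
    proof (rule integral_cong_AE)
      have [measurable]: "f \<in> borel_measurable borel" using f by (simp add: L_space_def)
      show "(\<lambda>\<omega>. iexp (mark_sum (stable_kernel (1 / a) (\<lambda>v. (\<theta> * c) * f v)) \<omega>)) \<in> borel_measurable M" by measurable
      show "AE \<omega> in M. iexp (\<theta> * \<Phi> f \<omega>) = iexp (mark_sum (stable_kernel (1 / a) (\<lambda>v. (\<theta> * c) * f v)) \<omega>)"
        using lin[OF f f, of "\<theta> * c" 0] by eventually_elim (simp add: \<Phi>_def f mult.assoc)
    qed measurable
    also have "\<dots> = of_real (exp (- (sine_moment a * (LINT v|lborel. \<bar>(\<theta> * c) * f v\<bar> powr a))))"
      by (rule stable_char[OF a L_space_cmult[OF a0 f]])
    also have "sine_moment a * (LINT v|lborel. \<bar>(\<theta> * c) * f v\<bar> powr a) = \<bar>\<theta>\<bar> powr a * (LINT x|lborel. \<bar>f x\<bar> powr a)"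
    proof -
      have "\<bar>(\<theta> * c) * f v\<bar> powr a = (\<bar>\<theta>\<bar> powr a * c powr a) * \<bar>f v\<bar> powr a" for v
        using c0 by (simp add: abs_mult powr_mult)
      then have "sine_moment a * (LINT v|lborel. \<bar>(\<theta> * c) * f v\<bar> powr a) = (c powr a * sine_moment a) * (\<bar>\<theta>\<bar> powr a * (LINT x|lborel. \<bar>f x\<bar> powr a))"
        by (simp add: mult_ac)
      then show ?thesis unfolding ca by simp
    qed
    finally show "char (distr N borel (I f)) \<theta> = of_real (exp (- (\<bar>\<theta>\<bar> powr a) * (LINT x|lborel. \<bar>f x\<bar> powr a)))"
      by simp
  next
    fix f g p q assume f: "f \<in> L_space a" and g: "g \<in> L_space a"
    have [measurable]: "I h \<in> borel_measurable ?P" for h by (rule Im)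
    have "AE \<omega> in M. \<Phi> (\<lambda>x. p * f x + q * g x) \<omega> = p * \<Phi> f \<omega> + q * \<Phi> g \<omega>"
      using lin[OF f g, of p q] by eventually_elim (simp add: \<Phi>_def f g L_space_linear[OF a0 f g] algebra_simps)
    then show "AE \<phi> in N. I (\<lambda>x. p * f x + q * g x) \<phi> = p * I f \<phi> + q * I g \<phi>"
      unfolding N_def by (subst AE_distr_iff[OF map]) (simp_all add: I_def)
  qed
  then show ?thesis by blast
qed

end

lemma has_real_derivative_of_C1:
  fixes f :: "real \<Rightarrow> real"
  assumes "f C1_differentiable_on UNIV" obtains D where "(f has_real_derivative D) (at u)"
  using assms unfolding C1_differentiable_on_def has_real_derivative_iff_has_vector_derivative by blast

lemma levy_motion_nontrivial:
  assumes S: "sas_random_measure N a I" and a: "0 < a" and b: "0 < b"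
  shows "nontrivial_process N (\<lambda>t \<omega>. b * levy_motion I t \<omega>)"
  unfolding nontrivial_process_def
proof (intro exI notI)
  interpret prob_space N using S unfolding sas_random_measure_def by blast
  assume "AE \<omega> in N. b * levy_motion I 1 \<omega> = 0"
  then have ae: "AE \<omega> in N. I (indicator {0..1}) \<omega> = 0"
    by eventually_elim (use b in \<open>simp add: levy_motion_def\<close>)
  have L: "indicator {0..1} \<in> L_space a" by (rule L_space_indicator) auto
  have [measurable]: "I (indicator {0..1}) \<in> borel_measurable N" using S L unfolding sas_random_measure_def by blast
  have "(CLINT \<omega>|N. iexp (1 * I (indicator {0..1}) \<omega>)) = (CLINT \<omega>|N. 1)"
    by (rule integral_cong_AE) (use ae in auto)
  then have "exp (- (1 powr a) * (LINT x|lborel. \<bar>indicator {0..1::real} x\<bar> powr a)) = (1::real)"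
    unfolding sas_char[OF S L] by (simp add: prob_space flip: of_real_exp)
  moreover have "(LINT x|lborel. \<bar>indicator {0..1::real} x\<bar> powr a) = (LINT x|lborel. indicator {0..1::real} x)"
    by (intro Bochner_Integration.integral_cong) (auto simp: indicator_def)
  ultimately show False by simp
qed

text \<open>
  Main term and remainder are put together; the law of the random measure enters only through the joint
  characteristic functions.
\<close>

lemma series_process_localisable:
  fixes M :: "'a measure" and N :: "'b measure"
  assumes M: "prob_space M" and lam: "lam > 0" and cd: "1 < c" "d < 2" "\<And>t. \<alpha> t \<in> {c..d}"
    and b: "\<And>t. b t > 0"
    and C1: "\<alpha> C1_differentiable_on UNIV" "b C1_differentiable_on UNIV"
    and \<Gamma>: "unit_poisson_arrivals M \<Gamma>" and V: "iid_mhat M V" and \<gamma>: "iid_signs M \<gamma>"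
    and ind: "indep_sequences3 M \<Gamma> V \<gamma>"
    and S: "sas_random_measure N (\<alpha> u) I"
  shows "localisable_with_form M (series_process lam \<alpha> b \<Gamma> V \<gamma>) (1 / \<alpha> u) u N (\<lambda>t \<omega>. b u * levy_motion I t \<omega>)"
proof -
  interpret P: marked_poisson M "arrival_gap \<Gamma>" V \<gamma> mhat_density
    by (rule marked_poisson_of_assumptions[OF M \<Gamma> V \<gamma> ind])
  let ?a = "\<alpha> u" and ?Y = "series_process lam \<alpha> b \<Gamma> V \<gamma>"
  define Y' where "Y' s \<omega> = amplitude \<alpha> b s * P.mark_sum (P.stable_kernel (1 / \<alpha> s) (ou_kernel lam s)) \<omega>" for s \<omega>
  have a: "1 < ?a" "?a < 2" using cd(1,2) cd(3)[of u] by auto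
  have N: "prob_space N" using S unfolding sas_random_measure_def by blast
  have eq: "?Y = Y'"
    unfolding Y'_def by (intro ext series_process_eq_mark_sum[OF M \<Gamma> V \<gamma> ind])
  have [measurable]: "ou_kernel lam s \<in> borel_measurable borel" for s unfolding ou_kernel_def[abs_def] by measurable
  have Ym[measurable]: "?Y s \<in> borel_measurable M" for s unfolding eq Y'_def[abs_def] by measurable
  have Lm[measurable]: "levy_motion I t \<in> borel_measurable N" for t by (rule levy_motion_measurable[OF S])
  obtain a' where a': "(\<alpha> has_real_derivative a') (at u)" using has_real_derivative_of_C1[OF C1(1)] by blast
  obtain b' where b': "(b has_real_derivative b') (at u)" using has_real_derivative_of_C1[OF C1(2)] by blast
  let ?B = "amplitude \<alpha> b u"
  have sp: "sine_moment ?a > 0" by (rule sine_moment_pos[OF a])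
  have B0: "0 \<le> ?B" using b[of u] by (simp add: amplitude_def)
  \<comment> \<open>The constant in the amplitude normalises the scale of the stable integral.\<close>
  have Ba: "sine_moment ?a * ?B powr ?a = b u powr ?a"
    using b[of u] sp a by (simp add: amplitude_def C_const_sine_moment powr_mult powr_powr)
  have "fdd_converges M (\<lambda>r t \<omega>. r powr (- (1 / ?a)) * (?Y (u + r * t) \<omega> - ?Y u \<omega>)) (at_right 0) N (\<lambda>t \<omega>. b u * levy_motion I t \<omega>)"
  proof (rule fdd_convergesI[OF M N, where A="\<lambda>r t. P.main_term ?a ?B u r t"])
    have "eventually (\<lambda>r::real. 0 < r) (at_right 0)" by (simp add: eventually_at_filter)
    then show "eventually (\<lambda>r. \<forall>T \<xi>. finite T \<longrightarrow>
       (CLINT \<omega>|M. iexp (\<Sum>t\<in>T. \<xi> t * P.main_term ?a ?B u r t \<omega>)) = (CLINT \<omega>|N. iexp (\<Sum>t\<in>T. \<xi> t * (b u * levy_motion I t \<omega>)))) (at_right 0)"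
    proof eventually_elim
      case (elim r)
      show ?case
      proof (intro allI impI)
        fix T \<xi> assume T: "finite (T :: real set)"
        have a0: "0 < ?a" using a by simp
        show "(CLINT \<omega>|M. iexp (\<Sum>t\<in>T. \<xi> t * P.main_term ?a ?B u r t \<omega>)) = (CLINT \<omega>|N. iexp (\<Sum>t\<in>T. \<xi> t * (b u * levy_motion I t \<omega>)))"
          unfolding P.main_term_char[OF a elim T B0] levy_motion_joint_char[OF S a0 T b[of u]] Ba ..
      qed
    qed
    fix t e :: real assume e: "0 < e"
    show "((\<lambda>r. measure M {\<omega>\<in>space M. e \<le> \<bar>r powr (- (1 / ?a)) * (?Y (u + r * t) \<omega> - ?Y u \<omega>) - P.main_term ?a ?B u r t \<omega>\<bar>}) \<longlongrightarrow> 0) (at_right 0)"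
      using P.remainder_tendsto_0[OF lam cd b a' b' e, of t] unfolding eq Y'_def .
  qed (measurable)
  moreover have "process M ?Y" unfolding process_def using M Ym by blast
  moreover have "process N (\<lambda>t \<omega>. b u * levy_motion I t \<omega>)" unfolding process_def using N by simp
  moreover have "nontrivial_process N (\<lambda>t \<omega>. b u * levy_motion I t \<omega>)"
    by (rule levy_motion_nontrivial[OF S]) (use a b in auto)
  ultimately show ?thesis unfolding localisable_with_form_def by simp
qed

theorem theorem10:
  fixes M :: "'a measure"
    and lam c d :: real
    and \<alpha> b :: "real \<Rightarrow> real"
    and \<Gamma> V \<gamma> :: "nat \<Rightarrow> 'a \<Rightarrow> real"
    and u :: real
  assumes "prob_space M"
    and "lam > 0"
    and "1 < c" and "d < 2" and "\<And>t. \<alpha> t \<in> {c..d}"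
    and "\<And>t. b t > 0"
    and "\<alpha> C1_differentiable_on UNIV" and "b C1_differentiable_on UNIV"
    and "unit_poisson_arrivals M \<Gamma>"
    and "iid_mhat M V"
    and "iid_signs M \<gamma>"
    and "indep_sequences3 M \<Gamma> V \<gamma>"
  shows "(\<exists>(N :: ((real \<Rightarrow> real) \<Rightarrow> real) measure) I.
            sas_random_measure N (\<alpha> u) I \<and>
            localisable_with_form M (series_process lam \<alpha> b \<Gamma> V \<gamma>) (1 / \<alpha> u) u
              N (\<lambda>t \<omega>. b u * levy_motion I t \<omega>)) \<and>
         (\<forall>(N :: 'b measure) I.
            sas_random_measure N (\<alpha> u) I \<longrightarrow>
            localisable_with_form M (series_process lam \<alpha> b \<Gamma> V \<gamma>) (1 / \<alpha> u) u
              N (\<lambda>t \<omega>. b u * levy_motion I t \<omega>))"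
proof -
  interpret P: marked_poisson M "arrival_gap \<Gamma>" V \<gamma> mhat_density
    by (rule marked_poisson_of_assumptions) (fact assms)+
  have a: "1 < \<alpha> u" "\<alpha> u < 2" using assms(3,4) assms(5)[of u] by auto
  note loc = series_process_localisable[OF assms]
  obtain N :: "((real \<Rightarrow> real) \<Rightarrow> real) measure" and I where S: "sas_random_measure N (\<alpha> u) I"
    using P.sas_random_measure_exists[OF a] by blast
  show ?thesis
  proof (intro conjI allI impI)
    show "\<exists>(N :: ((real \<Rightarrow> real) \<Rightarrow> real) measure) I. sas_random_measure N (\<alpha> u) I \<and>
      localisable_with_form M (series_process lam \<alpha> b \<Gamma> V \<gamma>) (1 / \<alpha> u) u N (\<lambda>t \<omega>. b u * levy_motion I t \<omega>)"
      by (intro exI conjI, rule S, rule loc[OF S])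
  qed (rule loc)
qed

end
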